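(* Let $p\in\mathbb{C}[z]$ be a polynomial without multiple roots with $\deg p\ge 3$. Then: (a) For every automorphism $F$ of the Lie algebra $\langle\mathrm{LND}(\mathrm{D}_p)\rangle$ there is an automorphism $\varphi:\mathrm{D}_p\to\mathrm{D}_p$ of varieties such that $F$ coincides with $\mathrm{Ad}(\varphi)$ on $\langle\mathrm{LND}(\mathrm{D}_p)\rangle$. (b) For every automorphism $F$ of the Lie algebra $\mathrm{Vec}^0(\mathrm{D}_p)$ there is an automorphism $\varphi:\mathrm{D}_p\to\mathrm{D}_p$ of varieties such that $F$ coincides with $\mathrm{Ad}(\varphi)$ on $\mathrm{Vec}^0(\mathrm{D}_p)$.
   Context: The base field is $\mathbb{C}$; Lie algebras and their homomorphisms are over $\mathbb{C}$. $\mathrm{D}_p=\{(x,y,z)\in\mathbb{A}^3\mid xy=p(z)\}$. $\mathrm{Vec}(\mathrm{D}_p)$ is the Lie algebra of algebraic vector fields on $\mathrm{D}_p$, identified with the derivations of $\mathcal{O}(\mathrm{D}_p)$. A vector field is locally nilpotent if for the corresponding derivation $D$, for every $f\in\mathcal{O}(\mathrm{D}_p)$ there is $n$ with $D^n(f)=0$. $\langle\mathrm{LND}(\mathrm{D}_p)\rangle$ is the Lie subalgebra of $\mathrm{Vec}(\mathrm{D}_p)$ generated by all locally nilpotent vector fields. Let $\omega_p=\frac1x dx\wedge dz=-\frac1y dy\wedge dz=\frac1{p'(z)}dx\wedge dy$, a nowhere vanishing regular $2$-form on $\mathrm{D}_p$. The divergence of $\theta\in\mathrm{Vec}(\mathrm{D}_p)$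 is the function $\mathrm{div}(\theta)$ with $d(i_\theta\omega_p)=\mathrm{div}(\theta)\,\omega_p$, where $i_\theta$ is contraction, and $\mathrm{Vec}^0(\mathrm{D}_p)=\{\theta\in\mathrm{Vec}(\mathrm{D}_p)\mid\mathrm{div}(\theta)=0\}$. For an automorphism $\varphi$ of $\mathrm{D}_p$ with comorphism $\varphi^*:\mathcal{O}(\mathrm{D}_p)\to\mathcal{O}(\mathrm{D}_p)$, $f\mapsto f\circ\varphi$, and $\delta\in\mathrm{Vec}(\mathrm{D}_p)$, one sets $\mathrm{Ad}(\varphi)\delta=(\varphi^* )^{-1}\circ\delta\circ\varphi^*$. This action preserves both $\langle\mathrm{LND}(\mathrm{D}_p)\rangle$ and $\mathrm{Vec}^0(\mathrm{D}_p)$. *)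

theory Defs
  imports
    Complex_Main
    "HOL-Library.Function_Algebras"
    "HOL-Computational_Algebra.Polynomial"
begin

type_synonym point = "complex \<times> complex \<times> complex"
type_synonym func = "point \<Rightarrow> complex"
type_synonym oper = "func \<Rightarrow> func"

text \<open>
  Addition, subtraction, multiplication, 0 and 1 of functions (and, for addition, subtraction and 0,
  of operators on functions) are the pointwise operations from Function_Algebras.
\<close>

definition poly3 :: "complex poly poly poly \<Rightarrow> func" where
  "poly3 P = (\<lambda>(x, y, z). poly (poly (poly P [:[:x:]:]) [:y:]) z)"

definition surface :: "complex poly \<Rightarrow> point set" where
  "surface p = {(x, y, z). x * y = poly p z}"

text \<open>
  The coordinate ring is the ring of restrictions of polynomial functions to the point set. A function
  on the surface is represented by its extension by zero, so that equality of functions on the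
  surface is equality of HOL functions; the unit of the ring is \<^term>\<open>on_surface p 1\<close>.
\<close>

definition on_surface :: "complex poly \<Rightarrow> func \<Rightarrow> func" where
  "on_surface p f = (\<lambda>v. if v \<in> surface p then f v else 0)"

definition regular :: "complex poly \<Rightarrow> func set" where
  "regular p = {on_surface p (poly3 P) | P. True}"

definition scal :: "complex \<Rightarrow> func \<Rightarrow> func" where
  "scal c f = (\<lambda>v. c * f v)"

text \<open>
  Derivations are only relevant on the coordinate ring; the first clause normalises them elsewhere.
\<close>

definition vec :: "complex poly \<Rightarrow> oper set" where
  "vec p = {D. (\<forall>f. f \<notin> regular p \<longrightarrow> D f = 0) \<and>
               (\<forall>f\<in>regular p. D f \<in> regular p) \<and>
               (\<forall>f\<in>regular p. \<forall>g\<in>regular p. D (f + g) = D f + D g) \<and>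
               (\<forall>c. \<forall>f\<in>regular p. D (scal c f) = scal c (D f)) \<and>
               (\<forall>f\<in>regular p. \<forall>g\<in>regular p. D (f * g) = f * D g + g * D f)}"

definition oscal :: "complex \<Rightarrow> oper \<Rightarrow> oper" where
  "oscal c D = (\<lambda>f. scal c (D f))"

definition bracket :: "oper \<Rightarrow> oper \<Rightarrow> oper" where
  "bracket D E = (D \<circ> E) - (E \<circ> D)"

definition lie_subalgebra :: "complex poly \<Rightarrow> oper set \<Rightarrow> bool" where
  "lie_subalgebra p L \<longleftrightarrow>
     L \<subseteq> vec p \<and> 0 \<in> L \<and>
     (\<forall>D\<in>L. \<forall>E\<in>L. D + E \<in> L) \<and>
     (\<forall>c. \<forall>D\<in>L. oscal c D \<in> L) \<and>
     (\<forall>D\<in>L. \<forall>E\<in>L. bracket D E \<in> L)"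

definition lnd :: "complex poly \<Rightarrow> oper set" where
  "lnd p = {D \<in> vec p. \<forall>f\<in>regular p. \<exists>n. (D ^^ n) f = 0}"

definition lnd_algebra :: "complex poly \<Rightarrow> oper set" where
  "lnd_algebra p = lie_subalgebra p hull lnd p"

definition lie_automorphism :: "oper set \<Rightarrow> (oper \<Rightarrow> oper) \<Rightarrow> bool" where
  "lie_automorphism L F \<longleftrightarrow>
     bij_betw F L L \<and>
     (\<forall>D\<in>L. \<forall>E\<in>L. F (D + E) = F D + F E) \<and>
     (\<forall>c. \<forall>D\<in>L. F (oscal c D) = oscal c (F D)) \<and>
     (\<forall>D\<in>L. \<forall>E\<in>L. F (bracket D E) = bracket (F D) (F E))"

text \<open>
  Since the surface is smooth and affine, its regular forms of degree k are the alternating k-linear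
  maps over the coordinate ring from vector fields to regular functions. Forms are represented by
  these maps; the exterior derivative of a 1-form is given by the invariant formula.
\<close>

definition coord_x :: "complex poly \<Rightarrow> func" where
  "coord_x p = on_surface p (\<lambda>(x, y, z). x)"

definition coord_y :: "complex poly \<Rightarrow> func" where
  "coord_y p = on_surface p (\<lambda>(x, y, z). y)"

definition coord_z :: "complex poly \<Rightarrow> func" where
  "coord_z p = on_surface p (\<lambda>(x, y, z). z)"

text \<open>The 2-form \<open>df \<and> dg\<close>.\<close>

definition dwedge :: "func \<Rightarrow> func \<Rightarrow> oper \<Rightarrow> oper \<Rightarrow> func" where
  "dwedge f g = (\<lambda>D E. D f * E g - D g * E f)"

text \<open>
  The three expressions for the volume form, each used where its denominator does not vanish;
  lemma \<open>omega_charts\<close> below shows that they agree on overlaps.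
\<close>

definition omega :: "complex poly \<Rightarrow> oper \<Rightarrow> oper \<Rightarrow> func" where
  "omega p D E = (\<lambda>(x, y, z).
     if x \<noteq> 0 then dwedge (coord_x p) (coord_z p) D E (x, y, z) / x
     else if y \<noteq> 0 then - (dwedge (coord_y p) (coord_z p) D E (x, y, z) / y)
     else dwedge (coord_x p) (coord_y p) D E (x, y, z) / poly (pderiv p) z)"

definition contract :: "oper \<Rightarrow> (oper \<Rightarrow> oper \<Rightarrow> func) \<Rightarrow> oper \<Rightarrow> func" where
  "contract D w = (\<lambda>E. w D E)"

definition ext_deriv :: "(oper \<Rightarrow> func) \<Rightarrow> oper \<Rightarrow> oper \<Rightarrow> func" where
  "ext_deriv a = (\<lambda>D E. D (a E) - E (a D) - a (bracket D E))"

definition divergence :: "complex poly \<Rightarrow> oper \<Rightarrow> func" where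
  "divergence p T = (THE g. g \<in> regular p \<and>
     (\<forall>D\<in>vec p. \<forall>E\<in>vec p. ext_deriv (contract T (omega p)) D E = g * omega p D E))"

definition vec0 :: "complex poly \<Rightarrow> oper set" where
  "vec0 p = {T \<in> vec p. divergence p T = 0}"

definition morphism :: "complex poly \<Rightarrow> (point \<Rightarrow> point) \<Rightarrow> bool" where
  "morphism p \<phi> \<longleftrightarrow>
     \<phi> ` surface p \<subseteq> surface p \<and>
     (\<exists>P Q R. \<forall>v\<in>surface p. \<phi> v = (poly3 P v, poly3 Q v, poly3 R v))"

definition variety_automorphism :: "complex poly \<Rightarrow> (point \<Rightarrow> point) \<Rightarrow> bool" where
  "variety_automorphism p \<phi> \<longleftrightarrow>
     morphism p \<phi> \<and>
     (\<exists>\<psi>. morphism p \<psi> \<and> (\<forall>v\<in>surface p. \<psi> (\<phi> v) = v \<and> \<phi> (\<psi> v) = v))"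

definition comorphism :: "complex poly \<Rightarrow> (point \<Rightarrow> point) \<Rightarrow> func \<Rightarrow> func" where
  "comorphism p \<phi> f = on_surface p (f \<circ> \<phi>)"

definition Ad :: "complex poly \<Rightarrow> (point \<Rightarrow> point) \<Rightarrow> oper \<Rightarrow> oper" where
  "Ad p \<phi> D = (\<lambda>f. if f \<in> regular p
     then inv_into (regular p) (comorphism p \<phi>) (D (comorphism p \<phi> f)) else 0)"


lemma poly3_add: "poly3 (P + Q) = poly3 P + poly3 Q"
  by (auto simp: poly3_def fun_eq_iff)

lemma poly3_mult: "poly3 (P * Q) = poly3 P * poly3 Q"
  by (auto simp: poly3_def fun_eq_iff)

lemma poly3_const: "poly3 [:[:q:]:] (x, y, z) = poly q z"
  by (simp add: poly3_def)

lemma regularI: "(\<And>v. v \<in> surface p \<Longrightarrow> f v = poly3 P v) \<Longrightarrow> (\<And>v. v \<notin> surface p \<Longrightarrow> f v = 0) \<Longrightarrow> f \<in> regular p"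
  unfolding regular_def on_surface_def by (auto intro!: exI[of _ P])

lemma regularE:
  assumes "f \<in> regular p"
  obtains P where "f = on_surface p (poly3 P)"
  using assms by (auto simp: regular_def)

lemma regular_outside: "f \<in> regular p \<Longrightarrow> v \<notin> surface p \<Longrightarrow> f v = 0"
  by (auto simp: regular_def on_surface_def)

lemma regular_add: "f \<in> regular p \<Longrightarrow> g \<in> regular p \<Longrightarrow> f + g \<in> regular p"
  by (elim regularE, rule regularI[of _ _ "_ + _"]) (auto simp: on_surface_def poly3_add)

lemma regular_mult: "f \<in> regular p \<Longrightarrow> g \<in> regular p \<Longrightarrow> f * g \<in> regular p"
  by (elim regularE, rule regularI[of _ _ "_ * _"]) (auto simp: on_surface_def poly3_mult)

lemma regular_scal: "f \<in> regular p \<Longrightarrow> scal c f \<in> regular p"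
proof (elim regularE)
  fix P assume f: "f = on_surface p (poly3 P)"
  have "poly3 ([:[:[:c:]:]:] * P) v = c * poly3 P v" for v
    by (simp only: poly3_mult times_fun_def) (simp add: poly3_def split: prod.split)
  with f show ?thesis
    by (intro regularI[of _ _ "[:[:[:c:]:]:] * P"]) (auto simp: on_surface_def scal_def)
qed

lemma regular_poly_z: "on_surface p (\<lambda>(x, y, z). poly q z) \<in> regular p"
  by (rule regularI[of _ _ "[:[:q:]:]"]) (auto simp: on_surface_def poly3_const)

lemma regular_zero: "0 \<in> regular p"
  by (rule regularI[of _ _ 0]) (auto simp: poly3_def)

lemma regular_one: "on_surface p 1 \<in> regular p"
  using regular_poly_z[of p 1] by (simp add: on_surface_def cong: if_cong)

lemma regular_coord: "coord_x p \<in> regular p" "coord_y p \<in> regular p" "coord_z p \<in> regular p"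
proof -
  show "coord_x p \<in> regular p"
    by (rule regularI[of _ _ "[:0, 1:]"]) (auto simp: coord_x_def on_surface_def poly3_def)
  show "coord_y p \<in> regular p"
    by (rule regularI[of _ _ "[:[:0, 1:]:]"]) (auto simp: coord_y_def on_surface_def poly3_def)
  show "coord_z p \<in> regular p"
    by (rule regularI[of _ _ "[:[:[:0, 1:]:]:]"]) (auto simp: coord_z_def on_surface_def poly3_def)
qed

lemma regular_diff: "f \<in> regular p \<Longrightarrow> g \<in> regular p \<Longrightarrow> f - g \<in> regular p"
  using regular_add[of f p "scal (-1) g"] regular_scal[of g p "-1"]
  by (simp add: scal_def fun_diff_def plus_fun_def)

context
  fixes p :: "complex poly" and D :: oper
  assumes D: "D \<in> vec p"
begin

lemma vec_regular: "f \<in> regular p \<Longrightarrow> D f \<in> regular p"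
  and vec_add: "f \<in> regular p \<Longrightarrow> g \<in> regular p \<Longrightarrow> D (f + g) = D f + D g"
  and vec_scal: "f \<in> regular p \<Longrightarrow> D (scal c f) = scal c (D f)"
  and vec_mult: "f \<in> regular p \<Longrightarrow> g \<in> regular p \<Longrightarrow> D (f * g) = f * D g + g * D f"
  and vec_outside: "f \<notin> regular p \<Longrightarrow> D f = 0"
  using D by (auto simp: vec_def)

lemma vec_zero: "D 0 = 0"
proof -
  have "D (scal 0 0) = scal 0 (D 0)"
    by (rule vec_scal[OF regular_zero])
  then show ?thesis by (simp add: scal_def zero_fun_def)
qed

lemma vec_diff: "f \<in> regular p \<Longrightarrow> g \<in> regular p \<Longrightarrow> D (f - g) = D f - D g"
proof -
  assume f: "f \<in> regular p" and g: "g \<in> regular p"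
  have "D (f - g + g) = D (f - g) + D g"
    by (rule vec_add[OF regular_diff[OF f g] g])
  then show ?thesis by simp
qed

lemma vec_one: "D (on_surface p 1) = 0"
proof
  fix v
  let ?e = "on_surface p 1"
  have e: "?e * ?e = ?e" by (auto simp: on_surface_def fun_eq_iff)
  have "D ?e v = ?e v * D ?e v + ?e v * D ?e v"
    using arg_cong[OF vec_mult[OF regular_one regular_one], of "\<lambda>h. h v"] e by simp
  moreover have "v \<notin> surface p \<Longrightarrow> D ?e v = 0"
    using regular_outside vec_regular regular_one by blast
  ultimately show "D ?e v = 0 v"
    by (cases "v \<in> surface p") (auto simp: on_surface_def)
qed

lemma vec_poly_z:
  "D (on_surface p (\<lambda>(x, y, z). poly q z)) = on_surface p (\<lambda>(x, y, z). poly (pderiv q) z) * D (coord_z p)"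
proof (induction q)
  case 0
  have "on_surface p (\<lambda>(x, y, z). poly 0 z) = 0"
    by (auto simp: on_surface_def fun_eq_iff)
  then show ?case by (simp only: pderiv_0 vec_zero mult_zero_left)
next
  case (pCons a q)
  let ?Q = "\<lambda>q. on_surface p (\<lambda>(x, y, z). poly q z)"
  have eq: "?Q (pCons a q) = scal a (on_surface p 1) + coord_z p * ?Q q"
    by (auto simp: on_surface_def fun_eq_iff scal_def coord_z_def)
  have "D (?Q (pCons a q)) = scal a (D (on_surface p 1)) + (coord_z p * D (?Q q) + ?Q q * D (coord_z p))"
    unfolding eq
    by (subst vec_add vec_scal vec_mult; (intro regular_scal regular_mult regular_one regular_coord regular_poly_z)?)+
       (rule refl)
  also have "\<dots> = coord_z p * (?Q (pderiv q) * D (coord_z p)) + ?Q q * D (coord_z p)"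
    by (simp add: vec_one pCons.IH scal_def zero_fun_def plus_fun_def)
  also have "\<dots> = ?Q (pderiv (pCons a q)) * D (coord_z p)"
    by (auto simp: fun_eq_iff on_surface_def coord_z_def pderiv_pCons algebra_simps)
  finally show ?case .
qed

lemma vec_equation:
  assumes "(x, y, z) \<in> surface p"
  shows "x * D (coord_y p) (x, y, z) + y * D (coord_x p) (x, y, z)
           = poly (pderiv p) z * D (coord_z p) (x, y, z)"
proof -
  have eq: "coord_x p * coord_y p = on_surface p (\<lambda>(x, y, z). poly p z)"
    by (auto simp: coord_x_def coord_y_def on_surface_def fun_eq_iff surface_def)
  have "coord_x p * D (coord_y p) + coord_y p * D (coord_x p)
          = on_surface p (\<lambda>(x, y, z). poly (pderiv p) z) * D (coord_z p)"
    using vec_mult[OF regular_coord(1,2)] vec_poly_z[of p] eq by simp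
  from arg_cong[OF this, of "\<lambda>h. h (x, y, z)"] assms show ?thesis
    by (simp add: coord_x_def coord_y_def on_surface_def)
qed

end

lemma vec_lie_subalgebra: "lie_subalgebra p (vec p)"
proof -
  have "bracket D E \<in> vec p" if D: "D \<in> vec p" and E: "E \<in> vec p" for D E
    unfolding vec_def mem_Collect_eq
  proof (intro conjI allI ballI impI)
    have *: "bracket D E f = D (E f) - E (D f)" for f
      by (simp add: bracket_def)
    note reg = vec_regular[OF D] vec_regular[OF E] regular_scal regular_add regular_mult
    note lin = vec_add[OF D] vec_add[OF E] vec_scal[OF D] vec_scal[OF E] vec_mult[OF D] vec_mult[OF E]
    show "bracket D E f = 0" if "f \<notin> regular p" for f
      unfolding * vec_outside[OF D that] vec_outside[OF E that] vec_zero[OF D] vec_zero[OF E]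
      by (rule diff_self)
    show "bracket D E f \<in> regular p" if "f \<in> regular p" for f
      unfolding * using that by (intro regular_diff reg)
    show "bracket D E (f + g) = bracket D E f + bracket D E g"
      if "f \<in> regular p" "g \<in> regular p" for f g
      using that by (simp only: * reg lin) (simp only: algebra_simps)
    show "bracket D E (scal c f) = scal c (bracket D E f)" if "f \<in> regular p" for c f
      using that by (simp only: * reg lin) (simp add: scal_def fun_eq_iff algebra_simps)
    show "bracket D E (f * g) = f * bracket D E g + g * bracket D E f"
      if "f \<in> regular p" "g \<in> regular p" for f g
      using that by (simp only: * reg lin) (simp only: algebra_simps)
  qed
  moreover have "D + E \<in> vec p" if "D \<in> vec p" "E \<in> vec p" for D E
    unfolding vec_def mem_Collect_eq using that
    by (intro conjI allI ballI impI;
        simp add: vec_regular vec_add vec_scal vec_mult vec_outside regular_add fun_eq_iff;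
        simp add: scal_def algebra_simps)
  moreover have "oscal c D \<in> vec p" if "D \<in> vec p" for c D
    unfolding vec_def mem_Collect_eq oscal_def using that
    by (intro conjI allI ballI impI;
        simp add: vec_regular vec_add vec_scal vec_mult vec_outside regular_scal fun_eq_iff;
        simp add: scal_def algebra_simps)
  moreover have "0 \<in> vec p"
    by (auto simp: vec_def scal_def regular_zero fun_eq_iff)
  ultimately show ?thesis
    by (auto simp: lie_subalgebra_def)
qed

lemma rsquarefree_pderiv:
  fixes p :: "complex poly"
  assumes "rsquarefree p" "poly p z = 0"
  shows "poly (pderiv p) z \<noteq> 0"
  using assms by (auto simp: rsquarefree_roots)

context
  fixes p :: "complex poly" and D E :: oper
  assumes p: "rsquarefree p" and D: "D \<in> vec p" and E: "E \<in> vec p"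
begin

lemma omega_charts:
  assumes v: "(x, y, z) \<in> surface p"
  shows "x * omega p D E (x, y, z) = dwedge (coord_x p) (coord_z p) D E (x, y, z)"
    and "- y * omega p D E (x, y, z) = dwedge (coord_y p) (coord_z p) D E (x, y, z)"
    and "poly (pderiv p) z * omega p D E (x, y, z) = dwedge (coord_x p) (coord_y p) D E (x, y, z)"
proof -
  define a b c where "a = D (coord_x p) (x, y, z)" and "b = D (coord_y p) (x, y, z)"
    and "c = D (coord_z p) (x, y, z)"
  define a' b' c' where "a' = E (coord_x p) (x, y, z)" and "b' = E (coord_y p) (x, y, z)"
    and "c' = E (coord_z p) (x, y, z)"
  note d = a_def[symmetric] b_def[symmetric] c_def[symmetric]
    a'_def[symmetric] b'_def[symmetric] c'_def[symmetric]
  define q where "q = poly (pderiv p) z"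
  have e1: "x * b + y * a = q * c" and e2: "x * b' + y * a' = q * c'"
    using vec_equation[OF D v] vec_equation[OF E v] by (simp_all add: d q_def)
  have ne: "x \<noteq> 0 \<or> y \<noteq> 0 \<or> q \<noteq> 0"
    using rsquarefree_pderiv[OF p, of z] v by (auto simp: surface_def q_def)
  define A B C where "A = dwedge (coord_x p) (coord_z p) D E (x, y, z)"
    and "B = dwedge (coord_y p) (coord_z p) D E (x, y, z)"
    and "C = dwedge (coord_x p) (coord_y p) D E (x, y, z)"
  have A: "A = a * c' - c * a'" and B: "B = b * c' - c * b'" and C: "C = a * b' - b * a'"
    by (simp_all add: dwedge_def A_def B_def C_def d mult.commute)
  have AB: "x * B + y * A = 0" and AC: "x * C = q * A" and BC: "- y * C = q * B"
    unfolding A B C using e1 e2 by algebra+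
  have om: "omega p D E (x, y, z) = (if x \<noteq> 0 then A / x else if y \<noteq> 0 then - (B / y) else C / q)"
    by (simp only: omega_def case_prod_conv A_def B_def C_def q_def)
  have yA: "y * A = - (x * B)" using AB by (simp add: add_eq_0_iff)
  have BC': "C * y = - (B * q)" using BC by (simp add: mult.commute minus_equation_iff)
  have "x * omega p D E (x, y, z) = A \<and> - y * omega p D E (x, y, z) = B \<and> q * omega p D E (x, y, z) = C"
    using ne AC BC' yA unfolding om by (auto simp: field_simps)
  then show "x * omega p D E (x, y, z) = dwedge (coord_x p) (coord_z p) D E (x, y, z)"
    "- y * omega p D E (x, y, z) = dwedge (coord_y p) (coord_z p) D E (x, y, z)"
    "poly (pderiv p) z * omega p D E (x, y, z) = dwedge (coord_x p) (coord_y p) D E (x, y, z)"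
    unfolding A_def B_def C_def q_def by blast+
qed

end

end

theory Submission
  imports Defs
    "HOL-Computational_Algebra.Formal_Laurent_Series"
    "HOL-Computational_Algebra.Polynomial_FPS"
    "HOL-Computational_Algebra.Polynomial_Factorial"
    "HOL-Computational_Algebra.Field_as_Ring"
    "HOL-Computational_Algebra.Fundamental_Theorem_Algebra"
begin

text \<open>
  The coordinate ring carries the Poisson bracket dual to the volume form, with brackets
  \<open>{x, z} = x\<close>, \<open>{y, z} = - y\<close> and \<open>{x, y} = p'(z)\<close>. Every divergence-free vector field is
  Hamiltonian (\<open>divergence_free_hamiltonian\<close>): the potential is found weight by weight for the torus
  action \<open>(t x, y / t, z)\<close>, and the only obstruction, in weight zero, is a constant divisible by \<open>p\<close>.
  A locally nilpotent field preserves the volume form (\<open>locally_nilpotent_divergence_free\<close>). So both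
  Lie algebras of the theorem consist of Hamiltonian fields, and both contain those of the functions
  \<open>x^k\<close> and \<open>y^k\<close>. A linear functional that kills all Poisson brackets but not the constants
  (\<open>period\<close>) normalises potentials, so that an automorphism becomes a bracket-preserving
  bijection \<open>F\<close> of a space \<open>B\<close> of functions.

  Such an \<open>F\<close> knows the multiplication of functions. From \<open>{x^j, x^k z} = j x^(j+k)\<close> the functions
  \<open>F(x^k)\<close> form a geometric progression for large \<open>k\<close>, with a ratio \<open>X\<close> in the fraction field, and
  comparing differentials gives \<open>F(x^k) = c X^k\<close> with a constant \<open>c\<close>. In the same way the images of
  \<open>x^m z^n\<close> for large \<open>m\<close> are \<open>c X^m Z^n\<close> (\<open>F_structure\<close>). Since \<open>{x^m, f}\<close> and \<open>{x^m z, f}\<close> are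
  combinations of such monomials for every function \<open>f\<close> and large \<open>m\<close>, the map \<open>F\<close> is, up to
  additive constants, \<open>c\<close> times the substitution \<open>x, y, z \<mapsto> X, p(Z)/X, Z\<close>
  (\<open>F_is_substitution\<close>). In particular \<open>X\<close> and \<open>Y = p(Z)/X\<close> are regular, as \<open>F(x)\<close> and \<open>F(y)\<close> are.
  That \<open>Z\<close> is regular as well follows because \<open>x\<close> and \<open>y\<close> generate the coordinate ring as a
  Poisson algebra (\<open>poisson_generation\<close>).

  The inverse of \<open>F\<close> yields a second substitution, and the two are inverse to each other
  (\<open>substitutions_inverse\<close>). They are the comorphisms of an automorphism of the surface and of its
  inverse, and \<open>F\<close> is the adjoint action of that automorphism (\<open>automorphism_is_inner\<close>).
\<close>

unbundle fps_syntax
notation fls_nth (infixl "$$" 75)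

section \<open>Evaluation of polynomials over a coefficient map\<close>

text \<open>
  The coefficient map \<open>k\<close> need not preserve the unit: the unit of the coordinate ring is not
  the unit of the ring of all functions on the ambient space. Horner's scheme avoids the unit.
\<close>

definition ev :: "(complex \<Rightarrow> 'a::comm_ring) \<Rightarrow> complex poly \<Rightarrow> 'a \<Rightarrow> 'a" where
  "ev k q a = fold_coeffs (\<lambda>c r. k c + a * r) q 0"

definition ev2 :: "(complex \<Rightarrow> 'a::comm_ring) \<Rightarrow> complex poly poly \<Rightarrow> 'a \<Rightarrow> 'a \<Rightarrow> 'a" where
  "ev2 k Q a b = fold_coeffs (\<lambda>q r. ev k q b + a * r) Q 0"

locale coefficients =
  fixes k :: "complex \<Rightarrow> 'a::comm_ring"
  assumes k_add: "k (c + d) = k c + k d" and k_mult: "k (c * d) = k c * k d"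
begin

lemma k_0 [simp]: "k 0 = 0"
  using k_add[of 0 0] by simp

lemma ev_0 [simp]: "ev k 0 a = 0"
  by (simp add: ev_def)

lemma ev_pCons [simp]: "ev k (pCons c q) a = k c + a * ev k q a"
  by (cases "c = 0 \<and> q = 0") (auto simp: ev_def)

lemma ev_add: "ev k (q + r) a = ev k q a + ev k r a"
  by (induction q r rule: poly_induct2) (simp_all add: k_add algebra_simps)

lemma ev_smult: "ev k (smult c q) a = k c * ev k q a"
  by (induction q) (simp_all add: k_mult algebra_simps)

lemma ev_mult: "ev k (q * r) a = ev k q a * ev k r a"
  by (induction q) (simp_all add: ev_add ev_smult algebra_simps)

lemma ev2_0 [simp]: "ev2 k 0 a b = 0"
  by (simp add: ev2_def)

lemma ev2_pCons [simp]: "ev2 k (pCons q Q) a b = ev k q b + a * ev2 k Q a b"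
  by (cases "q = 0 \<and> Q = 0") (auto simp: ev2_def)

lemma ev2_add: "ev2 k (Q + R) a b = ev2 k Q a b + ev2 k R a b"
  by (induction Q R rule: poly_induct2) (simp_all add: ev_add algebra_simps)

lemma ev2_smult: "ev2 k (smult q Q) a b = ev k q b * ev2 k Q a b"
  by (induction Q) (simp_all add: ev_mult algebra_simps)

lemma ev2_mult: "ev2 k (Q * R) a b = ev2 k Q a b * ev2 k R a b"
  by (induction Q) (simp_all add: ev2_add ev2_smult algebra_simps)

end

section \<open>Iterated Laurent series with two commuting derivations\<close>

text \<open>
  Expanding \<open>y = p(z)/x\<close> embeds the coordinate ring in the field of Laurent series in \<open>x\<close> over
  the Laurent series in \<open>z\<close>. It carries the derivations \<open>x d/dx\<close> and \<open>d/dz\<close>, and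
  an element killed by both is a complex number; the quotients that occur below live there.
\<close>

type_synonym ser = "complex fls fls"

definition con :: "complex \<Rightarrow> ser" where "con c = fls_const (fls_const c)"
definition sx :: ser where "sx = fls_X"
definition sz :: ser where "sz = fls_const fls_X"
definition eu :: "ser \<Rightarrow> ser" where "eu f = fls_X * fls_deriv f"
definition dz :: "ser \<Rightarrow> ser" where "dz f = Abs_fls (\<lambda>n. fls_deriv (f $$ n))"

lemma eu_nth: "eu f $$ n = of_int n * f $$ n"
  by (simp add: eu_def fls_X_times_conv_shift)

lemma dz_nth: "dz f $$ n = fls_deriv (f $$ n)"
proof -
  obtain N where "\<forall>n<N. f $$ n = 0" by (elim fls_nth_vanishes_belowE)
  then have "\<forall>n<N. fls_deriv (f $$ n) = 0" by simp
  then show ?thesis unfolding dz_def by (rule nth_Abs_fls_lower_bound)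
qed

lemma con_0 [simp]: "con 0 = 0" and con_1 [simp]: "con 1 = 1"
  and con_eq_0_iff [simp]: "con c = 0 \<longleftrightarrow> c = 0"
  by (simp_all add: con_def)

lemma con_add: "con (c + d) = con c + con d" and con_mult: "con (c * d) = con c * con d"
  and con_minus: "con (- c) = - con c" and con_diff: "con (c - d) = con c - con d"
  by (simp_all add: con_def fls_plus_const fls_minus_const)

interpretation con: coefficients con
  by standard (simp_all add: con_add con_mult)

lemma con_of_nat: "con (of_nat n) = of_nat n"
  by (induction n) (simp_all add: con_add)

lemma con_inverse: "con (inverse c) = inverse (con c)"
proof (cases "c = 0")
  case False
  then have "con c * con (inverse c) = 1" by (simp flip: con_mult)
  then show ?thesis by (simp add: inverse_unique)
qed simp

lemma con_divide: "con (c / d) = con c / con d"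
  by (simp add: divide_inverse con_mult con_inverse)


locale ser_derivation =
  fixes D :: "ser \<Rightarrow> ser"
  assumes add: "D (f + g) = D f + D g"
    and mult: "D (f * g) = f * D g + g * D f"
    and con [simp]: "D (con c) = 0"
begin

lemma zero [simp]: "D 0 = 0" using con[of 0] by simp
lemma one [simp]: "D 1 = 0" using con[of 1] by simp
lemma minus: "D (- f) = - D f" using add[of f "- f"] by (simp add: eq_neg_iff_add_eq_0 add.commute)
lemma diff: "D (f - g) = D f - D g" using add[of f "- g"] minus by simp
lemma con_times: "D (con c * f) = con c * D f" by (simp add: mult)

lemma power: "D (f ^ n) = of_nat n * f ^ (n - 1) * D f"
proof (induction n)
  case (Suc n)
  then show ?case by (cases n) (simp_all add: mult algebra_simps)
qed simp

lemma divide: "g \<noteq> 0 \<Longrightarrow> D (f / g) = (D f * g - f * D g) / g ^ 2"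
  using mult[of "f / g" g] by (simp add: field_simps power2_eq_square)

lemma ev: "D (ev con q f) = ev con (pderiv q) f * D f"
  by (induction q) (simp_all add: pderiv_pCons con.ev_add add mult algebra_simps)

end

text \<open>
  The range of summation may be any interval that contains the support. Products of different
  pairs of series can then be compared term by term over one common interval.
\<close>

lemma fls_mult_nth_cover:
  fixes f g :: "'a::comm_ring fls"
  assumes "a \<le> fls_subdegree f" "n - fls_subdegree g \<le> b"
  shows "(f * g) $$ n = (\<Sum>i=a..b. f $$ i * g $$ (n - i))"
proof -
  have "(\<Sum>i=fls_subdegree f..n - fls_subdegree g. f $$ i * g $$ (n - i)) =
        (\<Sum>i=a..b. f $$ i * g $$ (n - i))"
    by (rule sum.mono_neutral_left) (use assms in auto)
  then show ?thesis by (simp add: fls_times_nth(2))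
qed

interpretation eu: ser_derivation eu
  by standard (simp_all add: eu_def con_def algebra_simps)

interpretation dz: ser_derivation dz
proof
  fix f g :: ser and c
  show "dz (f + g) = dz f + dz g" by (rule fls_eqI) (simp add: dz_nth)
  show "dz (con c) = 0" by (rule fls_eqI) (simp add: dz_nth con_def)
  show "dz (f * g) = f * dz g + g * dz f"
  proof (rule fls_eqI)
    fix n
    define a where "a = min (fls_subdegree f) (fls_subdegree (dz f))"
    define b where "b = max (n - fls_subdegree g) (n - fls_subdegree (dz g))"
    have "(f * g) $$ n = (\<Sum>i=a..b. f $$ i * g $$ (n - i))"
      by (rule fls_mult_nth_cover) (auto simp: a_def b_def)
    moreover have "(f * dz g) $$ n = (\<Sum>i=a..b. f $$ i * dz g $$ (n - i))"
      by (rule fls_mult_nth_cover) (auto simp: a_def b_def)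
    moreover have "(dz f * g) $$ n = (\<Sum>i=a..b. dz f $$ i * g $$ (n - i))"
      by (rule fls_mult_nth_cover) (auto simp: a_def b_def)
    ultimately show "dz (f * g) $$ n = (f * dz g + g * dz f) $$ n"
      by (simp add: dz_nth fls_deriv_sum sum.distrib mult.commute[of g])
  qed
qed

lemma eu_dz: "eu (dz f) = dz (eu f)"
  by (rule fls_eqI) (simp add: dz_nth eu_nth fls_of_int)

lemma eu_eq_0: "eu f = 0 \<Longrightarrow> f = fls_const (f $$ 0)"
  by (rule fls_eqI) (metis eu_nth fls_const_nth fls_zero_nth mult_eq_0_iff of_int_eq_0_iff)

lemma constants: "eu f = 0 \<Longrightarrow> dz f = 0 \<Longrightarrow> \<exists>c. f = con c"
proof -
  assume "eu f = 0" "dz f = 0"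
  then have "fls_deriv (f $$ 0) = 0" by (metis dz_nth fls_zero_nth)
  then have "f $$ 0 = fls_const (f $$ 0 $$ 0)" by (simp only: fls_deriv_eq_0_iff)
  with eu_eq_0[OF \<open>eu f = 0\<close>] show ?thesis by (metis con_def)
qed

lemma coordinates [simp]: "eu sx = sx" "dz sx = 0" "eu sz = 0" "dz sz = 1" "sx \<noteq> 0" "sz \<noteq> 0"
proof -
  show "dz sx = 0" by (rule fls_eqI) (simp add: dz_nth sx_def)
  show "dz sz = 1" by (rule fls_eqI) (simp add: dz_nth sz_def)
qed (simp_all add: eu_def sx_def sz_def)

text \<open>
  The Poisson bracket of the volume form \<open>dx \<and> dz / x\<close>.
\<close>

definition br :: "ser \<Rightarrow> ser \<Rightarrow> ser" where "br f g = eu f * dz g - dz f * eu g"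

interpretation br: ser_derivation "br f"
  by standard (simp_all add: br_def eu.add eu.mult dz.add dz.mult algebra_simps)

lemma br_swap: "br g f = - br f g" by (simp add: br_def algebra_simps)
lemma br_self [simp]: "br f f = 0" by (simp add: br_def)

lemma br_add_left: "br (f + g) h = br f h + br g h"
  by (simp add: br_def eu.add dz.add algebra_simps)
lemma br_mult_left: "br (f * g) h = f * br g h + g * br f h"
  by (simp add: br_def eu.mult dz.mult algebra_simps)
lemma br_con_left [simp]: "br (con c) h = 0" "br 0 h = 0" "br 1 h = 0"
  by (simp_all add: br_def)
lemma br_con_times_left: "br (con c * f) h = con c * br f h"
  by (simp add: br_mult_left)
lemma br_power_left: "br (f ^ n) h = of_nat n * f ^ (n - 1) * br f h"
  by (simp add: br_def eu.power dz.power algebra_simps)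

lemma br_jacobi: "br (br f g) h = br f (br g h) - br g (br f h)"
  by (simp add: br_def eu.mult dz.mult eu.diff dz.diff eu_dz algebra_simps)

lemma br_z: "br sx sz = sx" by (simp add: br_def)

section \<open>The coordinate ring inside the Laurent series\<close>

definition pe :: "complex poly \<Rightarrow> complex fls" where "pe q = fps_to_fls (fps_of_poly q)"

lemma pe_simps: "pe (q + r) = pe q + pe r" "pe (q - r) = pe q - pe r" "pe (q * r) = pe q * pe r"
  "fls_deriv (pe q) = pe (pderiv q)" "pe [:c:] = fls_const c" "pe (smult c q) = fls_const c * pe q"
  by (simp_all add: pe_def fps_of_poly_add fps_of_poly_diff fps_of_poly_mult fls_times_fps_to_fls
      fls_deriv_fps_to_fls fps_of_poly_pderiv fps_of_poly_const fps_of_poly_smult)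

lemma pe_minus: "pe (- q) = - pe q"
  using pe_simps(2)[of 0 q] by (simp add: pe_def)

lemma pe_0 [simp]: "pe 0 = 0" and pe_1 [simp]: "pe 1 = 1"
  by (simp_all add: pe_def)

lemma pe_eq_iff [simp]: "pe q = pe r \<longleftrightarrow> q = r"
  by (simp add: pe_def fps_of_poly_eq_iff)

lemma pe_eq_0_iff [simp]: "pe q = 0 \<longleftrightarrow> q = 0"
  using pe_eq_iff[of q 0] by simp


text \<open>
  The Laurent monomial \<open>x^n q(z)\<close>.
\<close>

definition laur :: "int \<Rightarrow> complex poly \<Rightarrow> ser" where
  "laur n q = fls_shift (- n) (fls_const (pe q))"

lemma laur_nth: "laur n q $$ k = (if k = n then pe q else 0)"
  by (simp add: laur_def)

lemma laur_add: "laur n (q + r) = laur n q + laur n r"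
  by (rule fls_eqI) (simp add: laur_nth pe_simps)

lemma laur_diff: "laur n (q - r) = laur n q - laur n r"
  by (rule fls_eqI) (simp add: laur_nth pe_simps)

lemma laur_0 [simp]: "laur n 0 = 0"
  by (rule fls_eqI) (simp add: laur_nth)

lemma laur_mult: "laur n q * laur m r = laur (n + m) (q * r)"
  by (simp add: laur_def fls_shifted_times_simps pe_simps add.commute)

lemma laur_con: "con c * laur n q = laur n (smult c q)"
  by (rule fls_eqI) (simp add: con_def laur_nth pe_simps)

lemma eu_laur: "eu (laur n q) = laur n (smult (of_int n) q)"
  by (rule fls_eqI) (simp add: eu_nth laur_nth pe_simps fls_of_int)

lemma dz_laur: "dz (laur n q) = laur n (pderiv q)"
  by (rule fls_eqI) (simp add: dz_nth laur_nth pe_simps)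

lemma br_laur: "br (laur n q) (laur m r)
    = laur (n + m) (smult (of_int n) (q * pderiv r) - smult (of_int m) (pderiv q * r))"
  by (simp add: br_def eu_laur dz_laur laur_mult laur_diff)

lemma con_laur: "con c = laur 0 [:c:]"
  by (rule fls_eqI) (simp add: con_def laur_nth pe_simps)

lemma sx_laur: "sx = laur 1 1"
  by (rule fls_eqI) (simp add: sx_def laur_nth)

lemma sz_laur: "sz = laur 0 [:0, 1:]"
  by (rule fls_eqI) (simp add: sz_def laur_nth pe_def fps_of_poly_pCons)

lemma ev_laur: "ev con q sz = laur 0 q"
proof (induction q)
  case (pCons c q)
  have "pCons c q = [:c:] + [:0, 1:] * q" by simp
  then have "laur 0 (pCons c q) = con c + sz * laur 0 q"
    by (simp only: con_laur sz_laur laur_mult laur_add) simp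
  with pCons.IH show ?case by simp
qed simp

lemma sx_power_laur: "sx ^ n = laur (int n) 1"
proof (induction n)
  case 0
  then show ?case using con_laur[of 1] by (simp add: one_pCons)
next
  case (Suc n)
  then show ?case by (simp add: sx_laur laur_mult)
qed

lemma ev2_nth: "ev2 con Q sx sz $$ int n = pe (coeff Q n)"
proof (induction Q arbitrary: n)
  case (pCons q Q)
  have "ev2 con (pCons q Q) sx sz $$ int n = (if n = 0 then pe q else 0) + ev2 con Q sx sz $$ (int n - 1)"
    by (simp add: ev_laur laur_nth sx_def fls_X_times_conv_shift)
  also have "\<dots> = pe (coeff (pCons q Q) n)"
  proof (cases n)
    case 0
    have "ev2 con R sx sz $$ k = 0" if "k < 0" for R k using that
      by (induction R arbitrary: k) (simp_all add: ev_laur laur_nth sx_def fls_X_times_conv_shift)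
    then have "ev2 con Q sx sz $$ (-1) = 0" by simp
    with 0 show ?thesis by simp
  next
    case (Suc m)
    with pCons.IH show ?thesis by simp
  qed
  finally show ?case .
qed simp

lemma ev2_eq_0: "ev2 con Q sx sz = 0 \<Longrightarrow> Q = 0"
  by (rule poly_eqI) (metis ev2_nth fls_zero_nth pe_eq_0_iff coeff_0)

lemma ex_antiderivative: "\<exists>P. pderiv P = (q :: complex poly)"
proof
  have "pderiv (\<Sum>i\<le>degree q. monom (coeff q i / of_nat (Suc i)) (Suc i)) =
      (\<Sum>i\<le>degree q. monom (coeff q i) i)"
    by (simp add: higher_pderiv_sum[of 1, simplified] pderiv_monom del: of_nat_Suc)
  then show "pderiv (\<Sum>i\<le>degree q. monom (coeff q i / of_nat (Suc i)) (Suc i)) = q"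
    by (simp add: poly_as_sum_of_monoms)
qed

lemma pderiv_eq_0D: "pderiv q = 0 \<Longrightarrow> \<exists>c::complex. q = [:c:]"
  by (metis pderiv_eq_0_iff degree_eq_zeroE)

locale danielewski =
  fixes p :: "complex poly"
  assumes squarefree: "rsquarefree p" and degree_p: "3 \<le> degree p"
begin

text \<open>
  A common zero of \<open>p\<close> and its derivative would be a multiple root.
\<close>

lemma bezout: obtains u v where "u * p + v * pderiv p = 1"
proof -
  let ?g = "gcd p (pderiv p)"
  have p0: "p \<noteq> 0" using degree_p by auto
  have "degree ?g = 0"
  proof (rule ccontr)
    assume "degree ?g \<noteq> 0"
    then have "\<not> constant (poly ?g)" by (simp add: constant_degree)
    then obtain a where "poly ?g a = 0" using fundamental_theorem_of_algebra by blast
    then have "[:-a, 1:] dvd ?g" by (simp add: poly_eq_0_iff_dvd)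
    then have "poly p a = 0" "poly (pderiv p) a = 0"
      by (simp_all add: poly_eq_0_iff_dvd)
    with squarefree show False by (auto simp: rsquarefree_roots)
  qed
  then obtain c where c: "?g = [:c:]" by (metis degree_eq_zeroE)
  with p0 have "c \<noteq> 0" by (metis gcd_eq_0_iff pCons_0_0)
  obtain a b where ab: "a * p + b * pderiv p = [:c:]"
    using bezout_coefficients_fst_snd[of p "pderiv p"] c by metis
  have "smult (inverse c) a * p + smult (inverse c) b * pderiv p = smult (inverse c) (a * p + b * pderiv p)"
    by (simp add: smult_add_right)
  also have "\<dots> = 1" using ab \<open>c \<noteq> 0\<close> by (simp add: one_pCons)
  finally show ?thesis by (rule that)
qed

definition sy :: ser where "sy = ev con p sz / sx"

lemma sx_sy: "sx * sy = ev con p sz" by (simp add: sy_def)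

lemma sy_laur: "sy = laur (- 1) p"
proof -
  have "sx * laur (- 1) p = sx * sy" by (simp add: sx_laur laur_mult sx_sy[unfolded sx_laur] ev_laur)
  then show ?thesis by simp
qed

lemma br_xy: "br sx sy = ev con (pderiv p) sz"
  by (simp only: sx_laur sy_laur ev_laur br_laur) simp

lemma br_yz: "br sy sz = - sy"
  by (rule fls_eqI) (simp add: sy_laur sz_laur br_laur laur_nth pe_minus pderiv_pCons)

inductive_set alg :: "ser set" where
  alg_con: "con c \<in> alg"
| alg_x: "sx \<in> alg"
| alg_y: "sy \<in> alg"
| alg_z: "sz \<in> alg"
| alg_add: "f \<in> alg \<Longrightarrow> g \<in> alg \<Longrightarrow> f + g \<in> alg"
| alg_mult: "f \<in> alg \<Longrightarrow> g \<in> alg \<Longrightarrow> f * g \<in> alg"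

lemma alg_minus: "f \<in> alg \<Longrightarrow> - f \<in> alg"
  using alg_mult[OF alg_con[of "-1"]] by (metis con_1 con_minus mult_minus1)
lemma alg_diff: "f \<in> alg \<Longrightarrow> g \<in> alg \<Longrightarrow> f - g \<in> alg"
  using alg_add[OF _ alg_minus] by fastforce
lemma alg_0: "0 \<in> alg" and alg_1: "1 \<in> alg" using alg_con[of 0] alg_con[of 1] by simp_all
lemma alg_power: "f \<in> alg \<Longrightarrow> f ^ n \<in> alg"
  by (induction n) (auto intro: alg_1 alg_mult)
lemma alg_ev: "f \<in> alg \<Longrightarrow> ev con q f \<in> alg"
  by (induction q) (auto intro: alg_0 alg_con alg_add alg_mult)

lemma alg_br:
  assumes "f \<in> alg" "g \<in> alg"
  shows "br f g \<in> alg"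
proof -
  have sw: "br sy sx = - ev con (pderiv p) sz" "br sz sx = - sx" "br sz sy = sy"
    by (metis br_swap br_xy, metis br_swap br_z, metis br_swap br_yz minus_minus)
  note alg = alg_con alg_x alg_y alg_z alg_0 alg_minus[OF alg_x] alg_minus[OF alg_y]
    alg_ev[OF alg_z] alg_minus[OF alg_ev[OF alg_z]]
  have *: "br h g \<in> alg" if h: "h = sx \<or> h = sy \<or> h = sz" for h
    using assms(2)
  proof (induction rule: alg.induct)
    case (alg_add f g)
    then show ?case by (simp add: br.add alg.alg_add)
  next
    case (alg_mult f g)
    then show ?case by (simp add: br.mult alg.alg_add alg.alg_mult)
  qed (use h in \<open>elim disjE; simp add: sw br_xy br_yz br_z alg\<close>)+
  from assms(1) show ?thesis
  proof (induction rule: alg.induct)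
    case (alg_add f g)
    then show ?case by (simp add: br_add_left alg.alg_add)
  next
    case (alg_mult f g)
    then show ?case by (simp add: br_mult_left alg.alg_add alg.alg_mult)
  qed (simp_all add: * alg_0)
qed

text \<open>
  The monomials \<open>x^n q(z)\<close> and \<open>y^n q(z) = x^(-n) p(z)^n q(z)\<close> span the coordinate ring. This
  describes it by weights: the coefficient of \<open>x^(-n)\<close> must be divisible by \<open>p^n\<close>.
\<close>

inductive_set lspan :: "ser set" where
  lspan_0: "0 \<in> lspan"
| lspan_Cons: "f \<in> lspan \<Longrightarrow> p ^ nat (- n) dvd q \<Longrightarrow> laur n q + f \<in> lspan"

lemma laur_alg: "p ^ nat (- n) dvd q \<Longrightarrow> laur n q \<in> alg"
proof (cases "n \<ge> 0")
  case True
  then have "laur n q = sx ^ nat n * ev con q sz"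
    by (simp add: sx_power_laur ev_laur laur_mult)
  then show ?thesis by (simp add: alg_mult alg_power alg_ev alg_x alg_z)
next
  case False
  assume "p ^ nat (- n) dvd q"
  then obtain r where r: "q = p ^ nat (- n) * r" by blast
  have pow: "sy ^ k = laur (- int k) (p ^ k)" for k
    by (induction k) (simp_all add: sy_laur laur_mult one_pCons flip: con_laur)
  have "laur n q = sy ^ nat (- n) * ev con r sz"
    using False by (simp add: pow ev_laur laur_mult r)
  then show ?thesis by (simp add: alg_mult alg_power alg_ev alg_y alg_z)
qed

lemma lspan_alg: "f \<in> lspan \<Longrightarrow> f \<in> alg"
  by (induction rule: lspan.induct) (auto intro: alg_0 alg_add laur_alg)

lemma lspan_add: "f \<in> lspan \<Longrightarrow> g \<in> lspan \<Longrightarrow> f + g \<in> lspan"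
  by (induction rule: lspan.induct) (auto simp: add.assoc intro: lspan.intros)

lemma lspan_laur: "p ^ nat (- n) dvd q \<Longrightarrow> laur n q \<in> lspan"
  using lspan_Cons[OF lspan_0] by fastforce

lemma lspan_mult: "f \<in> lspan \<Longrightarrow> g \<in> lspan \<Longrightarrow> f * g \<in> lspan"
proof (induction rule: lspan.induct)
  case (lspan_Cons f n q)
  have "laur n q * g \<in> lspan" using \<open>g \<in> lspan\<close>
  proof (induction rule: lspan.induct)
    case (lspan_Cons g m r)
    have "p ^ nat (- (n + m)) dvd p ^ nat (- n) * p ^ nat (- m)"
      unfolding power_add[symmetric] by (rule le_imp_power_dvd) simp
    also have "\<dots> dvd q * r" using lspan_Cons \<open>p ^ nat (- n) dvd q\<close> by (simp add: mult_dvd_mono)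
    finally have "laur n q * laur m r \<in> lspan" by (simp only: laur_mult lspan_laur)
    with lspan_Cons show ?case by (simp add: distrib_left lspan_add)
  qed (simp add: lspan_0)
  with lspan_Cons show ?case by (simp add: distrib_right lspan_add)
qed (simp add: lspan_0)

lemma alg_lspan: "f \<in> alg \<Longrightarrow> f \<in> lspan"
  by (induction rule: alg.induct)
     (auto simp: con_laur sx_laur sy_laur sz_laur intro: lspan_laur lspan_add lspan_mult)

lemma alg_nth:
  assumes "f \<in> alg" obtains q where "f $$ n = pe (p ^ nat (- n) * q)"
proof -
  from alg_lspan[OF assms] have "\<exists>q. f $$ n = pe (p ^ nat (- n) * q)"
  proof (induction rule: lspan.induct)
    case lspan_0
    then show ?case by (auto intro: exI[of _ 0])
  next
    case (lspan_Cons f m q)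
    then obtain r where r: "f $$ n = pe (p ^ nat (- n) * r)" by blast
    from lspan_Cons obtain s where "q = p ^ nat (- m) * s" by blast
    with r have "(laur m q + f) $$ n = pe (p ^ nat (- n) * (if n = m then s + r else r))"
      by (simp add: laur_nth pe_simps distrib_left)
    then show ?case by blast
  qed
  then show ?thesis using that by blast
qed

text \<open>
  Up to a factor this integrates \<open>f\<close> times the volume form over a two-dimensional cycle with
  complex coefficients. Only the
  weight-zero part \<open>q(z)\<close> of \<open>f\<close> matters; a primitive of \<open>q\<close> is determined up to a constant,
  which does not affect the linear coefficient of its remainder modulo \<open>p\<close>.
\<close>

definition period :: "ser \<Rightarrow> complex" where
  "period f = (THE c. \<exists>P. f $$ 0 = pe (pderiv P) \<and> c = coeff (P mod p) 1)"

lemma period_eqI: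
  assumes "f $$ 0 = pe (pderiv P)"
  shows "period f = coeff (P mod p) 1"
  unfolding period_def
proof (rule the_equality)
  fix c assume "\<exists>P. f $$ 0 = pe (pderiv P) \<and> c = coeff (P mod p) 1"
  then obtain Q where Q: "f $$ 0 = pe (pderiv Q)" and c: "c = coeff (Q mod p) 1" by blast
  have "pderiv (Q - P) = 0" using Q assms by (simp add: pderiv_diff)
  then obtain d where "Q - P = [:d:]" using pderiv_eq_0D by blast
  then have "Q = P + [:d:]" by (simp add: algebra_simps)
  moreover have "[:d:] mod p = [:d:]" using degree_p by (intro mod_poly_less) simp
  ultimately show "c = coeff (P mod p) 1" using c by (simp add: poly_mod_add_left)
qed (use assms in auto)

lemma alg_weight_0: assumes "f \<in> alg" obtains P where "f $$ 0 = pe (pderiv P)"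
  using alg_nth[OF assms, of 0] ex_antiderivative by (metis nat_zero_as_int minus_zero nat_0 power_0 mult_1)

lemma period_add: "f \<in> alg \<Longrightarrow> g \<in> alg \<Longrightarrow> period (f + g) = period f + period g"
proof -
  assume "f \<in> alg" "g \<in> alg"
  then obtain P Q where *: "f $$ 0 = pe (pderiv P)" "g $$ 0 = pe (pderiv Q)" using alg_weight_0 by metis
  then have "(f + g) $$ 0 = pe (pderiv (P + Q))" by (simp add: pderiv_add pe_simps)
  from period_eqI[OF this] *[THEN period_eqI] show ?thesis by (simp add: poly_mod_add_left)
qed

lemma period_con_times: "f \<in> alg \<Longrightarrow> period (con c * f) = c * period f"
proof -
  assume "f \<in> alg"
  then obtain P where *: "f $$ 0 = pe (pderiv P)" using alg_weight_0 by metis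
  then have "(con c * f) $$ 0 = pe (pderiv (smult c P))" by (simp add: pderiv_smult pe_simps con_def)
  from period_eqI[OF this] *[THEN period_eqI] show ?thesis by (simp add: mod_smult_left)
qed

lemma period_con: "period (con c) = c"
proof -
  have "con c $$ 0 = pe (pderiv [:0, c:])" by (simp add: con_def pe_simps pderiv_pCons)
  from period_eqI[OF this] show ?thesis
    using degree_p by (simp add: mod_poly_less)
qed

lemma period_laur: "n \<noteq> 0 \<Longrightarrow> period (laur n q) = 0"
  using period_eqI[of "laur n q" 0] by (simp add: laur_nth)

lemma period_0: "period 0 = 0" using period_con[of 0] by simp

text \<open>
  The weight-zero part of a bracket is a sum of terms \<open>{x^n q, x^(-n) r} = n (q r)'\<close>. For
  \<open>n \<noteq> 0\<close> one of \<open>q\<close> and \<open>r\<close> is divisible by \<open>p\<close>, so the primitive \<open>n q r\<close> is zero modulo \<open>p\<close>.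
\<close>

lemma period_br:
  assumes "f \<in> alg" "g \<in> alg"
  shows "period (br f g) = 0"
proof -
  have *: "period (br (laur n q) (laur m r)) = 0" if "p ^ nat (- n) dvd q" "p ^ nat (- m) dvd r" for n m q r
  proof (cases "n + m = 0")
    case False
    then show ?thesis by (simp add: br_laur period_laur)
  next
    case True
    then have m: "m = - n" by simp
    have "br (laur n q) (laur m r) $$ 0 = pe (pderiv (smult (of_int n) (q * r)))"
      by (simp add: br_laur laur_nth m pderiv_smult pderiv_mult smult_add_right pe_simps algebra_simps)
    moreover have "smult (of_int n) (q * r) mod p = 0"
    proof (cases "n = 0")
      case False
      then have "p dvd p ^ nat (- n) \<or> p dvd p ^ nat (- m)" by (cases "n > 0") (auto simp: m)
      then have "p dvd q * r" using that by (metis dvd_mult dvd_mult2 dvd_trans)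
      then show ?thesis by (simp add: dvd_smult)
    qed simp
    ultimately show ?thesis by (simp add: period_eqI)
  qed
  have 2: "period (br (laur n q) g) = 0" if q: "p ^ nat (- n) dvd q" for n q
    using alg_lspan[OF assms(2)]
  proof (induction rule: lspan.induct)
    case (lspan_Cons g m r)
    then show ?case
      by (simp add: br.add period_add alg_br laur_alg q lspan_alg *)
  qed (simp add: period_0)
  show ?thesis using alg_lspan[OF assms(1)]
  proof (induction rule: lspan.induct)
    case (lspan_Cons f m r)
    then show ?case
      by (simp add: br_add_left period_add alg_br laur_alg lspan_alg 2 assms(2))
  qed (simp add: period_0)
qed

end

section \<open>The coordinate ring as a Poisson algebra\<close>

text \<open>
  The differential of \<open>f\<close> is a multiple of both \<open>dg\<close> and \<open>dh\<close>, which are independent.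
\<close>

lemma br_nondegenerate:
  assumes "br f g = 0" "br f h = 0" "br g h \<noteq> 0"
  shows "\<exists>c. f = con c"
proof -
  have "eu f * br g h = 0" "dz f * br g h = 0"
    using assms(1,2) unfolding br_def by algebra+
  with assms(3) show ?thesis by (simp add: constants)
qed

text \<open>
  In dimension two, functions that commute have proportional differentials. Knowing the factor
  requires only one further function \<open>h\<close>.
\<close>

lemma br_proportional:
  assumes "br f g = 0" "br g h \<noteq> 0"
  defines "r \<equiv> br f h / br g h"
  shows "eu f = r * eu g" "dz f = r * dz g"
proof -
  have "eu f * br g h = br f h * eu g" "dz f * br g h = br f h * dz g"
    using assms(1) unfolding br_def by algebra+
  then show "eu f = r * eu g" "dz f = r * dz g"
    using assms(2) by (simp_all add: r_def nonzero_eq_divide_eq)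
qed

lemma br_ev_left: "br (ev con q f) h = ev con (pderiv q) f * br f h"
  by (simp add: br_def eu.ev dz.ev algebra_simps)

text \<open>
  The factor \<open>X\<close> on the left avoids the exponents \<open>j - 1\<close> and \<open>m - 1\<close>.
\<close>

lemma br_monomial: "X * br (X ^ j * Z) (X ^ m * R)
    = X ^ (j + m) * (X * br Z R - of_nat m * R * br X Z + of_nat j * Z * br X R)"
proof -
  have pow: "X * (of_nat n * X ^ (n - 1) * t) = of_nat n * X ^ n * t" for n t
    by (cases n) simp_all
  have "X * br (X ^ j * Z) (X ^ m * R) = X ^ j * X ^ m * X * br Z R
      + X ^ j * R * (X * (of_nat m * X ^ (m - 1) * br Z X)) + X ^ m * Z * (X * (of_nat j * X ^ (j - 1) * br X R))"
    by (simp add: br.mult br.power br_mult_left br_power_left algebra_simps)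
  also have "\<dots> = X ^ (j + m) * (X * br Z R - of_nat m * R * br X Z + of_nat j * Z * br X R)"
    by (simp only: pow br_swap[of X Z]) (simp add: power_add algebra_simps)
  finally show ?thesis .
qed

context danielewski
begin

lemma conjugate_brackets:
  assumes "X * Y = ev con p Z" "con c * br X Z = X" "X \<noteq> 0"
  shows "con c * br X Y = ev con (pderiv p) Z" "con c * br Z Y = Y"
proof -
  have "br X (X * Y) = X * br X Y" by (simp add: br.mult)
  then have "X * br X Y = ev con (pderiv p) Z * br X Z" by (simp add: assms(1) br.ev)
  then have "X * (con c * br X Y) = ev con (pderiv p) Z * (con c * br X Z)"
    by (simp only: mult.left_commute[of _ "con c"])
  then show "con c * br X Y = ev con (pderiv p) Z" using assms(3) by (simp add: assms(2))
  have "br Z (X * Y) = 0" by (simp add: assms(1) br.ev)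
  then have "X * br Z Y = Y * br X Z" by (simp add: br.mult br_swap[of X Z] algebra_simps eq_neg_iff_add_eq_0)
  then have "X * (con c * br Z Y) = Y * (con c * br X Z)"
    by (simp only: mult.left_commute[of _ "con c"])
  then show "con c * br Z Y = Y" using assms(3) by (simp add: assms(2))
qed

text \<open>
  Bracketing \<open>Y\<close> repeatedly with \<open>X\<close> differentiates \<open>p\<close>, and the derivative of order
  \<open>degree p - 1\<close> is linear; this puts some \<open>X^m Z\<close> into \<open>S\<close>. As \<open>p(Z) = X Y\<close> is in \<open>S\<close> and the
  polynomials are a finite module over \<open>\<complex>[p]\<close>, one exponent \<open>m\<close> serves all of them:
  \<open>X^m q(Z)\<close> is in \<open>S\<close> for all \<open>q\<close>. The exponent then goes down to zero: multiplication by \<open>Y\<close> and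
  bracket with \<open>Y\<close> give \<open>X^(m-1) q p\<close> and \<open>X^(m-1) q p'\<close>, and \<open>p\<close>, \<open>p'\<close> generate the unit ideal.
\<close>

lemma poisson_generation:
  assumes S: "\<And>a. con a \<in> S" "\<And>f g. f \<in> S \<Longrightarrow> g \<in> S \<Longrightarrow> f + g \<in> S"
    "\<And>f g. f \<in> S \<Longrightarrow> g \<in> S \<Longrightarrow> f * g \<in> S" "\<And>f g. f \<in> S \<Longrightarrow> g \<in> S \<Longrightarrow> br f g \<in> S"
    and X: "X \<in> S" and Y: "Y \<in> S"
    and XY: "X * Y = ev con p Z" and XZ: "con c * br X Z = X" and X0: "X \<noteq> 0"
  shows "Z \<in> S"
proof -
  note YZ = conjugate_brackets[OF XY XZ X0]
  have pow: "f ^ n \<in> S" if "f \<in> S" for f n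
    using that S(1)[of 1] by (induction n) (auto intro: S(3))
  have diff: "f - g \<in> S" if "f \<in> S" "g \<in> S" for f g
    using S(2)[OF that(1) S(3)[OF S(1)[of "-1"] that(2)]] by (simp add: con_minus)
  have divide: "f \<in> S" if "con a * f \<in> S" "a \<noteq> 0" for f a
    using S(3)[OF S(1)[of "inverse a"] that(1)] that(2) by (simp add: con_inverse flip: mult.assoc)
  define W where "W m = {q. X ^ m * ev con q Z \<in> S}" for m
  have W_add: "q + r \<in> W m" if "q \<in> W m" "r \<in> W m" for q r m
    using S(2) that by (simp add: W_def con.ev_add distrib_left)
  have W_mult: "q * r \<in> W (m + n)" if "q \<in> W m" "r \<in> W n" for q r m n
    using S(3)[of "X ^ m * ev con q Z" "X ^ n * ev con r Z"] that
    by (simp add: W_def con.ev_mult power_add mult.assoc mult.left_commute[of "X ^ n"])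
  have W_const: "[:a:] \<in> W m" for a m
    using S(3)[OF pow[OF X] S(1)] by (simp add: W_def)
  have W_p: "p \<in> W 0" using S(3)[OF X Y] by (simp add: W_def XY)
  have "X ^ j * ev con ((pderiv ^^ (Suc j)) p) Z \<in> S" for j
  proof (induction j)
    case 0
    show ?case using S(3)[OF S(1)[of c] S(4)[OF X Y]] by (simp add: YZ)
  next
    case (Suc j)
    have "con c * br X (X ^ j * ev con ((pderiv ^^ (Suc j)) p) Z)
        = X ^ j * ev con (pderiv ((pderiv ^^ (Suc j)) p)) Z * (con c * br X Z)"
      by (simp add: br.mult br.power br.ev algebra_simps)
    also have "\<dots> = X ^ Suc j * ev con ((pderiv ^^ (Suc (Suc j))) p) Z"
      by (simp add: XZ algebra_simps)
    finally show ?case using S(3)[OF S(1) S(4)[OF X Suc]] by metis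
  qed
  then have linear: "(pderiv ^^ (Suc (degree p - 2))) p \<in> W (degree p - 2)" by (simp add: W_def)
  have "degree ((pderiv ^^ (Suc (degree p - 2))) p) = 1"
    using degree_p by (simp add: degree_higher_pderiv del: funpow.simps)
  then obtain \<beta> \<alpha> where lin: "(pderiv ^^ (Suc (degree p - 2))) p = [:\<beta>, \<alpha>:]" and "\<alpha> \<noteq> 0"
    by (metis degree1_coeffs)
  let ?m = "degree p - 2"
  have "[:0, \<alpha>:] \<in> W ?m"
    using W_add[OF linear W_const[of "- \<beta>"]] unfolding lin by simp
  from W_mult[OF W_const[of "inverse \<alpha>" 0] this] have z: "[:0, 1:] \<in> W ?m"
    using \<open>\<alpha> \<noteq> 0\<close> by simp
  \<comment> \<open>The product of \<open>X^m Z\<close> with itself raises the exponent of \<open>X\<close> with the degree.\<close>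
  have small: "q \<in> W (n * ?m)" if "degree q \<le> n" for q n
    using that
  proof (induction n arbitrary: q)
    case 0
    then show ?case by (metis W_const degree_eq_zeroE le_zero_eq)
  next
    case (Suc n)
    obtain a r where q: "q = pCons a r" by (metis pCons_cases)
    have "degree r \<le> n" using Suc.prems q by (cases "r = 0") auto
    have "q = [:a:] + [:0, 1:] * r" by (simp add: q)
    with W_add[OF W_const W_mult[OF z Suc.IH[OF \<open>degree r \<le> n\<close>]]] show ?case by simp
  qed
  \<comment> \<open>Division by \<open>p\<close> reduces to degrees below that of \<open>p\<close> at no cost, because \<open>p\<close> lies in \<open>W 0\<close>.\<close>
  have all: "q \<in> W (degree p * ?m)" for q
  proof (induction "degree q" arbitrary: q rule: less_induct)
    case less
    show ?case
    proof (cases "degree q < degree p")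
      case True
      then show ?thesis using small by simp
    next
      case False
      have "degree (q div p) < degree q"
        using False degree_p by (intro degree_div_less) auto
      from W_mult[OF W_p less[OF this]] have "p * (q div p) \<in> W (degree p * ?m)" by simp
      moreover have "degree (q mod p) \<le> degree p"
        using degree_mod_less[of p q] degree_p by force
      then have "q mod p \<in> W (degree p * ?m)" by (rule small)
      ultimately show ?thesis using W_add by fastforce
    qed
  qed
  obtain u v where uv: "u * p + v * pderiv p = 1" using bezout by blast
  have descend: "W (m - i) = UNIV" if "W m = UNIV" "i \<le> m" for m i :: nat
    using that(2)
  proof (induction i)
    case (Suc i)
    define k where "k = m - Suc i"
    have k: "m - i = Suc k" using Suc.prems by (simp add: k_def)
    then have IH: "X ^ Suc k * ev con q Z \<in> S" for q using Suc by (auto simp: W_def)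
    have 1: "X ^ k * ev con (q * p) Z \<in> S" for q
    proof -
      have "X ^ Suc k * ev con q Z * Y = X ^ k * ev con (q * p) Z"
        by (simp add: con.ev_mult mult_ac flip: XY)
      then show ?thesis using S(3)[OF IH Y, of q] by metis
    qed
    have 2: "X ^ k * ev con (q * pderiv p) Z \<in> S" for q
    proof -
      have "br (X ^ Suc k * ev con q Z) Y
          = X ^ Suc k * (ev con (pderiv q) Z * br Z Y) + ev con q Z * (of_nat (Suc k) * X ^ k * br X Y)"
        by (simp only: br_mult_left br_power_left br_ev_left) simp
      then have "con c * br (X ^ Suc k * ev con q Z) Y - X ^ k * ev con (pderiv q * p) Z
          = of_nat (Suc k) * X ^ k * ev con q Z * (con c * br X Y)
            + X ^ Suc k * ev con (pderiv q) Z * (con c * br Z Y) - X ^ k * ev con (pderiv q * p) Z"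
        by (simp add: algebra_simps del: of_nat_Suc power_Suc)
      also have "\<dots> = con (of_nat (Suc k)) * (X ^ k * ev con (q * pderiv p) Z)"
      proof -
        have "X ^ Suc k * ev con (pderiv q) Z * Y = X ^ k * ev con (pderiv q * p) Z"
          unfolding con.ev_mult XY[symmetric] power_Suc by (simp only: mult_ac)
        then have 3: "X ^ Suc k * ev con (pderiv q) Z * (con c * br Z Y) = X ^ k * ev con (pderiv q * p) Z"
          by (simp only: YZ)
        have "of_nat (Suc k) * X ^ k * ev con q Z * (con c * br X Y)
            = con (of_nat (Suc k)) * (X ^ k * ev con (q * pderiv p) Z)"
          unfolding YZ con.ev_mult con_of_nat by (simp only: mult.assoc)
        with 3 show ?thesis by (simp only: add_diff_cancel_right')
      qed
      finally have "con (of_nat (Suc k)) * (X ^ k * ev con (q * pderiv p) Z) \<in> S"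
        using diff[OF S(3)[OF S(1) S(4)[OF IH Y]] 1] by metis
      then show ?thesis by (rule divide) (rule of_nat_neq_0)
    qed
    have "X ^ k * ev con q Z \<in> S" for q
    proof -
      have "(q * u) * p + (q * v) * pderiv p = q * (u * p + v * pderiv p)" by (simp only: algebra_simps)
      then have "(q * u) * p + (q * v) * pderiv p = q" by (simp only: uv mult_1_right)
      then have "X ^ k * ev con q Z = X ^ k * ev con ((q * u) * p) Z + X ^ k * ev con ((q * v) * pderiv p) Z"
        by (metis con.ev_add distrib_left)
      then show ?thesis using S(2)[OF 1 2] by metis
    qed
    then show ?case by (auto simp: W_def k_def)
  qed (use that in simp)
  have "W (degree p * ?m) = UNIV" using all by (intro equalityI subsetI UNIV_I)
  from descend[OF this order.refl] have "W 0 = UNIV" by simp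
  then have "[:0, 1:] \<in> W 0" by blast
  then show ?thesis by (simp add: W_def)
qed

end

section \<open>Embeddings of Lie algebras of functions\<close>

text \<open>
  The situation of an injective endomorphism of a Lie algebra of Hamiltonian fields, read on
  potentials. Later \<open>B\<close> consists of the potentials with zero period.
\<close>

locale lie_embedding = danielewski +
  fixes B :: "ser set" and F :: "ser \<Rightarrow> ser"
  assumes B_add: "f \<in> B \<Longrightarrow> g \<in> B \<Longrightarrow> f + g \<in> B"
    and B_con_times: "f \<in> B \<Longrightarrow> con c * f \<in> B"
    and B_br: "f \<in> B \<Longrightarrow> g \<in> B \<Longrightarrow> br f g \<in> B"
    and B_x: "1 \<le> k \<Longrightarrow> sx ^ k \<in> B" and B_y_power: "1 \<le> k \<Longrightarrow> sy ^ k \<in> B"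
    and B_alg: "B \<subseteq> alg"
    and F_B: "f \<in> B \<Longrightarrow> F f \<in> B"
    and F_add: "f \<in> B \<Longrightarrow> g \<in> B \<Longrightarrow> F (f + g) = F f + F g"
    and F_con_times: "f \<in> B \<Longrightarrow> F (con c * f) = con c * F f"
    and F_br: "f \<in> B \<Longrightarrow> g \<in> B \<Longrightarrow> F (br f g) = br (F f) (F g)"
    and F_inj: "f \<in> B \<Longrightarrow> F f = 0 \<Longrightarrow> f = 0"
begin

lemma B_y: "sy \<in> B" using B_y_power[of 1] by simp

lemma br_x_power: "br (sx ^ j) (sx ^ k * f) = of_nat j * sx ^ (j + k - 1) * br sx f"
proof -
  have "br sx (sx ^ k * f) = sx ^ k * br sx f" by (simp add: br.mult br.power)
  then show ?thesis by (cases j) (simp_all add: br_power_left power_add del: power_Suc)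
qed

text \<open>
  The polynomials \<open>q\<close> for which \<open>x^m q(z)\<close> is in \<open>B\<close> for large \<open>m\<close> form a vector space that
  contains the constants. Bracketing with \<open>x\<close> shows that it is closed under derivatives, and bracketing with
  \<open>p' = {x, y}\<close> that it is closed under multiplication by \<open>p''\<close>. As \<open>p''\<close> is not constant,
  its powers and their derivatives have every degree.
\<close>

lemma B_poly: "\<exists>M. \<forall>m\<ge>M. sx ^ m * ev con q sz \<in> B"
proof -
  define T where "T = {q. \<exists>M. \<forall>m\<ge>M. sx ^ m * ev con q sz \<in> B}"
  have T_const: "[:c:] \<in> T" for c
  proof -
    have "sx ^ m * ev con [:c:] sz \<in> B" if "m \<ge> 1" for m
      using B_con_times[OF B_x[OF that], of c] by (simp add: mult.commute)
    then show ?thesis unfolding T_def by blast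
  qed
  have T_add: "q + r \<in> T" if "q \<in> T" "r \<in> T" for q r
  proof -
    from that obtain M N where "\<And>m. m \<ge> M \<Longrightarrow> sx ^ m * ev con q sz \<in> B" "\<And>m. m \<ge> N \<Longrightarrow> sx ^ m * ev con r sz \<in> B"
      by (auto simp: T_def)
    then have "sx ^ m * ev con (q + r) sz \<in> B" if "m \<ge> max M N" for m
      using that by (simp add: con.ev_add distrib_left B_add)
    then show ?thesis unfolding T_def by blast
  qed
  have T_smult: "smult c q \<in> T" if "q \<in> T" for c q
  proof -
    from that obtain M where "\<And>m. m \<ge> M \<Longrightarrow> sx ^ m * ev con q sz \<in> B"
      by (auto simp: T_def)
    then have "sx ^ m * ev con (smult c q) sz \<in> B" if "m \<ge> M" for m
      using B_con_times[of "sx ^ m * ev con q sz" c] that by (simp add: con.ev_smult mult.left_commute)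
    then show ?thesis unfolding T_def by blast
  qed
  have T_pderiv: "pderiv q \<in> T" if "q \<in> T" for q
  proof -
    from that obtain M where M: "\<And>m. m \<ge> M \<Longrightarrow> sx ^ m * ev con q sz \<in> B"
      by (auto simp: T_def)
    have "sx ^ m * ev con (pderiv q) sz \<in> B" if "m \<ge> Suc M" for m
    proof -
      obtain k where k: "m = Suc k" using \<open>m \<ge> Suc M\<close> by (cases m) auto
      have "br sx (sx ^ k * ev con q sz) = sx ^ m * ev con (pderiv q) sz"
        using br_x_power[of 1 k "ev con q sz"] by (simp add: br.ev br_z k)
      then show ?thesis using B_br[OF B_x[of 1] M[of k]] that by (simp add: k)
    qed
    then show ?thesis unfolding T_def by blast
  qed
  define p2 where "p2 = pderiv (pderiv p)"
  have T_mult: "p2 * q \<in> T" if "q \<in> T" for q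
  proof -
    from that obtain M where M: "\<And>m. m \<ge> M \<Longrightarrow> sx ^ m * ev con q sz \<in> B"
      by (auto simp: T_def)
    have "sx ^ m * ev con (p2 * q) sz \<in> B" if "m \<ge> Suc M" for m
    proof -
      have "br (br sx sy) (sx ^ m * ev con q sz) = - (ev con p2 sz * br (sx ^ m * ev con q sz) sz)"
        by (subst br_swap) (simp add: br_xy br.ev p2_def)
      also have "br (sx ^ m * ev con q sz) sz = of_nat m * sx ^ m * ev con q sz"
      proof -
        have "br (sx ^ m) sz = of_nat m * sx ^ m"
          using that by (cases m) (simp_all add: br_power_left br_z del: power_Suc, simp add: mult.commute)
        then show ?thesis by (simp add: br_mult_left br_swap[of "ev con q sz"] br.ev)
      qed
      finally have "con (- (1 / of_nat m)) * br (br sx sy) (sx ^ m * ev con q sz) = sx ^ m * ev con (p2 * q) sz"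
        using that by (simp add: con.ev_mult con_divide con_minus con_of_nat field_simps)
      moreover have "br (br sx sy) (sx ^ m * ev con q sz) \<in> B"
        using B_br[OF B_br[OF B_x[of 1] B_y] M[of m]] that by simp
      ultimately show ?thesis using B_con_times by metis
    qed
    then show ?thesis unfolding T_def by blast
  qed
  have "p2 ^ k \<in> T" for k
    by (induction k) (use T_const[of 1] T_mult in \<open>auto simp: one_pCons\<close>)
  moreover have higher: "(pderiv ^^ j) q \<in> T" if "q \<in> T" for j q
    using that by (induction j) (auto intro: T_pderiv)
  moreover have deg2: "1 \<le> degree p2"
    using degree_p by (simp add: p2_def degree_pderiv)
  ultimately have ex: "\<exists>s\<in>T. degree s = n" for n
  proof -
    have "n * 1 \<le> n * degree p2" by (rule mult_left_mono[OF deg2]) simp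
    moreover have "p2 \<noteq> 0" using deg2 by auto
    ultimately have "degree ((pderiv ^^ (n * degree p2 - n)) (p2 ^ n)) = n"
      by (simp add: degree_higher_pderiv degree_power_eq)
    then show ?thesis using \<open>\<And>k. p2 ^ k \<in> T\<close> higher by blast
  qed
  have "q \<in> T" if "degree q \<le> n" for n q
    using that
  proof (induction n arbitrary: q)
    case 0
    then show ?case by (metis T_const degree_eq_zeroE le_zero_eq)
  next
    case (Suc n)
    obtain s where s: "s \<in> T" "degree s = Suc n" using ex by blast
    define c where "c = coeff q (Suc n) / coeff s (Suc n)"
    have "coeff s (Suc n) \<noteq> 0" using s(2) by (metis leading_coeff_0_iff degree_0 nat.distinct(1))
    have "degree (q - smult c s) \<le> n"
    proof (rule degree_le, intro allI impI)
      fix i assume "n < i"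
      then show "coeff (q - smult c s) i = 0"
        using \<open>coeff s (Suc n) \<noteq> 0\<close> Suc.prems s(2)
        by (cases "i = Suc n") (auto simp: c_def coeff_eq_0)
    qed
    from T_add[OF Suc.IH[OF this] T_smult[OF s(1), of c]] show ?case by simp
  qed
  then show ?thesis by (auto simp: T_def)
qed

lemma F_0: "F 0 = 0" using F_con_times[OF B_y, of 0] by simp


text \<open>
  Write \<open>w k = F(x^k)\<close> and \<open>v k = F(x^k z)\<close>. The \<open>w k\<close> commute with \<open>w 1\<close>, so
  \<open>d w k = h k d w 1\<close> with a factor \<open>h k\<close> that is found from the brackets \<open>{w j, v k} = j w (j + k)\<close>:
  it is \<open>k w (k + m) / w (1 + m)\<close> for every large \<open>m\<close>. Independence of \<open>m\<close> makes \<open>w\<close> a geometric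
  progression of ratio \<open>X\<close> from some index \<open>b\<close> on, and \<open>h k = k X^(k-1)\<close>. Differentiating
  \<open>w (b + 1) = X w b\<close> in two ways gives \<open>X^b d w 1 = w b d X\<close>, whence \<open>w b / X^b\<close> is constant.
\<close>

lemma F_x_powers:
  obtains b c X where "c \<noteq> 0" "X \<noteq> 0" "\<And>k. b \<le> k \<Longrightarrow> F (sx ^ k) = con c * X ^ k"
    "\<And>k. 1 \<le> k \<Longrightarrow> \<exists>e. F (sx ^ k) = con c * X ^ k + con e"
proof -
  obtain a0 where a0: "\<And>m. m \<ge> a0 \<Longrightarrow> sx ^ m * sz \<in> B"
    using B_poly[of "[:0, 1:]"] by auto
  define a where "a = Suc a0"
  define b where "b = Suc a"
  define w where "w k = F (sx ^ k)" for k
  define v where "v k = F (sx ^ k * sz)" for k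
  have w0: "w k \<noteq> 0" if "1 \<le> k" for k
    using F_inj[OF B_x[OF that]] by (auto simp: w_def)
  have ww: "br (w j) (w k) = 0" if "1 \<le> j" "1 \<le> k" for j k
    using F_br[OF B_x[OF that(1)] B_x[OF that(2)]] br_x_power[of j k 1] by (simp add: w_def F_0)
  have wv: "br (w j) (v k) = of_nat j * w (j + k)" if "1 \<le> j" "a \<le> k" for j k
  proof -
    have "br (sx ^ j) (sx ^ k * sz) = con (of_nat j) * sx ^ (j + k)"
      using that by (cases j) (simp_all add: br_x_power br_z con_of_nat del: power_Suc of_nat_Suc, simp)
    then show ?thesis
      using F_br[OF B_x[OF that(1)] a0[of k]] F_con_times[OF B_x[of "j + k"], of "of_nat j"] that
      by (simp add: w_def v_def a_def con_of_nat)
  qed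
  have ne: "br (w 1) (v a) \<noteq> 0" using wv[of 1 a] w0[of "Suc a"] by simp
  define h where "h k = of_nat k * w (k + a) / w b" for k
  have h: "eu (w k) = h k * eu (w 1)" "dz (w k) = h k * dz (w 1)" if "1 \<le> k" for k
    using br_proportional[OF ww[OF that, of 1] ne] wv[OF that, of a] wv[of 1 a] by (simp_all add: h_def b_def)
  have wh: "of_nat k * w (k + m) = h k * w (Suc m)" if "1 \<le> k" "a \<le> m" for k m
  proof -
    have "br (w k) (v m) = h k * br (w 1) (v m)"
      unfolding br_def h[OF that(1)] by (simp add: algebra_simps)
    then show ?thesis using wv[OF that] wv[of 1 m] that by simp
  qed
  define X where "X = w (Suc b) / w b"
  have wX: "w (Suc m) = X * w m" if "b \<le> m" for m
  proof -
    obtain n where n: "m = Suc n" "a \<le> n" using \<open>b \<le> m\<close> by (cases m) (auto simp: b_def)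
    have "h 2 = 2 * X" by (simp add: h_def X_def b_def)
    with wh[of 2 n] n(2) have "2 * w (Suc m) = 2 * (X * w m)" by (simp add: n(1))
    then show ?thesis by simp
  qed
  have wb: "w (b + i) = X ^ i * w b" for i
    by (induction i) (simp_all add: wX)
  have b1: "1 \<le> b" by (simp add: b_def)
  have X0: "X \<noteq> 0" using w0[of b] w0[of "Suc b"] b1 by (simp add: X_def)
  have hX: "h k = of_nat k * X ^ (k - 1)" if "1 \<le> k" for k
  proof -
    have "k + a = b + (k - 1)" using that by (simp add: b_def)
    then show ?thesis using w0[OF b1] by (simp only: h_def wb) simp
  qed
  have key: "X ^ b * D (w 1) = w b * D X \<and> D (w b / X ^ b) = 0"
    if D: "ser_derivation D" and Dw: "\<And>k. 1 \<le> k \<Longrightarrow> D (w k) = h k * D (w 1)" for D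
  proof -
    interpret D: ser_derivation D by (rule D)
    have "D (w (Suc b)) = X * D (w b) + w b * D X" by (simp add: wX D.mult)
    then have "of_nat (Suc b) * X ^ b * D (w 1) = X * (of_nat b * X ^ (b - 1) * D (w 1)) + w b * D X"
      using Dw[of "Suc b"] Dw[OF b1] hX[of "Suc b"] hX[OF b1] by simp
    moreover have "X * (of_nat b * X ^ (b - 1) * D (w 1)) = of_nat b * X ^ b * D (w 1)"
      using b1 by (cases b) simp_all
    ultimately have "of_nat (Suc b) * X ^ b * D (w 1) = of_nat b * X ^ b * D (w 1) + w b * D X" by metis
    then have 1: "X ^ b * D (w 1) = w b * D X" by (simp add: algebra_simps)
    have "D (w b) * X ^ b = of_nat b * X ^ (b - 1) * (X ^ b * D (w 1))"
      using Dw[OF b1] hX[OF b1] by (simp add: algebra_simps)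
    also have "\<dots> = w b * D (X ^ b)" by (simp only: 1 D.power) (simp add: algebra_simps)
    finally have "D (w b / X ^ b) = 0" using X0 by (simp add: D.divide)
    with 1 show ?thesis by blast
  qed
  note eu = key[OF eu.ser_derivation_axioms h(1)] and dz = key[OF dz.ser_derivation_axioms h(2)]
  obtain c where c: "w b / X ^ b = con c" using constants eu dz by blast
  then have wbc: "w b = con c * X ^ b" using X0 by (simp add: field_simps)
  have "c \<noteq> 0" using wbc w0[OF b1] by auto
  have dw: "eu (w 1) = con c * eu X" "dz (w 1) = con c * dz X"
    using eu dz X0 by (simp_all add: wbc mult.assoc mult.left_commute[of "con c"])
  have "\<exists>e. w k = con c * X ^ k + con e" if "1 \<le> k" for k
  proof -
    have "\<exists>e. w k - con c * X ^ k = con e"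
      by (rule constants)
         (simp_all add: eu.diff dz.diff h[OF that] hX[OF that] dw eu.con_times dz.con_times eu.power dz.power algebra_simps del: One_nat_def)
    then show ?thesis by (metis diff_add_cancel add.commute)
  qed
  moreover have "w k = con c * X ^ k" if "b \<le> k" for k
    using wb[of "k - b"] that by (simp add: wbc power_add[symmetric] algebra_simps)
  ultimately show ?thesis using that[of c X b] \<open>c \<noteq> 0\<close> X0 by (simp add: w_def)
qed

text \<open>
  For large \<open>m\<close>, the brackets with \<open>x\<close> and \<open>x^2\<close> show that \<open>F(x^m z^n) = c X^m R n\<close> with \<open>R n\<close>
  independent of \<open>m\<close>, and that \<open>{X, R n}\<close> is what it would be for \<open>R n = Z^n\<close>, where
  \<open>Z = R 1\<close>. This determines \<open>R n\<close> up to an error \<open>k\<close> that commutes with \<open>X\<close>. The brackets with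
  \<open>x^j z\<close> give \<open>c {Z, k} = j n k\<close> for all large \<open>j\<close>, so the error vanishes.
\<close>

lemma F_structure:
  obtains c X Z where "c \<noteq> 0" "X \<noteq> 0" "con c * br X Z = X"
    "\<And>k. 1 \<le> k \<Longrightarrow> \<exists>e. F (sx ^ k) = con c * X ^ k + con e"
    "\<And>q. \<exists>N. \<forall>m\<ge>N. sx ^ m * ev con q sz \<in> B \<and> F (sx ^ m * ev con q sz) = con c * X ^ m * ev con q Z"
proof -
  obtain b c X where c0: "c \<noteq> 0" and X0: "X \<noteq> 0"
    and wb: "\<And>k. b \<le> k \<Longrightarrow> F (sx ^ k) = con c * X ^ k"
    and we: "\<And>k. 1 \<le> k \<Longrightarrow> \<exists>e. F (sx ^ k) = con c * X ^ k + con e"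
    using F_x_powers by metis
  have brw: "br (F (sx ^ j)) g = con c * of_nat j * X ^ (j - 1) * br X g" if "1 \<le> j" for j g
    using we[OF that] by (auto simp: br_add_left br_con_times_left br_power_left mult.assoc)
  have "\<exists>M. \<forall>m\<ge>M. sx ^ m * sz ^ n \<in> B" for n
  proof -
    have "ev con (monom 1 n) sz = sz ^ n"
      by (induction n) (simp_all add: monom_Suc one_pCons monom_0)
    then show ?thesis using B_poly[of "monom 1 n"] by simp
  qed
  then obtain M where M: "\<And>n m. M n \<le> m \<Longrightarrow> sx ^ m * sz ^ n \<in> B" by metis
  \<comment> \<open>A single bound for all exponents of \<open>z\<close> up to \<open>n\<close>, beyond \<open>b\<close> where \<open>F(x^k) = c X^k\<close> starts.\<close>
  define M' where "M' n = Suc (\<Sum>i\<le>n. M i) + b" for n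
  have M': "sx ^ m * sz ^ i \<in> B" if "M' n \<le> m" "i \<le> n" for m n i
  proof -
    have "M i \<le> (\<Sum>i\<le>n. M i)" using that by (intro member_le_sum) auto
    with that show ?thesis by (intro M) (simp add: M'_def)
  qed
  define G where "G m n = F (sx ^ m * sz ^ n)" for m n
  have G0: "G m 0 = con c * X ^ m" if "b \<le> m" for m
    using wb that by (simp add: G_def)
  have step: "con c * of_nat j * X ^ (j - 1) * br X (G m (Suc n)) = of_nat (j * Suc n) * G (j + m) n"
    if "1 \<le> j" "M' (Suc n) \<le> m" for j m n
  proof -
    have "br (sx ^ j) (sx ^ m * sz ^ Suc n) = con (of_nat (j * Suc n)) * (sx ^ (j + m) * sz ^ n)"
      using that(1) unfolding br_x_power br.power
      by (cases j) (simp_all add: br_z con_of_nat algebra_simps of_nat_mult con_mult del: of_nat_Suc mult_Suc mult_Suc_right)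
    then have "br (F (sx ^ j)) (G m (Suc n)) = con (of_nat (j * Suc n)) * G (j + m) n"
      using F_br[OF B_x[OF that(1)] M'[OF that(2), of "Suc n"]]
        F_con_times[OF M'[of "Suc n" "j + m" n], of "of_nat (j * Suc n)"] that
      by (simp add: G_def del: of_nat_Suc of_nat_mult power_Suc)
    then show ?thesis by (simp only: brw[OF that(1)] con_of_nat)
  qed
  have shift: "G (Suc m) n = X * G m n" if "Suc (M' (Suc n)) \<le> m" for m n
  proof -
    obtain k where k: "m = Suc k" "M' (Suc n) \<le> k" using \<open>Suc (M' (Suc n)) \<le> m\<close> by (cases m) auto
    have "of_nat (2 * Suc n) * G (Suc m) n = 2 * X * (con c * br X (G k (Suc n)))"
      using step[of 2 n k] k by (simp add: algebra_simps)
    also have "\<dots> = of_nat (2 * Suc n) * (X * G m n)"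
      using step[of 1 n k] k by (simp add: algebra_simps)
    finally show ?thesis by (simp del: of_nat_Suc of_nat_mult)
  qed
  define K where "K n = Suc (M' (Suc n))" for n
  define R where "R n = G (K n) n / (con c * X ^ K n)" for n
  have GR: "G m n = con c * X ^ m * R n" if "K n \<le> m" for m n
    using that
  proof (induction m rule: dec_induct)
    case base
    show ?case using c0 X0 by (simp add: R_def)
  next
    case (step m)
    then show ?case using shift[of n m] by (simp add: K_def)
  qed
  have R0: "R 0 = 1" using GR[of 0 "K 0"] G0[of "K 0"] c0 X0 by (simp add: K_def M'_def)
  have Rd: "con c * br X (R (Suc n)) = of_nat (Suc n) * X * R n" for n
  proof -
    define m where "m = K n + K (Suc n) + M' (Suc n)"
    have "con c * br X (con c * X ^ m * R (Suc n)) = of_nat (Suc n) * (con c * X ^ Suc m * R n)"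
      using step[of 1 n m] GR[of "Suc n" m] GR[of n "Suc m"] by (simp add: m_def)
    then have "(con c * X ^ m) * (con c * br X (R (Suc n))) = (con c * X ^ m) * (of_nat (Suc n) * X * R n)"
      by (simp add: br.mult br.power algebra_simps)
    then show ?thesis using c0 X0 by simp
  qed
  define Z where "Z = R 1"
  have XZ: "con c * br X Z = X" using Rd[of 0] R0 by (simp add: Z_def)
  have RZ: "R n = Z ^ n" for n
  proof (induction n)
    case (Suc n)
    define k where "k = R (Suc n) - Z ^ Suc n"
    have Zk: "con c * br Z k = of_nat j * of_nat (Suc n) * k" if j: "K 1 \<le> j" for j
    proof -
      define m where "m = K (Suc n)"
      define t where "t = of_nat j * of_nat (Suc n) - (of_nat m :: complex)"
      have t: "con t = of_nat j * of_nat (Suc n) - of_nat m"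
        by (simp add: t_def con_diff con_mult con_of_nat del: of_nat_Suc)
      have "sx * br (sx ^ j * sz) (sx ^ m * sz ^ Suc n) = sx * (con t * (sx ^ (j + m) * sz ^ Suc n))"
        by (simp only: br_monomial t br.power br_z br_self) (simp add: algebra_simps)
      then have "br (sx ^ j * sz) (sx ^ m * sz ^ Suc n) = con t * (sx ^ (j + m) * sz ^ Suc n)"
        by simp
      moreover have "sx ^ j * sz \<in> B" "sx ^ m * sz ^ Suc n \<in> B" "sx ^ (j + m) * sz ^ Suc n \<in> B"
        using M'[of 2 j 1] M'[of "Suc (Suc n)" m "Suc n"] M'[of "Suc (Suc n)" "j + m" "Suc n"] j
        by (simp_all add: K_def m_def numeral_2_eq_2 del: power_Suc)
      ultimately have "br (F (sx ^ j * sz)) (F (sx ^ m * sz ^ Suc n)) = con t * F (sx ^ (j + m) * sz ^ Suc n)"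
        using F_br F_con_times by metis
      then have "br (con c * (X ^ j * Z)) (con c * (X ^ m * R (Suc n))) = con t * (con c * (X ^ (j + m) * R (Suc n)))"
        using GR[OF j] GR[of "Suc n" m] GR[of "Suc n" "j + m"]
        by (simp add: G_def m_def Z_def mult.assoc del: power_Suc)
      then have "con c * (con c * (X * br (X ^ j * Z) (X ^ m * R (Suc n)))) = X * (con t * (con c * (X ^ (j + m) * R (Suc n))))"
        by (simp only: br_con_times_left br.con_times) (simp add: algebra_simps)
      then have "(con c * X ^ (j + m)) * (X * (con c * br Z (R (Suc n))) - of_nat m * R (Suc n) * (con c * br X Z)
          + of_nat j * Z * (con c * br X (R (Suc n)))) = (con c * X ^ (j + m)) * (X * con t * R (Suc n))"
        unfolding br_monomial by (simp add: algebra_simps)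
      then have "X * (con c * br Z (R (Suc n))) - of_nat m * R (Suc n) * X
          + of_nat j * Z * (of_nat (Suc n) * X * Z ^ n) = X * con t * R (Suc n)"
        using c0 X0 Rd[of n] by (simp add: XZ Suc.IH del: of_nat_Suc)
      then have "X * (con c * br Z (R (Suc n))) = X * (of_nat j * of_nat (Suc n) * k)"
        by (simp add: t k_def algebra_simps)
      moreover have "br Z k = br Z (R (Suc n))" by (simp add: k_def br.diff br.power del: power_Suc)
      ultimately show ?thesis using X0 by simp
    qed
    have "of_nat (K 1) * of_nat (Suc n) * k = of_nat (Suc (K 1)) * of_nat (Suc n) * k"
      using Zk[of "K 1"] Zk[of "Suc (K 1)"] by simp
    then have "of_nat (Suc n) * k = 0" by (simp add: algebra_simps)
    then show ?case by (simp add: k_def del: of_nat_Suc)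
  qed (simp add: R0)
  have "\<exists>N. \<forall>m\<ge>N. sx ^ m * (sz ^ i * ev con q sz) \<in> B
      \<and> F (sx ^ m * (sz ^ i * ev con q sz)) = con c * X ^ m * (Z ^ i * ev con q Z)" for i q
  proof (induction q arbitrary: i)
    case 0
    then show ?case using B_con_times[OF B_y, of 0] by (simp add: F_0)
  next
    case (pCons a q)
    from pCons.IH[of "Suc i"] obtain N where
      N: "\<And>m. N \<le> m \<Longrightarrow> sx ^ m * (sz ^ Suc i * ev con q sz) \<in> B
        \<and> F (sx ^ m * (sz ^ Suc i * ev con q sz)) = con c * X ^ m * (Z ^ Suc i * ev con q Z)" by blast
    have "sx ^ m * (sz ^ i * ev con (pCons a q) sz) \<in> B
      \<and> F (sx ^ m * (sz ^ i * ev con (pCons a q) sz)) = con c * X ^ m * (Z ^ i * ev con (pCons a q) Z)"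
      if m: "m \<ge> max N (K i)" for m
    proof -
      have "sx ^ m * sz ^ i \<in> B" using M'[of "Suc i" m i] m by (simp add: K_def)
      moreover have "F (sx ^ m * sz ^ i) = con c * X ^ m * Z ^ i" using GR[of i m] m by (simp add: G_def RZ)
      moreover have "sx ^ m * (sz ^ i * ev con (pCons a q) sz)
          = con a * (sx ^ m * sz ^ i) + sx ^ m * (sz ^ Suc i * ev con q sz)"
        by (simp add: algebra_simps)
      ultimately show ?thesis using N[of m] m
        by (simp add: B_add B_con_times F_add F_con_times del: power_Suc) (simp add: algebra_simps)
    qed
    then show ?case by blast
  qed
  from this[where i = 0] have "\<exists>N. \<forall>m\<ge>N. sx ^ m * ev con q sz \<in> B
      \<and> F (sx ^ m * ev con q sz) = con c * X ^ m * ev con q Z" for q by simp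
  from that[OF c0 X0 XZ we this] show ?thesis .
qed

end

section \<open>Substitutions\<close>

text \<open>
  Simultaneous generation of elements of two rings from corresponding generators. A homomorphism
  defined on generators is this relation, provided that it is single-valued; the same relation
  serves for substitutions of Laurent series and for the comparison of series with functions.
\<close>

inductive corr for k :: "complex \<Rightarrow> 'a::comm_ring_1" and x y z and k' :: "complex \<Rightarrow> 'b::comm_ring_1" and x' y' z' where
  corr_con: "corr k x y z k' x' y' z' (k c) (k' c)"
| corr_x: "corr k x y z k' x' y' z' x x'"
| corr_y: "corr k x y z k' x' y' z' y y'"
| corr_z: "corr k x y z k' x' y' z' z z'"
| corr_add: "corr k x y z k' x' y' z' f f' \<Longrightarrow> corr k x y z k' x' y' z' g g'
    \<Longrightarrow> corr k x y z k' x' y' z' (f + g) (f' + g')"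
| corr_mult: "corr k x y z k' x' y' z' f f' \<Longrightarrow> corr k x y z k' x' y' z' g g'
    \<Longrightarrow> corr k x y z k' x' y' z' (f * g) (f' * g')"

lemma power_add_distrib: "a ^ (N + M) * (b + d) = a ^ M * (a ^ N * b) + a ^ N * (a ^ M * d)"
  and power_add_mult: "a ^ (N + M) * (b * d) = (a ^ N * b) * (a ^ M * d)" for a b d :: "'c::comm_ring_1"
  by (simp_all add: power_add algebra_simps)

text \<open>
  After multiplication by a power of \<open>x\<close>, corresponding elements become the values of one and
  the same polynomial in \<open>x\<close> and \<open>z\<close>. Whether one of them is zero can thus be read off
  from the polynomial.
\<close>

lemma corr_clear_denominators:
  assumes k: "coefficients k" "x * k 1 = x" "z * k 1 = z" and k': "coefficients k'" "x' * k' 1 = x'" "z' * k' 1 = z'"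
    and y: "x * y = ev k p z" "x' * y' = ev k' p z'"
    and c: "corr k x y z k' x' y' z' f f'"
  shows "\<exists>N Q. x ^ N * f = ev2 k Q x z \<and> x' ^ N * f' = ev2 k' Q x' z'"
proof -
  interpret k: coefficients k by (rule k)
  interpret k': coefficients k' by (rule k')
  have shift: "x ^ n * ev2 k Q x z = ev2 k ((pCons 0 ^^ n) Q) x z"
    "x' ^ n * ev2 k' Q x' z' = ev2 k' ((pCons 0 ^^ n) Q) x' z'" for n Q
    by (induction n) (simp_all add: mult.assoc)
  from c show ?thesis
  proof (induction rule: corr.induct)
    case (corr_con c)
    show ?case by (rule exI[of _ 0], rule exI[of _ "[:[:c:]:]"]) simp
  next
    case corr_x
    show ?case by (rule exI[of _ 0], rule exI[of _ "[:0, [:1:]:]"]) (simp add: k k')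
  next
    case corr_y
    show ?case by (rule exI[of _ 1], rule exI[of _ "[:p:]"]) (simp add: y)
  next
    case corr_z
    show ?case by (rule exI[of _ 0], rule exI[of _ "[:[:0, 1:]:]"]) (simp add: k k')
  next
    case (corr_add f f' g g')
    then obtain N Q M R where *: "x ^ N * f = ev2 k Q x z" "x' ^ N * f' = ev2 k' Q x' z'"
        "x ^ M * g = ev2 k R x z" "x' ^ M * g' = ev2 k' R x' z'" by blast
    show ?case
      by (intro exI[of _ "N + M"] exI[of _ "(pCons 0 ^^ M) Q + (pCons 0 ^^ N) R"])
         (simp add: power_add_distrib * shift k.ev2_add k'.ev2_add)
  next
    case (corr_mult f f' g g')
    then obtain N Q M R where *: "x ^ N * f = ev2 k Q x z" "x' ^ N * f' = ev2 k' Q x' z'"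
        "x ^ M * g = ev2 k R x z" "x' ^ M * g' = ev2 k' R x' z'" by blast
    show ?case
      by (intro exI[of _ "N + M"] exI[of _ "Q * R"]) (simp add: power_add_mult * k.ev2_mult k'.ev2_mult)
  qed
qed

text \<open>
  The substitution \<open>x, y, z \<mapsto> X, Y, Z\<close> on the coordinate ring, with values in Laurent series.
\<close>

locale substitution = danielewski +
  fixes X Y Z :: ser
  assumes X_Y: "X * Y = ev con p Z" and X_nonzero: "X \<noteq> 0"
begin

abbreviation (input) "rel \<equiv> corr con sx sy sz con X Y Z"

lemma rel_clear:
  assumes "rel f g"
  obtains N Q where "sx ^ N * f = ev2 con Q sx sz" "X ^ N * g = ev2 con Q X Z"
  using corr_clear_denominators[OF con.coefficients_axioms _ _ con.coefficients_axioms _ _ sx_sy X_Y assms]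
  by auto

lemma rel_unique: "rel f g \<Longrightarrow> rel f h \<Longrightarrow> g = h"
proof -
  assume "rel f g" "rel f h"
  then have "rel (f + con (-1) * f) (g + con (-1) * h)" by (intro corr.intros)
  then have "rel 0 (g - h)" by (simp add: con_minus)
  then obtain N Q where "sx ^ N * 0 = ev2 con Q sx sz" "X ^ N * (g - h) = ev2 con Q X Z"
    by (rule rel_clear)
  then have "X ^ N * (g - h) = 0" using ev2_eq_0[of Q] by simp
  with X_nonzero show "g = h" by simp
qed

definition sub :: "ser \<Rightarrow> ser" where "sub f = (THE g. rel f g)"

lemma sub_eqI: "rel f g \<Longrightarrow> sub f = g"
  unfolding sub_def using rel_unique by blast

lemma rel_ex: "f \<in> alg \<Longrightarrow> \<exists>g. rel f g"
  by (induction rule: alg.induct) (blast intro: corr.intros)+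

lemma rel_sub: "f \<in> alg \<Longrightarrow> rel f (sub f)"
  using rel_ex sub_eqI by metis

lemma sub_con [simp]: "sub (con c) = con c" and sub_x [simp]: "sub sx = X"
  and sub_y [simp]: "sub sy = Y" and sub_z [simp]: "sub sz = Z"
  by (rule sub_eqI, rule corr.intros)+

lemma sub_0 [simp]: "sub 0 = 0" using sub_con[of 0] by simp

lemma sub_add: "f \<in> alg \<Longrightarrow> g \<in> alg \<Longrightarrow> sub (f + g) = sub f + sub g"
  by (rule sub_eqI) (intro corr.intros rel_sub)
lemma sub_mult: "f \<in> alg \<Longrightarrow> g \<in> alg \<Longrightarrow> sub (f * g) = sub f * sub g"
  by (rule sub_eqI) (intro corr.intros rel_sub)
lemma sub_minus: "f \<in> alg \<Longrightarrow> sub (- f) = - sub f"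
  using sub_mult[OF alg_con, of f "-1"] sub_con[of "-1"] by (simp add: con_minus)
lemma sub_ev: "f \<in> alg \<Longrightarrow> sub (ev con q f) = ev con q (sub f)"
  by (induction q) (simp_all add: sub_add sub_mult alg_con alg_mult alg_ev)

lemma sub_alg:
  assumes "X \<in> alg" "Y \<in> alg" "Z \<in> alg"
  shows "f \<in> alg \<Longrightarrow> sub f \<in> alg"
  by (induction rule: alg.induct) (auto simp: sub_add sub_mult assms intro: alg_con alg_add alg_mult)

text \<open>
  Both sides are derivations in \<open>f\<close> and in \<open>g\<close>, so it suffices to compare them on
  the generators.
\<close>

lemma sub_br:
  assumes XZ: "con c * br X Z = X" and f: "f \<in> alg" and g: "g \<in> alg"
  shows "con c * br (sub f) (sub g) = sub (br f g)"
proof -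
  note YZ = conjugate_brackets[OF X_Y XZ X_nonzero]
  have sw: "br sy sx = - ev con (pderiv p) sz" "br sz sx = - sx" "br sz sy = sy"
    by (metis br_swap br_xy, metis br_swap br_z, metis br_swap br_yz minus_minus)
  have sw': "con c * br Y X = - ev con (pderiv p) Z" "con c * br Z X = - X" "con c * br Y Z = - Y"
    by (subst br_swap, simp add: YZ XZ)+
  note base = sw sw' YZ XZ br_xy br_yz br_z sub_minus sub_ev alg_con alg_x alg_y alg_z alg_ev
  have *: "con c * br (sub h) (sub g) = sub (br h g)" if h: "h = sx \<or> h = sy \<or> h = sz" for h
    using g
  proof (induction rule: alg.induct)
    case (alg_add f g)
    have "h \<in> alg" using h alg_x alg_y alg_z by blast
    with alg_add show ?case
      by (simp add: br.add sub_add distrib_left alg_br)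
  next
    case (alg_mult f g)
    have "h \<in> alg" using h alg_x alg_y alg_z by blast
    with alg_mult show ?case
      by (simp add: br.mult sub_add sub_mult alg_br alg.alg_mult distrib_left flip: alg_mult.IH)
  qed (use h in \<open>elim disjE; simp add: base\<close>)+
  from f show ?thesis
  proof (induction rule: alg.induct)
    case (alg_add f h)
    then show ?case using g by (simp add: br_add_left sub_add distrib_left alg_br)
  next
    case (alg_mult f h)
    then show ?case using g
      by (simp add: br_mult_left sub_add sub_mult alg_br alg.alg_mult distrib_left flip: alg_mult.IH)
  qed (use *[of sx] *[of sy] *[of sz] in simp_all)
qed

end

context lie_embedding
begin

text \<open>
  For a potential \<open>f\<close> and large \<open>n\<close>, the brackets of \<open>f\<close> with \<open>x^(n+1)\<close> and \<open>x^(n+1) z\<close> are \<open>x^n\<close>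
  times elements of the coordinate ring, where \<open>F\<close> is known. Hence \<open>F f\<close> and \<open>c\<close> times the
  image of \<open>f\<close> under the substitution have the same brackets with \<open>X\<close> and \<open>Z\<close>, and they differ by a
  constant.
\<close>

lemma F_is_substitution:
  obtains c X Y Z where "c \<noteq> 0" "substitution p X Y Z" "X \<in> alg" "Y \<in> alg" "Z \<in> alg" "con c * br X Z = X"
    "\<And>f. f \<in> B \<Longrightarrow> \<exists>e. F f = con c * substitution.sub p X Y Z f + con e"
proof -
  obtain c X Z where c0: "c \<noteq> 0" and X0: "X \<noteq> 0" and XZ: "con c * br X Z = X"
    and Fx: "\<And>k. 1 \<le> k \<Longrightarrow> \<exists>e. F (sx ^ k) = con c * X ^ k + con e"
    and Fq: "\<And>q. \<exists>N. \<forall>m\<ge>N. sx ^ m * ev con q sz \<in> B \<and> F (sx ^ m * ev con q sz) = con c * X ^ m * ev con q Z"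
    using F_structure by metis
  define Y where "Y = ev con p Z / X"
  interpret substitution p X Y Z by unfold_locales (simp_all add: X0 Y_def)
  have FQ: "\<exists>N. \<forall>m\<ge>N. sx ^ m * ev2 con Q sx sz \<in> B \<and> F (sx ^ m * ev2 con Q sx sz) = con c * X ^ m * ev2 con Q X Z" for Q
  proof (induction Q)
    case 0
    then show ?case using B_con_times[OF B_y, of 0] by (simp add: F_0)
  next
    case (pCons q Q)
    from Fq[of q] obtain M where
      M: "\<And>m. M \<le> m \<Longrightarrow> sx ^ m * ev con q sz \<in> B \<and> F (sx ^ m * ev con q sz) = con c * X ^ m * ev con q Z" by blast
    from pCons obtain N where
      N: "\<And>m. N \<le> m \<Longrightarrow> sx ^ m * ev2 con Q sx sz \<in> B \<and> F (sx ^ m * ev2 con Q sx sz) = con c * X ^ m * ev2 con Q X Z" by blast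
    have "sx ^ m * ev2 con (pCons q Q) sx sz \<in> B
      \<and> F (sx ^ m * ev2 con (pCons q Q) sx sz) = con c * X ^ m * ev2 con (pCons q Q) X Z"
      if m: "m \<ge> max M N" for m
    proof -
      have "sx ^ m * ev2 con (pCons q Q) sx sz = sx ^ m * ev con q sz + sx ^ Suc m * ev2 con Q sx sz"
        by (simp add: algebra_simps)
      then show ?thesis using M[of m] N[of "Suc m"] m
        by (simp add: B_add F_add del: power_Suc con.ev2_pCons) (simp add: algebra_simps)
    qed
    then show ?case by blast
  qed
  have Fg: "\<exists>N. \<forall>m\<ge>N. sx ^ m * g \<in> B \<and> F (sx ^ m * g) = con c * X ^ m * sub g" if g: "g \<in> alg" for g
  proof -
    obtain N Q where *: "sx ^ N * g = ev2 con Q sx sz" "X ^ N * sub g = ev2 con Q X Z"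
      using rel_clear[OF rel_sub[OF g]] by blast
    obtain M where M: "\<And>m. M \<le> m \<Longrightarrow> sx ^ m * ev2 con Q sx sz \<in> B \<and>
        F (sx ^ m * ev2 con Q sx sz) = con c * X ^ m * ev2 con Q X Z" using FQ[of Q] by blast
    have "sx ^ m * g \<in> B \<and> F (sx ^ m * g) = con c * X ^ m * sub g" if "M + N \<le> m" for m
    proof -
      have "m - N + N = m" using that by simp
      then have "sx ^ m * g = sx ^ (m - N) * (sx ^ N * g)" "X ^ m * sub g = X ^ (m - N) * (X ^ N * sub g)"
        by (simp_all only: mult.assoc[symmetric] power_add[symmetric])
      then show ?thesis using M[of "m - N"] that by (simp add: * mult.assoc)
    qed
    then show ?thesis by blast
  qed
  have FB: "\<exists>e. F f = con c * sub f + con e" if f: "f \<in> B" for f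
  proof -
    have fA: "f \<in> alg" using f B_alg by blast
    obtain Nx where Nx: "\<And>m. Nx \<le> m \<Longrightarrow> sx ^ m * br sx f \<in> B \<and> F (sx ^ m * br sx f) = con c * X ^ m * sub (br sx f)"
      using Fg[OF alg_br[OF alg_x fA]] by blast
    obtain Nz where Nz: "\<And>m. Nz \<le> m \<Longrightarrow> sx ^ m * br sz f \<in> B \<and> F (sx ^ m * br sz f) = con c * X ^ m * sub (br sz f)"
      using Fg[OF alg_br[OF alg_z fA]] by blast
    obtain Nt where Nt: "\<And>m. Nt \<le> m \<Longrightarrow> sx ^ m * (sz * br sx f) \<in> B \<and> F (sx ^ m * (sz * br sx f)) = con c * X ^ m * sub (sz * br sx f)"
      using Fg[OF alg_mult[OF alg_z alg_br[OF alg_x fA]]] by blast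
    obtain N1 where N1: "\<And>m. N1 \<le> m \<Longrightarrow> sx ^ m * sz \<in> B \<and> F (sx ^ m * sz) = con c * X ^ m * Z"
      using Fq[of "[:0, 1:]"] by auto
    define n where "n = Nx + Nz + Nt + N1"
    have le: "Nx \<le> n" "Nz \<le> Suc n" "Nt \<le> n" "N1 \<le> Suc n" by (simp_all add: n_def)
    define s :: ser where "s = of_nat (Suc n)"
    have s: "con (of_nat (Suc n)) = s" by (simp only: con_of_nat s_def)
    have s0: "s \<noteq> 0" by (simp add: s_def del: of_nat_Suc)
    have power: "br (h ^ Suc n) t = s * h ^ n * br h t" for h t
      by (simp only: br_power_left s_def) simp
    note Fs = F_con_times[of _ "of_nat (Suc n)", unfolded s] and Bs = B_con_times[of _ "of_nat (Suc n)", unfolded s]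
    have "br (sx ^ Suc n) f = s * (sx ^ n * br sx f)"
      by (simp only: power mult.assoc)
    then have "br (F (sx ^ Suc n)) (F f) = s * (con c * X ^ n * (con c * br X (sub f)))"
      using F_br[OF B_x[of "Suc n"] f] Fs[of "sx ^ n * br sx f"] Nx[OF le(1)]
      by (simp only: sub_br[OF XZ alg_x fA, symmetric] sub_x)
    moreover obtain e where "F (sx ^ Suc n) = con c * X ^ Suc n + con e" using Fx[of "Suc n"] by auto
    then have "br (F (sx ^ Suc n)) (F f) = con c * (s * X ^ n * br X (F f))"
      by (simp only: br_add_left br_con_times_left power br_con_left) simp
    ultimately have "(s * con c * X ^ n) * br X (F f) = (s * con c * X ^ n) * (con c * br X (sub f))"
      by (simp only: mult_ac)
    then have 1: "br X (F f) = con c * br X (sub f)"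
      using c0 X0 s0 by simp
    have "br (sx ^ Suc n * sz) f = sx ^ Suc n * br sz f + s * (sx ^ n * (sz * br sx f))"
      by (simp only: br_mult_left power) (simp add: algebra_simps)
    then have "br (F (sx ^ Suc n * sz)) (F f) = con c * X ^ Suc n * (con c * br Z (sub f))
        + s * (con c * X ^ n * (Z * (con c * br X (sub f))))"
      using F_br[of "sx ^ Suc n * sz" f] N1[OF le(4)] f Nz[OF le(2)] Nt[OF le(3)]
        Fs[of "sx ^ n * (sz * br sx f)"] Bs[of "sx ^ n * (sz * br sx f)"]
        F_add[of "sx ^ Suc n * br sz f" "s * (sx ^ n * (sz * br sx f))"]
        sub_br[OF XZ alg_x fA] sub_br[OF XZ alg_z fA] sub_mult[OF alg_z alg_br[OF alg_x fA]]
      by (simp del: power_Suc)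
    moreover have "br (F (sx ^ Suc n * sz)) (F f) = con c * (X ^ Suc n * br Z (F f) + Z * (s * X ^ n * br X (F f)))"
      using N1[OF le(4)] by (simp only: mult.assoc[of "con c"] br_con_times_left) (simp only: br_mult_left power)
    ultimately have "con c * X ^ Suc n * br Z (F f) = con c * X ^ Suc n * (con c * br Z (sub f))"
      by (auto simp: 1 algebra_simps)
    then have 2: "br Z (F f) = con c * br Z (sub f)"
      using c0 X0 by simp
    have "br (F f - con c * sub f) X = 0" "br (F f - con c * sub f) Z = 0"
      by (subst br_swap, simp add: br.diff br.con_times 1 2)+
    moreover have "br X Z \<noteq> 0" using XZ X0 by auto
    ultimately obtain e where "F f - con c * sub f = con e" using br_nondegenerate by blast
    then show ?thesis by (metis diff_add_cancel add.commute)
  qed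
  have quotient: "g \<in> alg" if "F f = con c * g + con e" "f \<in> B" for f g e
  proof -
    have "g = con (inverse c) * (F f - con e)" using that c0 by (simp add: con_inverse)
    then show ?thesis using F_B[OF that(2)] B_alg by (auto intro: alg_mult alg_con alg_diff)
  qed
  have "X \<in> alg" using FB[OF B_x[of 1]] quotient B_x[of 1] by auto
  moreover have "Y \<in> alg" using FB[OF B_y] quotient B_y by auto
  moreover have "Z \<in> alg"
    by (rule poisson_generation[OF alg_con alg_add alg_mult alg_br \<open>X \<in> alg\<close> \<open>Y \<in> alg\<close> X_Y XZ X0])
  ultimately show ?thesis using that[OF c0 substitution_axioms] XZ FB by blast
qed

end

section \<open>Locally nilpotent and divergence-free derivations\<close>

lemma funpow_additive:
  fixes D :: "'a::ab_group_add \<Rightarrow> 'a"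
  assumes "\<And>f g. D (f + g) = D f + D g"
  shows "(D ^^ n) (f + g) = (D ^^ n) f + (D ^^ n) g" and "(D ^^ n) 0 = 0"
proof -
  have "D 0 = 0" using assms[of 0 0] by simp
  then show "(D ^^ n) (f + g) = (D ^^ n) f + (D ^^ n) g" "(D ^^ n) 0 = 0"
    by (induction n) (simp_all add: assms)
qed

lemma funpow_zero_mono:
  fixes D :: "'a::ab_group_add \<Rightarrow> 'a"
  assumes "\<And>f g. D (f + g) = D f + D g" "(D ^^ n) f = 0" "n \<le> m"
  shows "(D ^^ m) f = 0"
proof -
  have "(D ^^ (m - n + n)) f = 0"
    unfolding funpow_add using assms(2) funpow_additive(2)[OF assms(1)] by simp
  then show ?thesis using assms(3) by simp
qed

text \<open>
  The Leibniz rule moves one application of an operator to an argument at each step, so after \<open>n + m\<close>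
  steps one of the two arguments is gone. Three operators are allowed because the Lie derivative of
  functions differs from that of volume forms.
\<close>

lemma nilpotent_bilinear:
  fixes D1 D2 D3 :: "'a::ab_group_add \<Rightarrow> 'a" and b :: "'a \<Rightarrow> 'a \<Rightarrow> 'a"
  assumes add: "\<And>f g. D3 (f + g) = D3 f + D3 g"
    and b: "\<And>f. b f 0 = 0" "\<And>f. b 0 f = 0"
    and leibniz: "\<And>f g. D3 (b f g) = b (D1 f) g + b f (D2 g)"
  shows "(D1 ^^ n) f = 0 \<Longrightarrow> (D2 ^^ m) g = 0 \<Longrightarrow> (D3 ^^ (n + m)) (b f g) = 0"
proof (induction n arbitrary: f g m)
  case 0
  then show ?case by (simp add: b funpow_additive(2)[OF add])
next
  case (Suc n)
  note outer = Suc.IH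
  from Suc.prems show ?case
  proof (induction m arbitrary: g)
    case 0
    then show ?case by (simp add: b funpow_additive(2)[OF add] del: funpow.simps)
  next
    case (Suc m)
    have "(D3 ^^ (Suc n + Suc m)) (b f g) = (D3 ^^ (n + Suc m)) (D3 (b f g))"
      by (simp add: funpow_swap1)
    also have "\<dots> = (D3 ^^ (n + Suc m)) (b (D1 f) g) + (D3 ^^ (Suc n + m)) (b f (D2 g))"
      by (simp only: leibniz funpow_additive(1)[OF add] add_Suc_right add_Suc)
    also have "(D3 ^^ (n + Suc m)) (b (D1 f) g) = 0"
      using outer[of "D1 f" "Suc m" g] Suc.prems by (simp add: funpow_swap1)
    also have "(D3 ^^ (Suc n + m)) (b f (D2 g)) = 0"
      using Suc.IH[of "D2 g"] Suc.prems by (simp add: funpow_swap1)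
    finally show ?case by simp
  qed
qed

definition nilpotents :: "(ser \<Rightarrow> ser) \<Rightarrow> ser set" where "nilpotents D = {f. \<exists>n. (D ^^ n) f = 0}"

context ser_derivation
begin

lemma nil_add: "f \<in> nilpotents D \<Longrightarrow> g \<in> nilpotents D \<Longrightarrow> f + g \<in> nilpotents D"
proof -
  assume "f \<in> nilpotents D" "g \<in> nilpotents D"
  then obtain n m where "(D ^^ n) f = 0" "(D ^^ m) g = 0" by (auto simp: nilpotents_def)
  then have "(D ^^ (max n m)) (f + g) = 0"
    by (simp add: funpow_additive[OF add] funpow_zero_mono[OF add, of n _ "max n m"] funpow_zero_mono[OF add, of m _ "max n m"])
  then show ?thesis by (auto simp: nilpotents_def)
qed

lemma nil_mult: "f \<in> nilpotents D \<Longrightarrow> g \<in> nilpotents D \<Longrightarrow> f * g \<in> nilpotents D"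
proof -
  assume "f \<in> nilpotents D" "g \<in> nilpotents D"
  then obtain n m where "(D ^^ n) f = 0" "(D ^^ m) g = 0" by (auto simp: nilpotents_def)
  then have "(D ^^ (n + m)) (f * g) = 0"
    by (intro nilpotent_bilinear[of D "(*)" D D]) (simp_all add: add mult algebra_simps)
  then show ?thesis by (auto simp: nilpotents_def)
qed

lemma nil_step: "D f \<in> nilpotents D \<Longrightarrow> f \<in> nilpotents D"
proof -
  assume "D f \<in> nilpotents D"
  then obtain n where "(D ^^ n) (D f) = 0" by (auto simp: nilpotents_def)
  then have "(D ^^ Suc n) f = 0" by (simp add: funpow_swap1)
  then show ?thesis by (auto simp: nilpotents_def simp del: funpow.simps)
qed

lemma nil_con: "con c \<in> nilpotents D"
  by (simp add: nilpotents_def exI[of _ 1])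

lemma nil_power: "f \<in> nilpotents D \<Longrightarrow> f ^ n \<in> nilpotents D"
  by (induction n) (use nil_con[of 1] in \<open>simp_all add: nil_mult\<close>)

lemma nil_ev: "f \<in> nilpotents D \<Longrightarrow> ev con q f \<in> nilpotents D"
  by (induction q) (use nil_con[of 0] in \<open>simp_all add: nil_con nil_add nil_mult\<close>)

text \<open>
  All other terms of the Leibniz formula contain one factor too many derivatives of \<open>f\<close> or \<open>g\<close>.
  It says that the degree function of a locally nilpotent derivation is additive.
\<close>

lemma leading_term:
  "(D ^^ Suc m) f = 0 \<Longrightarrow> (D ^^ Suc n) g = 0
    \<Longrightarrow> (D ^^ (m + n)) (f * g) = of_nat ((m + n) choose m) * ((D ^^ m) f * (D ^^ n) g)"
proof (induction "m + n" arbitrary: m n f g)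
  case 0
  then show ?case by simp
next
  case (Suc k)
  have split: "(D ^^ (m + n)) (f * g) = (D ^^ k) (D f * g) + (D ^^ k) (f * D g)"
  proof -
    have "(D ^^ Suc k) (f * g) = (D ^^ k) (D f * g + f * D g)"
      by (simp add: funpow_swap1 mult add.commute mult.commute)
    then show ?thesis by (simp only: Suc.hyps(2)[symmetric] funpow_additive(1)[OF add])
  qed
  have first: "(D ^^ k) (D f * g) = of_nat (k choose (m - 1)) * ((D ^^ m) f * (D ^^ n) g)" if "m \<noteq> 0"
    using that Suc.hyps(1)[of "m - 1" n "D f" g] Suc.hyps(2) Suc.prems
    by (cases m) (simp_all add: funpow_swap1)
  have second: "(D ^^ k) (f * D g) = of_nat (k choose m) * ((D ^^ m) f * (D ^^ n) g)" if "n \<noteq> 0"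
    using that Suc.hyps(1)[of m "n - 1" f "D g"] Suc.hyps(2) Suc.prems
    by (cases n) (simp_all add: funpow_swap1)
  show ?case
  proof (cases "m = 0 \<or> n = 0")
    case True
    then show ?thesis
      using split first second Suc.hyps(2) Suc.prems
      by (auto simp: funpow_additive(2)[OF add])
  next
    case False
    then obtain m' where m: "m = Suc m'" by (cases m) auto
    then have "(m + n) choose m = (k choose m') + (k choose m)"
      using Suc.hyps(2) by (simp flip: Suc.hyps(2))
    then show ?thesis using split first second False by (simp add: m algebra_simps)
  qed
qed

end

context danielewski
begin

text \<open>
  The vector field with \<open>x\<close>-component \<open>x \<alpha>\<close> and \<open>z\<close>-component \<open>\<gamma>\<close>. With respect to
  \<open>dx \<and> dz / x\<close> its divergence is \<open>eu \<alpha> + dz \<gamma>\<close>.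
\<close>

definition vfield where "vfield \<alpha> \<gamma> f = \<alpha> * eu f + \<gamma> * dz f"

lemma ser_derivation_vfield: "ser_derivation (vfield \<alpha> \<gamma>)"
  by standard (simp_all add: vfield_def eu.add dz.add eu.mult dz.mult algebra_simps)

lemma vfield_coordinates: "vfield \<alpha> \<gamma> sx = sx * \<alpha>" "vfield \<alpha> \<gamma> sz = \<gamma>"
  by (simp_all add: vfield_def)

lemma eu_y: "eu sy = - sy" and x_dz_y: "sx * dz sy = ev con (pderiv p) sz"
  using br_yz br_xy by (simp_all add: br_def)

lemma y_nonzero: "sy \<noteq> 0"
proof
  assume "sy = 0"
  then have "laur (- 1) p $$ (- 1) = 0" by (simp flip: sy_laur)
  then show False using degree_p by (auto simp: laur_nth)
qed

lemma bezout_alg: obtains U V where "U \<in> alg" "V \<in> alg" "U * sx * sy + V * ev con (pderiv p) sz = 1"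
proof -
  obtain u v where uv: "u * p + v * pderiv p = 1" using bezout by blast
  have "ev con u sz * sx * sy + ev con v sz * ev con (pderiv p) sz = ev con (u * p + v * pderiv p) sz"
    by (simp add: con.ev_add con.ev_mult mult.assoc sx_sy)
  also have "\<dots> = 1" by (simp add: uv one_pCons)
  finally show ?thesis using that[of "ev con u sz" "ev con v sz"] alg_ev[OF alg_z] by blast
qed

text \<open>
  The vector fields on the surface are generated over the coordinate ring by the Hamiltonian fields
  of the coordinates: \<open>field = A {x, _} + B {y, _} + C {z, _}\<close>.
\<close>

lemma vfield_hamiltonian_decomposition:
  assumes D: "\<And>f. f \<in> alg \<Longrightarrow> vfield \<alpha> \<gamma> f \<in> alg"
  obtains A B C where "A \<in> alg" "B \<in> alg" "C \<in> alg" "\<alpha> = - (B * dz sy + C)" "\<gamma> = A * sx - B * sy"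
proof -
  define a b where "a = vfield \<alpha> \<gamma> sx" and "b = vfield \<alpha> \<gamma> sy"
  have ab: "a \<in> alg" "b \<in> alg" "\<gamma> \<in> alg"
    using D[OF alg_x] D[OF alg_y] D[OF alg_z] by (simp_all add: a_def b_def vfield_coordinates)
  obtain U V where UV: "U \<in> alg" "V \<in> alg" "U * sx * sy + V * ev con (pderiv p) sz = 1"
    using bezout_alg by blast
  let ?q = "ev con (pderiv p) sz"
  have a: "a = sx * \<alpha>" by (simp add: a_def vfield_coordinates)
  have xb: "sx * b = ?q * \<gamma> - sy * a"
    using x_dz_y by (simp add: b_def vfield_def eu_y a algebra_simps)
  \<comment> \<open>Contracting the volume form with the field and using \<open>1 = U x y + V p'(z)\<close>.\<close>
  define A B C where "A = V * b + U * sy * \<gamma>" and "B = - (V * a)" and "C = - (U * sy * a)"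
  have "A * sx - B * sy = V * (sx * b) + U * sx * sy * \<gamma> + V * sy * a"
    by (simp add: A_def B_def algebra_simps)
  also have "\<dots> = (U * sx * sy + V * ?q) * \<gamma>" by (simp add: xb algebra_simps)
  finally have 1: "\<gamma> = A * sx - B * sy" by (simp add: UV)
  have "sx * - (B * dz sy + C) = (U * sx * sy + V * (sx * dz sy)) * a"
    by (simp add: B_def C_def algebra_simps)
  then have "sx * - (B * dz sy + C) = sx * \<alpha>" by (simp add: x_dz_y UV a)
  then have 2: "\<alpha> = - (B * dz sy + C)" by simp
  show ?thesis
    using that[OF _ _ _ 2 1] ab UV by (simp add: A_def B_def C_def alg_add alg_mult alg_minus alg_y)
qed

text \<open>
  The divergence of \<open>A {x, _}\<close> is \<open>{x, A}\<close>, and likewise for \<open>y\<close> and \<open>z\<close>.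
\<close>

lemma vfield_divergence_alg:
  assumes D: "\<And>f. f \<in> alg \<Longrightarrow> vfield \<alpha> \<gamma> f \<in> alg"
  shows "eu \<alpha> + dz \<gamma> \<in> alg"
proof -
  obtain A B C where ABC: "A \<in> alg" "B \<in> alg" "C \<in> alg"
    and \<alpha>: "\<alpha> = - (B * dz sy + C)" and \<gamma>: "\<gamma> = A * sx - B * sy"
    using vfield_hamiltonian_decomposition[OF D] by blast
  have "eu \<alpha> + dz \<gamma> = br sx A + br sy B + br sz C"
    unfolding \<alpha> \<gamma> br_def
    by (simp add: eu.minus eu.diff eu.add eu.mult dz.diff dz.mult eu_dz eu_y dz.minus algebra_simps)
  then show ?thesis using ABC by (simp add: alg_add alg_br alg_x alg_y alg_z)
qed

text \<open>
  The equation \<open>eu h = \<gamma>\<close> is solved by dividing the coefficient of \<open>x^n\<close> by \<open>n\<close>, which fails only for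
  \<open>n = 0\<close>. There the coefficient \<open>q\<close> of \<open>\<gamma>\<close> is constant because the divergence is zero, and divisible
  by \<open>p\<close> because \<open>\<gamma>\<close> lies in the ideal generated by \<open>x\<close> and \<open>y\<close>; so it vanishes. A polynomial in
  \<open>z\<close> can still be added to \<open>h\<close>, and it adjusts \<open>dz h\<close>.
\<close>

lemma divergence_free_hamiltonian:
  assumes D: "\<And>f. f \<in> alg \<Longrightarrow> vfield \<alpha> \<gamma> f \<in> alg" and div: "eu \<alpha> + dz \<gamma> = 0"
  obtains h where "h \<in> alg" "eu h = \<gamma>" "dz h = - \<alpha>"
proof -
  have \<gamma>: "\<gamma> \<in> alg" and a: "sx * \<alpha> \<in> alg"
    using D[OF alg_x] D[OF alg_z] by (simp_all add: vfield_coordinates)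
  have shift: "(sx * f) $$ n = f $$ (n - 1)" for f n
    by (simp add: sx_def fls_X_times_conv_shift)
  have "\<exists>f\<in>alg. \<exists>q. f' = eu f + fls_const (pe q)" if "f' \<in> alg" for f'
    using alg_lspan[OF that]
  proof (induction rule: lspan.induct)
    case lspan_0
    then show ?case using alg_0 by (intro bexI[of _ 0] exI[of _ 0]) auto
  next
    case (lspan_Cons f n q)
    then obtain g r where g: "g \<in> alg" "f = eu g + fls_const (pe r)" by blast
    show ?case
    proof (cases "n = 0")
      case True
      have "laur n q + f = eu g + fls_const (pe (q + r))"
        by (rule fls_eqI) (simp add: g laur_nth True pe_simps)
      with g show ?thesis by blast
    next
      case False
      have "laur n q + f = eu (laur n (smult (inverse (of_int n)) q) + g) + fls_const (pe r)"
        using False by (simp add: g eu.add eu_laur)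
      moreover have "laur n (smult (inverse (of_int n)) q) \<in> alg"
        using lspan_Cons False by (intro laur_alg) (simp add: dvd_smult)
      ultimately show ?thesis using alg_add g by blast
    qed
  qed
  then obtain f q where f: "f \<in> alg" and fq: "\<gamma> = eu f + fls_const (pe q)" using \<gamma> by blast
  have "pderiv q = 0"
  proof -
    have "(eu \<alpha> + dz \<gamma>) $$ 0 = pe (pderiv q)"
      unfolding fq by (simp add: eu_nth dz.add dz_nth pe_simps)
    then show ?thesis by (simp add: div)
  qed
  moreover have "p dvd q"
  proof -
    obtain A B C where ABC: "A \<in> alg" "B \<in> alg" "\<gamma> = A * sx - B * sy"
      using vfield_hamiltonian_decomposition[OF D] by blast
    obtain r where r: "A $$ (-1) = pe (p * r)" using alg_nth[OF ABC(1), of "-1"] by auto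
    obtain s where s: "B $$ 1 = pe s" using alg_nth[OF ABC(2), of 1] by auto
    have "laur (-1) p = fls_shift 1 (fls_const (pe p))" by (simp add: laur_def)
    then have "(B * sy) $$ 0 = B $$ 1 * pe p"
      by (simp add: sy_laur fls_shifted_times_simps)
    moreover have "(A * sx) $$ 0 = A $$ (-1)" using shift[of A 0] by (simp add: mult.commute)
    ultimately have "\<gamma> $$ 0 = pe (p * (r - s))" by (simp add: ABC(3) r s pe_simps algebra_simps)
    moreover have "\<gamma> $$ 0 = pe q" by (simp add: fq eu_nth)
    ultimately show ?thesis by simp
  qed
  ultimately have "q = 0"
    using degree_p pderiv_eq_0_iff[of q] dvd_imp_degree_le[of p q] by auto
  then have eu_f: "eu f = \<gamma>" using fq by simp
  have "eu (dz f + \<alpha>) = 0" using div by (simp add: eu.add eu_dz eu_f add.commute)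
  then have const: "dz f + \<alpha> = fls_const ((dz f + \<alpha>) $$ 0)" by (rule eu_eq_0)
  obtain P where "f $$ 0 = pe P" using alg_nth[OF f, of 0] by auto
  moreover obtain R where "(sx * \<alpha>) $$ 1 = pe R" using alg_nth[OF a, of 1] by auto
  ultimately have "(dz f + \<alpha>) $$ 0 = pe (pderiv P + R)" by (simp add: dz_nth shift pe_simps)
  moreover obtain Q where "pderiv Q = pderiv P + R" using ex_antiderivative by blast
  ultimately have "dz f + \<alpha> = ev con (pderiv Q) sz"
    using const by (simp add: ev_laur laur_def)
  then have Q: "dz f + \<alpha> = dz (ev con Q sz)" by (simp add: dz.ev)
  show ?thesis
  proof (rule that[of "f - ev con Q sz"])
    show "f - ev con Q sz \<in> alg" by (intro alg_diff f alg_ev alg_z)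
    show "eu (f - ev con Q sz) = \<gamma>" by (simp add: eu.diff eu.ev eu_f)
    show "dz (f - ev con Q sz) = - \<alpha>" using Q by (simp add: dz.diff algebra_simps)
  qed
qed

text \<open>
  Let \<open>g\<close> be the divergence and \<open>T = D + g\<close>, the Lie derivative on volume forms. It satisfies
  \<open>T {f, h} = {D f, h} + {f, D h}\<close>, so it is nilpotent on brackets, and on \<open>1\<close>, which is a combination of
  \<open>{x, z}\<close> and \<open>{x, y}\<close> over the coordinate ring. The last nonzero iterate \<open>f\<close> of \<open>T\<close> on \<open>1\<close> satisfies
  \<open>D f = - g f\<close>. If \<open>g \<noteq> 0\<close>, this contradicts additivity of the degree of \<open>D\<close>: the right hand side
  has at least the degree of \<open>f\<close>, the left hand side a smaller one.
\<close>

lemma locally_nilpotent_divergence_free: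
  assumes D: "\<And>f. f \<in> alg \<Longrightarrow> vfield \<alpha> \<gamma> f \<in> alg" and nilpotents: "alg \<subseteq> nilpotents (vfield \<alpha> \<gamma>)"
  shows "eu \<alpha> + dz \<gamma> = 0"
proof (rule ccontr)
  let ?D = "vfield \<alpha> \<gamma>"
  define g where "g = eu \<alpha> + dz \<gamma>"
  assume "eu \<alpha> + dz \<gamma> \<noteq> 0"
  then have g0: "g \<noteq> 0" by (simp add: g_def)
  interpret D: ser_derivation ?D by (rule ser_derivation_vfield)
  have gA: "g \<in> alg" unfolding g_def by (rule vfield_divergence_alg[OF D])
  define T where "T f = ?D f + g * f" for f
  have T_add: "T (f + h) = T f + T h" for f h by (simp add: T_def D.add algebra_simps)
  have T_mult: "T (f * h) = ?D f * h + f * T h" for f h by (simp add: T_def D.mult algebra_simps)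
  have T_br: "T (br f h) = br (?D f) h + br f (?D h)" for f h
    by (simp add: T_def g_def br_def vfield_def eu.add dz.add eu.mult dz.mult eu.diff dz.diff eu_dz algebra_simps)
  have br_nil: "\<exists>n. (T ^^ n) (br f h) = 0" if fh: "f \<in> alg" "h \<in> alg" for f h
  proof -
    obtain n m where "(?D ^^ n) f = 0" "(?D ^^ m) h = 0" using fh nilpotents by (fastforce simp: nilpotents_def)
    then have "(T ^^ (n + m)) (br f h) = 0" by (intro nilpotent_bilinear[of T br ?D ?D]) (simp_all add: T_add T_br)
    then show ?thesis by blast
  qed
  have mult_nil: "\<exists>n. (T ^^ n) (f * h) = 0" if fh: "f \<in> alg" "\<exists>n. (T ^^ n) h = 0" for f h
  proof -
    obtain n m where "(?D ^^ n) f = 0" "(T ^^ m) h = 0" using fh nilpotents by (fastforce simp: nilpotents_def)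
    then have "(T ^^ (n + m)) (f * h) = 0" by (intro nilpotent_bilinear[of T "(*)" ?D T]) (simp_all add: T_add T_mult)
    then show ?thesis by blast
  qed
  obtain U V where UV: "U \<in> alg" "V \<in> alg" "U * sx * sy + V * ev con (pderiv p) sz = 1"
    using bezout_alg by blast
  have "\<exists>n. (T ^^ n) ((U * sy) * br sx sz) = 0" "\<exists>n. (T ^^ n) (V * br sx sy) = 0"
    by (intro mult_nil br_nil alg_mult UV alg_x alg_y alg_z)+
  then obtain n m where "(T ^^ n) ((U * sy) * br sx sz) = 0" "(T ^^ m) (V * br sx sy) = 0" by blast
  then have "(T ^^ max n m) ((U * sy) * br sx sz + V * br sx sy) = 0"
    by (simp add: funpow_additive[OF T_add] funpow_zero_mono[OF T_add, of n _ "max n m"]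
        funpow_zero_mono[OF T_add, of m _ "max n m"])
  also have "(U * sy) * br sx sz + V * br sx sy = 1"
    using UV(3) by (simp add: br_z br_xy mult_ac)
  finally have ex: "\<exists>n. (T ^^ n) 1 = 0" by blast
  define N where "N = (LEAST n. (T ^^ n) 1 = 0)"
  have N: "(T ^^ N) 1 = 0" unfolding N_def using ex by (rule LeastI_ex)
  then obtain M where M: "N = Suc M" by (cases N) auto
  define f where "f = (T ^^ M) 1"
  have f0: "f \<noteq> 0" using not_less_Least[of M "\<lambda>n. (T ^^ n) 1 = 0"] M by (auto simp: f_def N_def)
  have "(T ^^ n) 1 \<in> alg" for n
    by (induction n) (simp_all add: alg_1 T_def alg_add alg_mult D gA)
  then have fA: "f \<in> alg" by (simp add: f_def)
  have Df: "g * f = - ?D f" using N by (simp add: M f_def T_def eq_neg_iff_add_eq_0 add.commute)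
  have last: "\<exists>n. (?D ^^ n) h \<noteq> 0 \<and> (?D ^^ Suc n) h = 0" if "h \<in> alg" "h \<noteq> 0" for h
  proof -
    have ex: "\<exists>n. (?D ^^ n) h = 0" using that nilpotents by (auto simp: nilpotents_def)
    define k where "k = (LEAST n. (?D ^^ n) h = 0)"
    have "(?D ^^ k) h = 0" unfolding k_def using ex by (rule LeastI_ex)
    with that obtain j where "k = Suc j" by (cases k) auto
    then have "(?D ^^ j) h \<noteq> 0" using not_less_Least[of j "\<lambda>n. (?D ^^ n) h = 0"] by (auto simp: k_def)
    with \<open>(?D ^^ k) h = 0\<close> \<open>k = Suc j\<close> show ?thesis by blast
  qed
  obtain i where i: "(?D ^^ i) g \<noteq> 0" "(?D ^^ Suc i) g = 0" using last[OF gA g0] by blast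
  obtain j where j: "(?D ^^ j) f \<noteq> 0" "(?D ^^ Suc j) f = 0" using last[OF fA f0] by blast
  have "(?D ^^ (i + j)) (g * f) + (?D ^^ (i + j)) (?D f) = 0"
    by (simp add: Df funpow_additive[OF D.add] flip: funpow_additive(1)[OF D.add])
  moreover have "(?D ^^ (i + j)) (?D f) = 0"
    using funpow_zero_mono[OF D.add j(2), of "Suc (i + j)"] by (simp add: funpow_swap1)
  ultimately have "(?D ^^ (i + j)) (g * f) = 0" by simp
  then show False using D.leading_term[OF i(2) j(2)] i(1) j(1) by (simp add: binomial_eq_0_iff)
qed

lemma power_hamiltonians_nilpotent: "alg \<subseteq> nilpotents (br (sx ^ k))" "alg \<subseteq> nilpotents (br (sy ^ k))"
proof -
  have alg_nil: "alg \<subseteq> nilpotents D" if "ser_derivation D" "sx \<in> nilpotents D" "sy \<in> nilpotents D" "sz \<in> nilpotents D" for D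
  proof
    interpret ser_derivation D by (rule that(1))
    fix f assume "f \<in> alg"
    then show "f \<in> nilpotents D"
      by (induction rule: alg.induct) (use that nil_con nil_add nil_mult in auto)
  qed
  have of_nat_nil: "of_nat n \<in> nilpotents D" if "ser_derivation D" for D n
    using ser_derivation.nil_con[OF that, of "of_nat n"] by (simp add: con_of_nat)
  note steps = br.nil_mult br.nil_power br.nil_ev of_nat_nil[OF br.ser_derivation_axioms]
  have x: "sx \<in> nilpotents (br (sx ^ k))" by (rule br.nil_step) (use br.nil_con[of 0] in \<open>simp add: br_power_left\<close>)
  have z: "sz \<in> nilpotents (br (sx ^ k))"
    by (rule br.nil_step) (simp add: br_power_left br_z, intro steps x)
  have y: "sy \<in> nilpotents (br (sx ^ k))"
    by (rule br.nil_step) (simp add: br_power_left br_xy, intro steps x z)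
  show "alg \<subseteq> nilpotents (br (sx ^ k))" by (rule alg_nil[OF br.ser_derivation_axioms x y z])
  have y: "sy \<in> nilpotents (br (sy ^ k))" by (rule br.nil_step) (use br.nil_con[of 0] in \<open>simp add: br_power_left\<close>)
  have m: "con (- 1) \<in> nilpotents (br (sy ^ k))" by (rule br.nil_con)
  have z: "sz \<in> nilpotents (br (sy ^ k))"
  proof (rule br.nil_step)
    have "br (sy ^ k) sz = con (-1) * (of_nat k * sy ^ (k - 1) * sy)"
      by (simp add: br_power_left br_yz con_minus)
    then show "br (sy ^ k) sz \<in> nilpotents (br (sy ^ k))" by (simp only:) (intro steps m y)
  qed
  have x: "sx \<in> nilpotents (br (sy ^ k))"
  proof (rule br.nil_step)
    have "br (sy ^ k) sx = con (-1) * (of_nat k * sy ^ (k - 1) * ev con (pderiv p) sz)"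
    proof -
      have "br sy sx = - ev con (pderiv p) sz" by (metis br_swap br_xy)
      then show ?thesis by (simp add: br_power_left con_minus)
    qed
    then show "br (sy ^ k) sx \<in> nilpotents (br (sy ^ k))" by (simp only:) (intro steps m y z)
  qed
  show "alg \<subseteq> nilpotents (br (sy ^ k))" by (rule alg_nil[OF br.ser_derivation_axioms x y z])
qed

end

section \<open>Inverse substitutions\<close>

text \<open>
  Let \<open>T\<close> be the composite. For \<open>f = x\<close> and \<open>f = y\<close>, applying a derivation to the hypothesis for \<open>f\<close>
  and for \<open>f^2\<close> gives \<open>D f = c c' D(T f)\<close> and \<open>f D f = c c' T f D(T f)\<close>, hence \<open>T f = f\<close>, and then
  \<open>c c' = 1\<close>. Now \<open>T\<close> preserves the bracket, and its fixed points form a Poisson algebra that contains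
  \<open>x\<close> and \<open>y\<close>.
\<close>

lemma (in danielewski) substitutions_inverse:
  assumes s: "substitution p X Y Z" and s': "substitution p X' Y' Z'"
    and XZ: "con c * br X Z = X" and XZ': "con c' * br X' Z' = X'"
    and alg': "X' \<in> alg" "Y' \<in> alg" "Z' \<in> alg"
    and scaled: "\<And>f. f \<in> {sx, sx ^ 2, sy, sy ^ 2} \<Longrightarrow>
      \<exists>e. f = con (c * c') * substitution.sub p X Y Z (substitution.sub p X' Y' Z' f) + con e"
    and f: "f \<in> alg"
  shows "substitution.sub p X Y Z (substitution.sub p X' Y' Z' f) = f"
proof -
  interpret s: substitution p X Y Z by (rule s)
  interpret s': substitution p X' Y' Z' by (rule s')
  define T where "T f = s.sub (s'.sub f)" for f
  note sub_alg = s'.sub_alg[OF alg']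
  have T_add: "T (f + g) = T f + T g" and T_mult: "T (f * g) = T f * T g" if "f \<in> alg" "g \<in> alg" for f g
    using that by (simp_all add: T_def s.sub_add s'.sub_add s.sub_mult s'.sub_mult sub_alg)
  have eu: "eu f = con (c * c') * eu (T f)" if "f \<in> {sx, sx ^ 2, sy, sy ^ 2}" for f
  proof -
    from scaled[OF that] obtain e where e: "f = con (c * c') * T f + con e" by (auto simp: T_def)
    show ?thesis by (subst e) (simp add: eu.add eu.con_times)
  qed
  have fixed: "T f = f" if f: "f \<in> {sx, sy}" for f
  proof -
    have f0: "f \<in> alg" "eu f \<noteq> 0" using f alg_x alg_y y_nonzero by (auto simp: eu_y)
    have "2 * f * eu f = con (c * c') * eu (T (f ^ 2))"
      using eu[of "f ^ 2"] f by (auto simp: eu.power)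
    also have "T (f ^ 2) = T f ^ 2" by (simp add: power2_eq_square T_mult f0)
    also have "con (c * c') * eu (T f ^ 2) = 2 * T f * (con (c * c') * eu (T f))"
      by (simp add: eu.power)
    also have "con (c * c') * eu (T f) = eu f" using eu[of f] f by auto
    finally show ?thesis using f0 by simp
  qed
  have "con (c * c') * sx = sx" using eu[of sx] fixed[of sx] by simp
  then have cc: "con (c * c') = 1" by simp
  have T_br: "br (T f) (T g) = T (br f g)" if "f \<in> alg" "g \<in> alg" for f g
  proof -
    have "T (br f g) = s.sub (con c' * br (s'.sub f) (s'.sub g))"
      using s'.sub_br[OF XZ' that] by (simp add: T_def)
    also have "\<dots> = con c' * (con c * br (T f) (T g))"
      using that by (simp add: s.sub_mult s.sub_br[OF XZ] T_def alg_con alg_br sub_alg)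
    also have "\<dots> = con (c * c') * br (T f) (T g)" by (simp add: con_mult mult_ac)
    finally show ?thesis by (simp add: cc)
  qed
  define S where "S = {f \<in> alg. T f = f}"
  have S_con: "con a \<in> S" for a by (simp add: S_def alg_con T_def)
  have S_add: "f + g \<in> S" and S_mult: "f * g \<in> S" and S_br: "br f g \<in> S" if "f \<in> S" "g \<in> S" for f g
    using that T_br[of f g] by (simp_all add: S_def alg_add alg_mult alg_br T_add T_mult)
  have S_x: "sx \<in> S" and S_y: "sy \<in> S" using fixed alg_x alg_y by (auto simp: S_def)
  have "con 1 * br sx sz = sx" by (simp add: br_z)
  from poisson_generation[OF S_con S_add S_mult S_br S_x S_y sx_sy this]
  have S_z: "sz \<in> S" by simp
  from f have "f \<in> S"
    by (induction rule: alg.induct) (auto intro: S_con S_x S_y S_z S_add S_mult)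
  then show ?thesis by (simp add: S_def T_def)
qed

section \<open>Regular functions as Laurent series\<close>

context danielewski
begin

definition const_fun :: "complex \<Rightarrow> func" where "const_fun c = on_surface p (\<lambda>_. c)"

lemma const_fun_regular: "const_fun c \<in> regular p"
  using regular_poly_z[of p "[:c:]"] by (simp add: const_fun_def case_prod_unfold)

lemma scal_const_fun: "f \<in> regular p \<Longrightarrow> scal c f = const_fun c * f"
  by (auto simp: fun_eq_iff scal_def const_fun_def on_surface_def dest: regular_outside)

interpretation const_fun: coefficients const_fun
  by standard (auto simp: const_fun_def on_surface_def fun_eq_iff)

lemma const_fun_1: "f \<in> regular p \<Longrightarrow> f * const_fun 1 = f"
  by (auto simp: fun_eq_iff const_fun_def on_surface_def dest: regular_outside)

lemma ev_coord_z: "ev const_fun q (coord_z p) = on_surface p (\<lambda>(x, y, z). poly q z)"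
proof (induction q)
  case 0
  show ?case unfolding const_fun.ev_0 by (auto simp: fun_eq_iff on_surface_def)
next
  case (pCons a q)
  show ?case unfolding const_fun.ev_pCons pCons.IH
    by (auto simp: fun_eq_iff const_fun_def on_surface_def coord_z_def)
qed

lemma coord_xy: "coord_x p * coord_y p = ev const_fun p (coord_z p)"
  by (auto simp: ev_coord_z fun_eq_iff coord_x_def coord_y_def on_surface_def surface_def)

lemma regular_induct [consumes 1, case_names con x y z add mult]:
  assumes f: "f \<in> regular p"
    and con: "\<And>c. P (const_fun c)" and xyz: "P (coord_x p)" "P (coord_y p)" "P (coord_z p)"
    and add: "\<And>f g. f \<in> regular p \<Longrightarrow> g \<in> regular p \<Longrightarrow> P f \<Longrightarrow> P g \<Longrightarrow> P (f + g)"
    and mult: "\<And>f g. f \<in> regular p \<Longrightarrow> g \<in> regular p \<Longrightarrow> P f \<Longrightarrow> P g \<Longrightarrow> P (f * g)"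
  shows "P f"
proof -
  have reg: "on_surface p (poly3 A) \<in> regular p" for A by (auto simp: regular_def)
  have const_fun_0: "P (on_surface p (poly3 0))"
    using con[of 0] by (simp add: const_fun_def poly3_def on_surface_def case_prod_unfold cong: if_cong)
  have 1: "P (on_surface p (poly3 [:[:q:]:]))" for q
  proof (induction q)
    case (pCons a q)
    have "on_surface p (poly3 [:[:pCons a q:]:]) = const_fun a + coord_z p * on_surface p (poly3 [:[:q:]:])"
      by (auto simp: fun_eq_iff on_surface_def poly3_def const_fun_def coord_z_def)
    then show ?case by (simp only:) (intro add mult con xyz const_fun_regular regular_coord regular_mult reg pCons)
  qed (use const_fun_0 in simp)
  have 2: "P (on_surface p (poly3 [:q:]))" for q
  proof (induction q)
    case (pCons a q)
    have "on_surface p (poly3 [:pCons a q:])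
        = on_surface p (poly3 [:[:a:]:]) + coord_y p * on_surface p (poly3 [:q:])"
      by (auto simp: fun_eq_iff on_surface_def poly3_def coord_y_def)
    then show ?case by (simp only:) (intro add mult 1 xyz regular_coord regular_mult reg pCons)
  qed (use const_fun_0 in simp)
  have "P (on_surface p (poly3 q))" for q
  proof (induction q)
    case (pCons a q)
    have "on_surface p (poly3 (pCons a q)) = on_surface p (poly3 [:a:]) + coord_x p * on_surface p (poly3 q)"
      by (auto simp: fun_eq_iff on_surface_def poly3_def coord_x_def)
    then show ?case by (simp only:) (intro add mult 2 xyz regular_coord regular_mult reg pCons)
  qed (rule const_fun_0)
  with f show ?thesis by (auto simp: regular_def)
qed

abbreviation (input) "represents \<equiv> corr const_fun (coord_x p) (coord_y p) (coord_z p) con sx sy sz"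

lemma represents_regular: "represents f e \<Longrightarrow> f \<in> regular p" and represents_alg: "represents f e \<Longrightarrow> e \<in> alg"
  by (induction rule: corr.induct)
     (auto intro: const_fun_regular regular_coord regular_add regular_mult alg_con alg_x alg_y alg_z alg_add alg_mult)

lemma regular_ex_represents: "f \<in> regular p \<Longrightarrow> \<exists>e. represents f e"
  by (induction rule: regular_induct) (blast intro: corr.intros)+

lemma alg_ex_represents: "e \<in> alg \<Longrightarrow> \<exists>f. represents f e"
  by (induction rule: alg.induct) (blast intro: corr.intros)+

lemma represents_clear:
  assumes "represents f e"
  obtains N Q where "coord_x p ^ N * f = ev2 const_fun Q (coord_x p) (coord_z p)" "sx ^ N * e = ev2 con Q sx sz"
  using corr_clear_denominators[OF const_fun.coefficients_axioms _ _ con.coefficients_axioms _ _ coord_xy sx_sy assms]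
    const_fun_1 regular_coord by auto

lemma regular_along_curve:
  assumes "f \<in> regular p" "\<And>t. poly a t * poly b t = poly p (poly c t)"
  shows "\<exists>r. \<forall>t. f (poly a t, poly b t, poly c t) = poly r t"
  using assms(1)
proof (induction rule: regular_induct)
  case (con d)
  show ?case by (rule exI[of _ "[:d:]"]) (simp add: const_fun_def on_surface_def surface_def assms(2))
next
  case x
  show ?case by (rule exI[of _ a]) (simp add: coord_x_def on_surface_def surface_def assms(2))
next
  case y
  show ?case by (rule exI[of _ b]) (simp add: coord_y_def on_surface_def surface_def assms(2))
next
  case z
  show ?case by (rule exI[of _ c]) (simp add: coord_z_def on_surface_def surface_def assms(2))
next
  case (add f g)
  then obtain r s where "\<forall>t. f (poly a t, poly b t, poly c t) = poly r t" "\<forall>t. g (poly a t, poly b t, poly c t) = poly s t"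
    by blast
  then show ?case by (intro exI[of _ "r + s"]) simp
next
  case (mult f g)
  then obtain r s where "\<forall>t. f (poly a t, poly b t, poly c t) = poly r t" "\<forall>t. g (poly a t, poly b t, poly c t) = poly s t"
    by blast
  then show ?case by (intro exI[of _ "r * s"]) simp
qed

lemma poly_zero_off_zeros:
  fixes r a :: "complex poly"
  assumes "\<And>t. poly a t \<noteq> 0 \<Longrightarrow> poly r t = 0" "a \<noteq> 0"
  shows "r = 0"
proof -
  have "poly (a * r) t = 0" for t using assms(1)[of t] by auto
  then have "a * r = 0" using poly_all_0_iff_0 by blast
  with assms(2) show ?thesis by simp
qed

text \<open>
  The points with \<open>x = 0\<close> are limits of points with \<open>x \<noteq> 0\<close>: those with \<open>y \<noteq> 0\<close> along the curve
  \<open>(p(z + t) / y, y, z + t)\<close>, and \<open>(0, 0, z)\<close> along \<open>(0, t, z)\<close>.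
\<close>

lemma regular_eq_0I:
  assumes f: "f \<in> regular p" and 0: "\<And>x y z. x \<noteq> 0 \<Longrightarrow> x * y = poly p z \<Longrightarrow> f (x, y, z) = 0"
  shows "f = 0"
proof -
  have y: "f (0, y, z) = 0" if "y \<noteq> 0" "poly p z = 0" for y z
  proof -
    define a where "a = smult (inverse y) (pcompose p [:z, 1:])"
    have "degree (pcompose p [:z, 1:]) = degree p" by (simp add: degree_pcompose)
    then have "a \<noteq> 0" using that degree_p by (auto simp: a_def)
    have curve: "poly a t * poly [:y:] t = poly p (poly [:z, 1:] t)" for t
      using that by (simp add: a_def poly_pcompose)
    then obtain r where r: "\<And>t. f (poly a t, poly [:y:] t, poly [:z, 1:] t) = poly r t"
      using regular_along_curve[OF f] by blast
    have "r = 0"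
      using poly_zero_off_zeros[of a r] \<open>a \<noteq> 0\<close> 0 curve by (simp add: r[symmetric])
    then show ?thesis using r[of 0] that by (simp add: a_def poly_pcompose)
  qed
  have "f (0, 0, z) = 0" if "poly p z = 0" for z
  proof -
    have "poly 0 t * poly [:0, 1:] t = poly p (poly [:z:] t)" for t using that by simp
    then obtain r where r: "\<And>t. f (poly 0 t, poly [:0, 1:] t, poly [:z:] t) = poly r t"
      using regular_along_curve[OF f] by blast
    have "r = 0"
      using poly_zero_off_zeros[of "[:0, 1:]" r] y that by (simp add: r[symmetric])
    then show ?thesis using r[of 0] by simp
  qed
  with y 0 have "f (x, y, z) = 0" if "x * y = poly p z" for x y z
    using that by (cases "x = 0"; cases "y = 0") auto
  then show ?thesis
    using regular_outside[OF f] by (fastforce simp: fun_eq_iff surface_def)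
qed

lemma ev2_coord:
  assumes "x * y = poly p z"
  shows "ev2 const_fun Q (coord_x p) (coord_z p) (x, y, z) = poly (poly Q [:x:]) z"
  using assms
  by (induction Q) (auto simp: ev_coord_z on_surface_def surface_def coord_x_def algebra_simps)

text \<open>
  Both conditions say that the common polynomial in \<open>x\<close> and \<open>z\<close> is zero: a polynomial that vanishes
  for all \<open>x \<noteq> 0\<close> and all \<open>z\<close> is zero, and a regular function that vanishes for \<open>x \<noteq> 0\<close> is zero.
\<close>

lemma represents_zero_iff: "represents f e \<Longrightarrow> f = 0 \<longleftrightarrow> e = 0"
proof -
  assume represents: "represents f e"
  then obtain N Q where NQ: "coord_x p ^ N * f = ev2 const_fun Q (coord_x p) (coord_z p)" "sx ^ N * e = ev2 con Q sx sz"
    by (rule represents_clear)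
  show ?thesis
  proof
    assume "f = 0"
    then have ev: "ev2 const_fun Q (coord_x p) (coord_z p) = 0" using NQ(1) by simp
    have "poly Q [:x:] = 0" if "x \<noteq> 0" for x
    proof -
      have "poly (poly Q [:x:]) z = 0" for z
        using ev2_coord[of x "poly p z / x" z Q] that ev by (simp add: zero_fun_def)
      then show ?thesis using poly_all_0_iff_0 by blast
    qed
    then have "(\<lambda>x. [:x:]) ` (- {0}) \<subseteq> {q. poly Q q = 0}" by auto
    moreover have "infinite ((\<lambda>x. [:x:]) ` (- {0 :: complex}))"
    proof -
      have "infinite (- {0 :: complex})" by (simp add: infinite_UNIV_char_0 Compl_eq_Diff_UNIV)
      then show ?thesis by (simp add: finite_image_iff inj_on_def)
    qed
    ultimately have "Q = 0" using poly_roots_finite[of Q] finite_subset by blast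
    then show "e = 0" using NQ(2) by simp
  next
    assume "e = 0"
    then have "Q = 0" using NQ(2) ev2_eq_0[of Q] by simp
    then have *: "coord_x p ^ N * f = 0" using NQ(1) by simp
    show "f = 0"
    proof (rule regular_eq_0I[OF represents_regular[OF represents]])
      fix x y z :: complex assume "x \<noteq> 0" "x * y = poly p z"
      moreover have "(coord_x p ^ n) v = coord_x p v ^ n" for n v by (induction n) simp_all
      ultimately show "f (x, y, z) = 0"
        using fun_cong[OF *, of "(x, y, z)"] by (simp add: coord_x_def on_surface_def surface_def)
    qed
  qed
qed

lemma represents_unique: "represents f e \<Longrightarrow> represents f' e' \<Longrightarrow> f = f' \<longleftrightarrow> e = e'"
proof -
  assume *: "represents f e" "represents f' e'"
  then have "represents (f + const_fun (-1) * f') (e + con (-1) * e')" by (intro corr.intros)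
  moreover have "const_fun (-1) * f' = - f'"
    using scal_const_fun[OF represents_regular[OF *(2)], of "-1"] by (auto simp: scal_def fun_eq_iff)
  ultimately have "represents (f - f') (e - e')" by (simp add: con_minus)
  from represents_zero_iff[OF this] show ?thesis by simp
qed

definition ser_of :: "func \<Rightarrow> ser" where "ser_of f = (THE e. represents f e)"
definition fun_of :: "ser \<Rightarrow> func" where "fun_of e = (THE f. represents f e)"

lemma ser_of_eqI: "represents f e \<Longrightarrow> ser_of f = e"
  unfolding ser_of_def using represents_unique by blast
lemma fun_of_eqI: "represents f e \<Longrightarrow> fun_of e = f"
  unfolding fun_of_def using represents_unique by blast
lemma represents_ser_of: "f \<in> regular p \<Longrightarrow> represents f (ser_of f)"
  using regular_ex_represents ser_of_eqI by metis
lemma represents_fun_of: "e \<in> alg \<Longrightarrow> represents (fun_of e) e"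
  using alg_ex_represents fun_of_eqI by metis

lemma ser_of_alg: "f \<in> regular p \<Longrightarrow> ser_of f \<in> alg"
  using represents_ser_of represents_alg by blast
lemma fun_of_regular: "e \<in> alg \<Longrightarrow> fun_of e \<in> regular p"
  using represents_fun_of represents_regular by blast
lemma fun_of_ser_of [simp]: "f \<in> regular p \<Longrightarrow> fun_of (ser_of f) = f"
  by (rule fun_of_eqI, rule represents_ser_of)
lemma ser_of_fun_of [simp]: "e \<in> alg \<Longrightarrow> ser_of (fun_of e) = e"
  by (rule ser_of_eqI, rule represents_fun_of)

lemma ser_of_inj: "f \<in> regular p \<Longrightarrow> g \<in> regular p \<Longrightarrow> ser_of f = ser_of g \<Longrightarrow> f = g"
  by (metis fun_of_ser_of)

lemma ser_of_coords [simp]: "ser_of (coord_x p) = sx" "ser_of (coord_y p) = sy" "ser_of (coord_z p) = sz"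
  "ser_of (const_fun c) = con c"
  by (rule ser_of_eqI, rule corr.intros)+

lemma ser_of_add: "f \<in> regular p \<Longrightarrow> g \<in> regular p \<Longrightarrow> ser_of (f + g) = ser_of f + ser_of g"
  and ser_of_mult: "f \<in> regular p \<Longrightarrow> g \<in> regular p \<Longrightarrow> ser_of (f * g) = ser_of f * ser_of g"
  by (rule ser_of_eqI, intro corr.intros represents_ser_of, assumption+)+

lemma ser_of_scal: "f \<in> regular p \<Longrightarrow> ser_of (scal c f) = con c * ser_of f"
  by (simp add: scal_const_fun ser_of_mult const_fun_regular)

lemma ser_of_0 [simp]: "ser_of 0 = 0"
  using ser_of_scal[OF regular_zero, of 0] by (simp add: scal_def zero_fun_def)

lemma ser_of_diff: "f \<in> regular p \<Longrightarrow> g \<in> regular p \<Longrightarrow> ser_of (f - g) = ser_of f - ser_of g"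
  using ser_of_add[of "f - g" g] by (simp add: regular_diff)

lemma ser_of_eq_0_iff: "f \<in> regular p \<Longrightarrow> ser_of f = 0 \<longleftrightarrow> f = 0"
  using ser_of_inj[OF _ regular_zero] by auto

lemma ser_of_poly_z: "ser_of (on_surface p (\<lambda>(x, y, z). poly q z)) = ev con q sz"
proof (induction q)
  case (pCons a q)
  have "on_surface p (\<lambda>(x, y, z). poly (pCons a q) z) = const_fun a + coord_z p * on_surface p (\<lambda>(x, y, z). poly q z)"
    by (auto simp: fun_eq_iff on_surface_def const_fun_def coord_z_def)
  with pCons.IH show ?case
    by (simp only: ser_of_add ser_of_mult const_fun_regular regular_mult regular_coord regular_poly_z ser_of_coords con.ev_pCons)
qed (simp add: on_surface_def case_prod_unfold zero_fun_def[symmetric] cong: if_cong)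

end

section \<open>Vector fields on the surface\<close>

context danielewski
begin

definition oper_of :: "(ser \<Rightarrow> ser) \<Rightarrow> oper" where
  "oper_of \<delta> = (\<lambda>f. if f \<in> regular p then fun_of (\<delta> (ser_of f)) else 0)"

lemma ser_of_oper_of:
  "f \<in> regular p \<Longrightarrow> \<delta> (ser_of f) \<in> alg \<Longrightarrow> ser_of (oper_of \<delta> f) = \<delta> (ser_of f)"
  by (simp add: oper_of_def)

lemma oper_of_vec:
  assumes "ser_derivation \<delta>" and alg: "\<And>e. e \<in> alg \<Longrightarrow> \<delta> e \<in> alg"
  shows "oper_of \<delta> \<in> vec p"
proof -
  interpret ser_derivation \<delta> by (rule assms(1))
  have reg: "oper_of \<delta> f \<in> regular p" if "f \<in> regular p" for f
    using that by (simp add: oper_of_def fun_of_regular alg ser_of_alg)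
  have ser: "ser_of (oper_of \<delta> f) = \<delta> (ser_of f)" if "f \<in> regular p" for f
    using that by (simp add: ser_of_oper_of alg ser_of_alg)
  have "oper_of \<delta> (f + g) = oper_of \<delta> f + oper_of \<delta> g"
    "oper_of \<delta> (f * g) = f * oper_of \<delta> g + g * oper_of \<delta> f" if "f \<in> regular p" "g \<in> regular p" for f g
    using that by (auto intro!: ser_of_inj regular_add regular_mult reg
        simp: ser ser_of_add ser_of_mult regular_add regular_mult reg add mult)
  moreover have "oper_of \<delta> (scal c f) = scal c (oper_of \<delta> f)" if "f \<in> regular p" for c f
    using that by (auto intro!: ser_of_inj regular_scal reg simp: ser ser_of_scal regular_scal reg con_times)
  ultimately show ?thesis
    by (auto simp: vec_def reg) (simp_all add: oper_of_def)
qed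

text \<open>
  The components \<open>\<alpha>\<close> and \<open>\<gamma>\<close> of a vector field in the sense of \<open>vfield\<close>.
\<close>

definition xpart :: "oper \<Rightarrow> ser" where "xpart D = ser_of (D (coord_x p)) / sx"
definition zpart :: "oper \<Rightarrow> ser" where "zpart D = ser_of (D (coord_z p))"
abbreviation "lift D \<equiv> vfield (xpart D) (zpart D)"

lemma ser_of_vec:
  assumes D: "D \<in> vec p" and f: "f \<in> regular p"
  shows "ser_of (D f) = lift D (ser_of f)"
proof -
  interpret L: ser_derivation "lift D" by (rule ser_derivation_vfield)
  note reg = vec_regular[OF D] regular_coord
  have x: "ser_of (D (coord_x p)) = lift D sx" by (simp add: vfield_coordinates xpart_def)
  have z: "ser_of (D (coord_z p)) = lift D sz" by (simp add: vfield_coordinates zpart_def)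
  have eq: "coord_x p * D (coord_y p) + coord_y p * D (coord_x p)
      = on_surface p (\<lambda>(x, y, z). poly (pderiv p) z) * D (coord_z p)"
  proof -
    have "coord_x p * coord_y p = on_surface p (\<lambda>(x, y, z). poly p z)"
      by (auto simp: coord_x_def coord_y_def on_surface_def fun_eq_iff surface_def)
    then show ?thesis using vec_mult[OF D regular_coord(1,2)] vec_poly_z[OF D, of p] by simp
  qed
  have "sx * ser_of (D (coord_y p)) + sy * lift D sx = ev con (pderiv p) sz * lift D sz"
    using arg_cong[OF eq, of ser_of]
    by (simp add: ser_of_add ser_of_mult ser_of_poly_z regular_mult regular_poly_z reg x z)
  also have "\<dots> = lift D (sx * sy)" by (simp add: sx_sy L.ev)
  also have "\<dots> = sx * lift D sy + sy * lift D sx" by (rule L.mult)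
  finally have y: "ser_of (D (coord_y p)) = lift D sy" by simp
  have const_fun: "D (const_fun c) = 0" for c
  proof -
    have "const_fun c = scal c (on_surface p 1)" by (auto simp: const_fun_def on_surface_def scal_def fun_eq_iff)
    then have "D (const_fun c) = scal c 0" using vec_scal[OF D regular_one, of c] vec_one[OF D] by simp
    then show ?thesis by (simp add: scal_def zero_fun_def)
  qed
  from f show ?thesis
  proof (induction rule: regular_induct)
    case (add f g)
    have "ser_of (D (f + g)) = ser_of (D f) + ser_of (D g)"
      unfolding vec_add[OF D add(1,2)] by (rule ser_of_add[OF vec_regular[OF D add(1)] vec_regular[OF D add(2)]])
    then show ?case by (simp only: add ser_of_add L.add)
  next
    case (mult f g)
    have "ser_of (D (f * g)) = ser_of f * ser_of (D g) + ser_of g * ser_of (D f)"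
      unfolding vec_mult[OF D mult(1,2)]
      by (simp only: ser_of_add ser_of_mult regular_mult mult(1,2) vec_regular[OF D])
    then show ?case by (simp only: mult ser_of_mult L.mult)
  qed (simp_all only: const_fun x y z ser_of_coords ser_of_0 L.con)
qed

lemma lift_alg:
  assumes "D \<in> vec p" "e \<in> alg"
  shows "lift D e \<in> alg"
proof -
  have "ser_of (D (fun_of e)) = lift D e"
    using ser_of_vec[OF assms(1) fun_of_regular[OF assms(2)]] assms(2) by simp
  then show ?thesis using ser_of_alg[OF vec_regular[OF assms(1) fun_of_regular[OF assms(2)]]] by simp
qed

lemma vec_eqI:
  assumes "D \<in> vec p" "E \<in> vec p" "xpart D = xpart E" "zpart D = zpart E"
  shows "D = E"
proof
  fix f show "D f = E f"
  proof (cases "f \<in> regular p")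
    case True
    have "ser_of (D f) = ser_of (E f)"
      by (simp only: ser_of_vec[OF assms(1) True] ser_of_vec[OF assms(2) True] assms(3,4))
    then show ?thesis
      by (rule ser_of_inj[OF vec_regular[OF assms(1) True] vec_regular[OF assms(2) True]])
  next
    case False
    show ?thesis unfolding vec_outside[OF assms(1) False] vec_outside[OF assms(2) False] ..
  qed
qed

lemma oper_of_parts:
  assumes "ser_derivation \<delta>" "\<And>e. e \<in> alg \<Longrightarrow> \<delta> e \<in> alg"
  shows "xpart (oper_of \<delta>) = \<delta> sx / sx" "zpart (oper_of \<delta>) = \<delta> sz"
  by (simp_all add: xpart_def zpart_def ser_of_oper_of regular_coord assms(2) alg_x alg_z)

definition ham :: "ser \<Rightarrow> oper" where "ham h = oper_of (br h)"

lemma ham_vec: "h \<in> alg \<Longrightarrow> ham h \<in> vec p"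
  unfolding ham_def by (rule oper_of_vec[OF br.ser_derivation_axioms]) (rule alg_br)

lemma ser_of_ham: "h \<in> alg \<Longrightarrow> f \<in> regular p \<Longrightarrow> ser_of (ham h f) = br h (ser_of f)"
  by (simp add: ham_def ser_of_oper_of alg_br ser_of_alg)

lemma ham_parts: "h \<in> alg \<Longrightarrow> xpart (ham h) = - dz h" "h \<in> alg \<Longrightarrow> zpart (ham h) = eu h"
  unfolding ham_def by (simp_all add: oper_of_parts[OF br.ser_derivation_axioms] alg_br) (simp_all add: br_def)

lemma ham_outside: "f \<notin> regular p \<Longrightarrow> ham h f = 0"
  by (simp add: ham_def oper_of_def)

lemma oper_eqI:
  assumes "\<And>f. f \<notin> regular p \<Longrightarrow> D f = E f" "\<And>f. f \<in> regular p \<Longrightarrow> D f \<in> regular p"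
    "\<And>f. f \<in> regular p \<Longrightarrow> E f \<in> regular p" "\<And>f. f \<in> regular p \<Longrightarrow> ser_of (D f) = ser_of (E f)"
  shows "D = E"
  using assms ser_of_inj by (intro ext) metis

lemma ham_regular: "h \<in> alg \<Longrightarrow> f \<in> regular p \<Longrightarrow> ham h f \<in> regular p"
  using vec_regular[OF ham_vec] .

lemma ham_add: "g \<in> alg \<Longrightarrow> h \<in> alg \<Longrightarrow> ham (g + h) = ham g + ham h"
  by (rule oper_eqI)
     (simp_all add: ham_outside ham_regular regular_add alg_add ser_of_ham ser_of_add br_add_left)

lemma ham_con_times: "h \<in> alg \<Longrightarrow> ham (con c * h) = oscal c (ham h)"
  by (rule oper_eqI)
     (simp_all add: oscal_def scal_def zero_fun_def[symmetric] ham_outside ham_regular regular_scal[unfolded scal_def] alg_mult alg_con ser_of_ham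
       ser_of_scal[unfolded scal_def] br_con_times_left)

lemma ham_br: "g \<in> alg \<Longrightarrow> h \<in> alg \<Longrightarrow> ham (br g h) = bracket (ham g) (ham h)"
  using vec_zero[OF ham_vec]
  by (intro oper_eqI)
     (simp_all add: bracket_def ham_outside ham_regular regular_diff alg_br ser_of_ham ser_of_diff br_jacobi)

lemma ham_con: "ham (con c) = 0"
  by (rule oper_eqI) (simp_all add: ham_outside ham_regular alg_con regular_zero ser_of_ham)

lemma ham_eq_iff: "g \<in> alg \<Longrightarrow> h \<in> alg \<Longrightarrow> ham g = ham h \<longleftrightarrow> (\<exists>c. g = h + con c)"
proof
  assume gh: "g \<in> alg" "h \<in> alg" "ham g = ham h"
  then have "eu (g - h) = 0" "dz (g - h) = 0"
    using ham_parts[OF gh(1)] ham_parts[OF gh(2)] by (simp_all add: eu.diff dz.diff)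
  then show "\<exists>c. g = h + con c" using constants by (metis add.commute diff_add_cancel)
next
  assume "g \<in> alg" "h \<in> alg" "\<exists>c. g = h + con c"
  then show "ham g = ham h" by (auto simp: ham_add alg_con ham_con)
qed

text \<open>
  The three local expressions are glued by \<open>1 = u(z) x y + v(z) p'(z)\<close> into one regular function.
\<close>

lemma omega_regular_ser:
  assumes D: "D \<in> vec p" and E: "E \<in> vec p"
  shows "omega p D E \<in> regular p" "ser_of (omega p D E) = xpart D * zpart E - zpart D * xpart E"
proof -
  obtain u v where uv: "u * p + v * pderiv p = 1" using bezout by blast
  let ?q = "\<lambda>q. on_surface p (\<lambda>(x, y, z). poly q z)"
  have dw: "dwedge f g D E \<in> regular p" if "f \<in> regular p" "g \<in> regular p" for f g
    unfolding dwedge_def by (intro regular_diff regular_mult vec_regular[OF D] vec_regular[OF E] that)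
  have off: "omega p D E w = 0" if "w \<notin> surface p" for w
    using regular_outside[OF dw[OF regular_coord(1,3)] that] regular_outside[OF dw[OF regular_coord(2,3)] that]
      regular_outside[OF dw[OF regular_coord(1,2)] that]
    by (cases w) (auto simp: omega_def)
  have "omega p D E w = (?q u * coord_y p * dwedge (coord_x p) (coord_z p) D E
      + ?q v * dwedge (coord_x p) (coord_y p) D E) w" for w
  proof (cases "w \<in> surface p")
    case True
    obtain x y z where w: "w = (x, y, z)" by (cases w)
    have xy: "x * y = poly p z" using True by (simp add: w surface_def)
    note charts = omega_charts[OF squarefree D E True[unfolded w]]
    have "poly (u * p + v * pderiv p) z = 1" by (simp add: uv)
    then have "omega p D E w = (poly u z * (x * y) + poly v z * poly (pderiv p) z) * omega p D E w"
      by (simp add: xy)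
    also have "\<dots> = poly u z * y * (x * omega p D E (x, y, z)) + poly v z * (poly (pderiv p) z * omega p D E (x, y, z))"
      by (simp add: w algebra_simps)
    finally show ?thesis using True by (simp add: charts w on_surface_def coord_y_def)
  next
    case False
    then show ?thesis using off by (simp add: on_surface_def coord_y_def)
  qed
  then have "omega p D E = ?q u * coord_y p * dwedge (coord_x p) (coord_z p) D E + ?q v * dwedge (coord_x p) (coord_y p) D E"
    by blast
  then show reg: "omega p D E \<in> regular p"
    by (simp only:) (intro regular_add regular_mult regular_poly_z regular_coord dw)
  have "coord_x p * omega p D E = dwedge (coord_x p) (coord_z p) D E"
  proof
    fix w show "(coord_x p * omega p D E) w = dwedge (coord_x p) (coord_z p) D E w"
    proof (cases "w \<in> surface p")
      case True
      then show ?thesis using omega_charts(1)[OF squarefree D E] by (cases w) (auto simp: coord_x_def on_surface_def)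
    next
      case False
      then show ?thesis using regular_outside[OF dw[OF regular_coord(1,3)]] off by simp
    qed
  qed
  from arg_cong[OF this, of ser_of]
  have "sx * ser_of (omega p D E) = sx * (xpart D * zpart E - zpart D * xpart E)"
    by (simp add: ser_of_mult ser_of_diff regular_coord reg dwedge_def regular_mult vec_regular[OF D] vec_regular[OF E]
        ser_of_vec[OF D] ser_of_vec[OF E] vfield_coordinates algebra_simps)
  then show "ser_of (omega p D E) = xpart D * zpart E - zpart D * xpart E" by simp
qed

lemma bracket_parts:
  assumes D: "D \<in> vec p" and E: "E \<in> vec p"
  shows "xpart (bracket D E) = lift D (xpart E) - lift E (xpart D)"
    "zpart (bracket D E) = lift D (zpart E) - lift E (zpart D)"
proof -
  interpret D: ser_derivation "lift D" by (rule ser_derivation_vfield)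
  interpret E: ser_derivation "lift E" by (rule ser_derivation_vfield)
  have *: "ser_of (bracket D E f) = lift D (lift E (ser_of f)) - lift E (lift D (ser_of f))" if "f \<in> regular p" for f
    using that by (simp add: bracket_def ser_of_diff ser_of_vec D E vec_regular[OF D] vec_regular[OF E])
  show "zpart (bracket D E) = lift D (zpart E) - lift E (zpart D)"
    unfolding zpart_def[of "bracket D E"] by (simp add: * regular_coord vfield_coordinates)
  show "xpart (bracket D E) = lift D (xpart E) - lift E (xpart D)"
    unfolding xpart_def[of "bracket D E"]
    by (simp add: * regular_coord vfield_coordinates D.mult E.mult field_simps)
qed

text \<open>
  The invariant formula for the exterior derivative turns into an identity between \<open>eu\<close> and \<open>dz\<close> of the
  components. The factor is unique because the volume form is nonzero on the Hamiltonian fields of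
  \<open>x\<close> and \<open>z\<close>.
\<close>

lemma divergence_ser:
  assumes T: "T \<in> vec p"
  shows "divergence p T = fun_of (eu (xpart T) + dz (zpart T))"
proof -
  define d where "d = eu (xpart T) + dz (zpart T)"
  have dA: "d \<in> alg" unfolding d_def by (rule vfield_divergence_alg) (rule lift_alg[OF T])
  have main: "ext_deriv (contract T (omega p)) D E = fun_of d * omega p D E"
    if D: "D \<in> vec p" and E: "E \<in> vec p" for D E
  proof (rule ser_of_inj)
    have DE: "bracket D E \<in> vec p"
      using vec_lie_subalgebra D E unfolding lie_subalgebra_def by blast
    note reg = omega_regular_ser(1)[OF T] omega_regular_ser(1)[OF D E] vec_regular[OF D] vec_regular[OF E]
      fun_of_regular[OF dA]
    show "ext_deriv (contract T (omega p)) D E \<in> regular p"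
      unfolding ext_deriv_def contract_def by (intro regular_diff reg D E DE)
    show "fun_of d * omega p D E \<in> regular p" by (intro regular_mult reg)
    interpret D: ser_derivation "lift D" by (rule ser_derivation_vfield)
    interpret E: ser_derivation "lift E" by (rule ser_derivation_vfield)
    have "ser_of (ext_deriv (contract T (omega p)) D E)
        = lift D (xpart T * zpart E - zpart T * xpart E) - lift E (xpart T * zpart D - zpart T * xpart D)
          - (xpart T * (lift D (zpart E) - lift E (zpart D)) - zpart T * (lift D (xpart E) - lift E (xpart D)))"
      by (simp add: ext_deriv_def contract_def ser_of_diff regular_diff reg D E DE
          ser_of_vec omega_regular_ser(2)[OF T] bracket_parts)
    also have "\<dots> = d * (xpart D * zpart E - zpart D * xpart E)"
      unfolding d_def vfield_def by (simp add: eu.diff dz.diff eu.mult dz.mult algebra_simps)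
    also have "\<dots> = ser_of (fun_of d * omega p D E)"
      by (simp add: ser_of_mult reg dA omega_regular_ser(2)[OF D E])
    finally show "ser_of (ext_deriv (contract T (omega p)) D E) = ser_of (fun_of d * omega p D E)" .
  qed
  show ?thesis
    unfolding divergence_def d_def[symmetric]
  proof (rule the_equality)
    show "fun_of d \<in> regular p \<and>
      (\<forall>D\<in>vec p. \<forall>E\<in>vec p. ext_deriv (contract T (omega p)) D E = fun_of d * omega p D E)"
      using main fun_of_regular[OF dA] by blast
  next
    fix g assume g: "g \<in> regular p \<and>
      (\<forall>D\<in>vec p. \<forall>E\<in>vec p. ext_deriv (contract T (omega p)) D E = g * omega p D E)"
    let ?D = "ham sx" and ?E = "ham sz"
    have DE: "?D \<in> vec p" "?E \<in> vec p" by (rule ham_vec, rule alg_x alg_z)+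
    have "g * omega p ?D ?E = fun_of d * omega p ?D ?E"
      using g main DE by metis
    from arg_cong[OF this, of ser_of]
    have "ser_of g * sx = d * sx"
      using g dA by (simp add: ser_of_mult fun_of_regular omega_regular_ser[OF DE] ham_parts alg_x alg_z)
    then show "g = fun_of d" using g by (metis coordinates(5) fun_of_ser_of mult_cancel_right)
  qed
qed

lemma vec0_iff: "T \<in> vec0 p \<longleftrightarrow> T \<in> vec p \<and> eu (xpart T) + dz (zpart T) = 0"
proof -
  have "fun_of e = 0 \<longleftrightarrow> e = 0" if "e \<in> alg" for e
    using ser_of_eq_0_iff[OF fun_of_regular[OF that]] that by auto
  moreover have "eu (xpart T) + dz (zpart T) \<in> alg" if "T \<in> vec p"
    by (rule vfield_divergence_alg) (rule lift_alg[OF that])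
  ultimately show ?thesis unfolding vec0_def using divergence_ser by auto
qed

lemma vec0_hamiltonian: "vec0 p = ham ` alg"
proof
  show "vec0 p \<subseteq> ham ` alg"
  proof
    fix T assume "T \<in> vec0 p"
    then have T: "T \<in> vec p" and div: "eu (xpart T) + dz (zpart T) = 0" by (simp_all add: vec0_iff)
    obtain h where h: "h \<in> alg" "eu h = zpart T" "dz h = - xpart T"
      using divergence_free_hamiltonian[OF lift_alg[OF T] div] by blast
    have "T = ham h" by (rule vec_eqI[OF T ham_vec]) (simp_all add: h ham_parts)
    with h show "T \<in> ham ` alg" by blast
  qed
  show "ham ` alg \<subseteq> vec0 p"
  proof
    fix T assume "T \<in> ham ` alg"
    then obtain h where "h \<in> alg" "T = ham h" by blast
    then show "T \<in> vec0 p" by (simp add: vec0_iff ham_vec ham_parts eu.minus eu_dz)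
  qed
qed

lemma funpow_vec:
  assumes D: "D \<in> vec p" and f: "f \<in> regular p"
  shows "(D ^^ n) f \<in> regular p" "ser_of ((D ^^ n) f) = (lift D ^^ n) (ser_of f)"
proof -
  have "(D ^^ n) f \<in> regular p \<and> ser_of ((D ^^ n) f) = (lift D ^^ n) (ser_of f)"
    by (induction n) (simp_all add: f D vec_regular[OF D] ser_of_vec)
  then show "(D ^^ n) f \<in> regular p" "ser_of ((D ^^ n) f) = (lift D ^^ n) (ser_of f)" by auto
qed

lemma lnd_iff: "D \<in> lnd p \<longleftrightarrow> D \<in> vec p \<and> alg \<subseteq> nilpotents (lift D)"
proof -
  have "(\<forall>f\<in>regular p. \<exists>n. (D ^^ n) f = 0) \<longleftrightarrow> alg \<subseteq> nilpotents (lift D)" if D: "D \<in> vec p"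
  proof
    assume *: "\<forall>f\<in>regular p. \<exists>n. (D ^^ n) f = 0"
    show "alg \<subseteq> nilpotents (lift D)"
    proof
      fix e assume "e \<in> alg"
      then obtain n where "(D ^^ n) (fun_of e) = 0" using * fun_of_regular by blast
      then have "(lift D ^^ n) e = 0"
        using funpow_vec(2)[OF D fun_of_regular[OF \<open>e \<in> alg\<close>], of n] \<open>e \<in> alg\<close> by simp
      then show "e \<in> nilpotents (lift D)" by (auto simp: nilpotents_def)
    qed
  next
    assume *: "alg \<subseteq> nilpotents (lift D)"
    show "\<forall>f\<in>regular p. \<exists>n. (D ^^ n) f = 0"
    proof
      fix f assume f: "f \<in> regular p"
      then obtain n where "(lift D ^^ n) (ser_of f) = 0" using * ser_of_alg by (auto simp: nilpotents_def)
      then have "(D ^^ n) f = 0" using funpow_vec[OF D f, of n] ser_of_eq_0_iff by metis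
      then show "\<exists>n. (D ^^ n) f = 0" by blast
    qed
  qed
  then show ?thesis by (auto simp: lnd_def)
qed

lemma lnd_vec0: "lnd p \<subseteq> vec0 p"
  using locally_nilpotent_divergence_free[OF lift_alg] by (auto simp: lnd_iff vec0_iff)

lemma vec0_lie_subalgebra: "lie_subalgebra p (vec0 p)"
proof -
  have "0 = ham (con 0)" by (rule ham_con[symmetric])
  then have "0 \<in> vec0 p" unfolding vec0_hamiltonian using alg_con by blast
  moreover have "vec0 p \<subseteq> vec p" by (auto simp: vec0_def)
  ultimately show ?thesis
    unfolding lie_subalgebra_def
    by (auto simp: vec0_hamiltonian simp flip: ham_add ham_con_times ham_br intro!: imageI alg_add alg_mult alg_con alg_br)
qed

lemma lnd_algebra_lie_subalgebra: "lie_subalgebra p (lnd_algebra p)"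
  unfolding lnd_algebra_def hull_def
proof -
  let ?S = "{L. lie_subalgebra p L \<and> lnd p \<subseteq> L}"
  have mem: "vec0 p \<in> ?S" using vec0_lie_subalgebra lnd_vec0 by blast
  have "vec0 p \<subseteq> vec p" by (auto simp: vec0_def)
  then have "\<Inter>?S \<subseteq> vec p" using Inter_lower[OF mem] by (rule order_trans[rotated])
  then show "lie_subalgebra p (\<Inter>?S)"
    unfolding lie_subalgebra_def[of p "\<Inter>?S"]
  proof (intro conjI ballI allI)
    show "0 \<in> \<Inter>?S" by (rule InterI) (simp add: lie_subalgebra_def)
    show "oscal c D \<in> \<Inter>?S" if D: "D \<in> \<Inter>?S" for c D
    proof (rule InterI)
      fix L assume L: "L \<in> ?S"
      with D have "D \<in> L" by (rule InterD)
      with L show "oscal c D \<in> L" by (simp add: lie_subalgebra_def)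
    qed
    fix D E assume DE: "D \<in> \<Inter>?S" "E \<in> \<Inter>?S"
    show "D + E \<in> \<Inter>?S"
    proof (rule InterI)
      fix L assume L: "L \<in> ?S"
      with DE have "D \<in> L" "E \<in> L" by (blast dest: InterD)+
      with L show "D + E \<in> L" by (simp add: lie_subalgebra_def)
    qed
    show "bracket D E \<in> \<Inter>?S"
    proof (rule InterI)
      fix L assume L: "L \<in> ?S"
      with DE have "D \<in> L" "E \<in> L" by (blast dest: InterD)+
      with L show "bracket D E \<in> L" by (simp add: lie_subalgebra_def)
    qed
  qed
qed

lemma lnd_algebra_vec0: "lnd_algebra p \<subseteq> vec0 p"
  unfolding lnd_algebra_def using lnd_vec0 vec0_lie_subalgebra by (rule hull_minimal)

lemma ham_power_lnd: "ham (sx ^ k) \<in> lnd p" "ham (sy ^ k) \<in> lnd p"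
proof -
  have lift: "lift (ham h) = br h" if "h \<in> alg" for h
    using that by (auto simp: vfield_def ham_parts br_def fun_eq_iff algebra_simps)
  show "ham (sx ^ k) \<in> lnd p" "ham (sy ^ k) \<in> lnd p"
    using power_hamiltonians_nilpotent
    by (simp_all add: lnd_iff lift ham_vec alg_power alg_x alg_y)
qed

end

section \<open>Automorphisms of the surface\<close>

context danielewski
begin

lemma fun_of_add: "e \<in> alg \<Longrightarrow> e' \<in> alg \<Longrightarrow> fun_of (e + e') = fun_of e + fun_of e'"
  and fun_of_mult: "e \<in> alg \<Longrightarrow> e' \<in> alg \<Longrightarrow> fun_of (e * e') = fun_of e * fun_of e'"
  by (rule fun_of_eqI, intro corr.intros represents_fun_of, assumption+)+

lemma fun_of_base [simp]: "fun_of (con c) = const_fun c" "fun_of sx = coord_x p" "fun_of sy = coord_y p" "fun_of sz = coord_z p"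
  by (rule fun_of_eqI, rule corr.intros)+

lemma fun_of_ev: "e \<in> alg \<Longrightarrow> v \<in> surface p \<Longrightarrow> fun_of (ev con q e) v = poly q (fun_of e v)"
proof (induction q)
  case 0
  then show ?case using fun_of_base(1)[of 0] by (simp add: const_fun_def on_surface_def)
next
  case (pCons c q)
  then show ?case
    by (simp add: fun_of_add fun_of_mult alg_con alg_mult alg_ev) (simp add: const_fun_def on_surface_def)
qed

end

text \<open>
  A substitution by regular functions is the comorphism of a map of the surface to itself.
\<close>

locale regular_substitution = substitution +
  assumes X_alg: "X \<in> alg" and Y_alg: "Y \<in> alg" and Z_alg: "Z \<in> alg"
begin

definition point_map :: "point \<Rightarrow> point" where
  "point_map v = (fun_of X v, fun_of Y v, fun_of Z v)"

lemma point_map_surface: "v \<in> surface p \<Longrightarrow> point_map v \<in> surface p"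
proof -
  assume v: "v \<in> surface p"
  have "fun_of X v * fun_of Y v = fun_of (X * Y) v" by (simp add: fun_of_mult X_alg Y_alg)
  also have "\<dots> = poly p (fun_of Z v)" by (simp only: X_Y fun_of_ev[OF Z_alg v])
  finally show ?thesis by (simp add: point_map_def surface_def)
qed

lemma point_map_morphism: "morphism p point_map"
proof -
  have "\<exists>P. \<forall>v\<in>surface p. fun_of e v = poly3 P v" if "e \<in> alg" for e
    using regularE[OF fun_of_regular[OF that]] by (metis on_surface_def)
  then obtain P Q R where "\<forall>v\<in>surface p. fun_of X v = poly3 P v" "\<forall>v\<in>surface p. fun_of Y v = poly3 Q v"
    "\<forall>v\<in>surface p. fun_of Z v = poly3 R v" using X_alg Y_alg Z_alg by meson
  then have "\<forall>v\<in>surface p. point_map v = (poly3 P v, poly3 Q v, poly3 R v)" by (simp add: point_map_def)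
  then show ?thesis unfolding morphism_def using point_map_surface by blast
qed

lemmas sub_alg' = sub_alg[OF X_alg Y_alg Z_alg]

lemma comorphism_point_map: "f \<in> regular p \<Longrightarrow> comorphism p point_map f = fun_of (sub (ser_of f))"
proof (induction rule: regular_induct)
  case (con c)
  show ?case unfolding ser_of_coords sub_con fun_of_base
    using point_map_surface by (auto simp: comorphism_def on_surface_def const_fun_def fun_eq_iff)
next
  case x
  show ?case unfolding ser_of_coords sub_x
    using point_map_surface regular_outside[OF fun_of_regular[OF X_alg]]
    by (auto simp: comorphism_def on_surface_def coord_x_def fun_eq_iff point_map_def)
next
  case y
  show ?case unfolding ser_of_coords sub_y
    using point_map_surface regular_outside[OF fun_of_regular[OF Y_alg]]
    by (auto simp: comorphism_def on_surface_def coord_y_def fun_eq_iff point_map_def)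
next
  case z
  show ?case unfolding ser_of_coords sub_z
    using point_map_surface regular_outside[OF fun_of_regular[OF Z_alg]]
    by (auto simp: comorphism_def on_surface_def coord_z_def fun_eq_iff point_map_def)
next
  case (add f g)
  have "comorphism p point_map (f + g) = comorphism p point_map f + comorphism p point_map g"
    by (auto simp: comorphism_def on_surface_def fun_eq_iff)
  then show ?case
    by (simp only: add ser_of_add sub_add fun_of_add ser_of_alg sub_alg')
next
  case (mult f g)
  have "comorphism p point_map (f * g) = comorphism p point_map f * comorphism p point_map g"
    by (auto simp: comorphism_def on_surface_def fun_eq_iff)
  then show ?case
    by (simp only: mult ser_of_mult sub_mult fun_of_mult ser_of_alg sub_alg')
qed

end

section \<open>Automorphisms of Lie algebras of Hamiltonian fields\<close>

context danielewski
begin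

lemma point_map_inverse:
  assumes "regular_substitution p X Y Z" "regular_substitution p X' Y' Z'"
    and inv: "\<And>e. e \<in> alg \<Longrightarrow> substitution.sub p X' Y' Z' (substitution.sub p X Y Z e) = e"
    and v: "v \<in> surface p"
  shows "regular_substitution.point_map p X Y Z (regular_substitution.point_map p X' Y' Z' v) = v"
proof -
  interpret s: regular_substitution p X Y Z by (rule assms(1))
  interpret s': regular_substitution p X' Y' Z' by (rule assms(2))
  have *: "fun_of (s.sub e) (s'.point_map v) = fun_of e v" if "e \<in> alg" for e
  proof -
    have "fun_of (s.sub e) (s'.point_map v) = comorphism p s'.point_map (fun_of (s.sub e)) v"
      using v by (simp add: comorphism_def on_surface_def)
    also have "\<dots> = fun_of e v"
      using that by (simp add: s'.comorphism_point_map fun_of_regular s.sub_alg' inv)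
    finally show ?thesis .
  qed
  show ?thesis
    using *[OF alg_x] *[OF alg_y] *[OF alg_z] v
    by (cases v) (simp add: s.point_map_def coord_x_def coord_y_def coord_z_def on_surface_def)
qed

text \<open>
  Adding a constant changes the period by that constant, so each Hamiltonian field has exactly one
  potential of period zero. Since brackets have period zero, these potentials form a Lie algebra
  isomorphic to that of the fields.
\<close>

definition potential :: "oper \<Rightarrow> ser" where
  "potential D = (THE f. f \<in> alg \<and> period f = 0 \<and> ham f = D)"

lemma potential_ham:
  assumes "f \<in> alg" "period f = 0"
  shows "potential (ham f) = f"
  unfolding potential_def
proof (rule the_equality)
  fix g assume g: "g \<in> alg \<and> period g = 0 \<and> ham g = ham f"
  then obtain c where c: "g = f + con c" using ham_eq_iff assms(1) by blast
  then have "c = 0" using g assms by (simp add: period_add alg_con period_con)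
  with c show "g = f" by simp
qed (use assms in simp)

lemma potential:
  assumes "D \<in> vec0 p"
  shows "potential D \<in> alg" "period (potential D) = 0" "ham (potential D) = D"
proof -
  from assms obtain h where h: "h \<in> alg" "D = ham h" by (auto simp: vec0_hamiltonian)
  define f where "f = h + con (- period h)"
  have f: "f \<in> alg" "period f = 0" "ham f = D"
    using h by (simp_all add: f_def alg_add alg_con period_add period_con ham_add ham_con)
  with potential_ham[OF f(1,2)] show "potential D \<in> alg" "period (potential D) = 0" "ham (potential D) = D"
    by simp_all
qed

lemma period_powers: "1 \<le> k \<Longrightarrow> period (sx ^ k) = 0" "1 \<le> k \<Longrightarrow> period (sy ^ k) = 0"
proof -
  have "sy ^ k = laur (- int k) (p ^ k)" for k
    by (induction k) (simp_all add: sy_laur laur_mult one_pCons flip: con_laur)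
  then show "1 \<le> k \<Longrightarrow> period (sx ^ k) = 0" "1 \<le> k \<Longrightarrow> period (sy ^ k) = 0"
    by (simp_all add: sx_power_laur period_laur)
qed

lemma lie_embedding_of_automorphism:
  assumes L: "lie_subalgebra p L" "L \<subseteq> vec0 p"
    and powers: "\<And>k. ham (sx ^ k) \<in> L" "\<And>k. ham (sy ^ k) \<in> L"
    and F: "lie_automorphism L F"
  shows "lie_embedding p {f \<in> alg. period f = 0 \<and> ham f \<in> L} (\<lambda>f. potential (F (ham f)))"
proof -
  have L_add: "D + E \<in> L" and L_bracket: "bracket D E \<in> L" and L_scal: "oscal c D \<in> L" if "D \<in> L" "E \<in> L" for D E c
    using L(1) that by (auto simp: lie_subalgebra_def)
  have F_L: "F D \<in> L" if "D \<in> L" for D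
    using F that by (auto simp: lie_automorphism_def bij_betw_def)
  have pot: "potential (F D) \<in> alg" "period (potential (F D)) = 0" "ham (potential (F D)) = F D" if "D \<in> L" for D
    using potential[of "F D"] F_L[OF that] L(2) by auto
  show ?thesis
  proof (unfold_locales)
    fix f g and c and k :: nat
    assume f: "f \<in> {f \<in> alg. period f = 0 \<and> ham f \<in> L}"
    then have fL: "f \<in> alg" "period f = 0" "ham f \<in> L" by auto
    note potf = pot[OF fL(3)]
    show "con c * f \<in> {f \<in> alg. period f = 0 \<and> ham f \<in> L}"
      using fL L_scal by (simp add: alg_mult alg_con period_con_times ham_con_times)
    show "potential (F (ham f)) \<in> {f \<in> alg. period f = 0 \<and> ham f \<in> L}"
      using potf F_L[OF fL(3)] by simp
    show "potential (F (ham (con c * f))) = con c * potential (F (ham f))"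
    proof -
      have "F (ham (con c * f)) = ham (con c * potential (F (ham f)))"
        using F fL potf by (simp add: ham_con_times lie_automorphism_def)
      then show ?thesis
        using potf by (simp add: potential_ham alg_mult alg_con period_con_times)
    qed
    show "f = 0" if "potential (F (ham f)) = 0"
    proof -
      have zero: "ham 0 = 0" using ham_con[of 0] by simp
      have "F (ham f) = 0" using potf(3) that zero by simp
      moreover have "0 \<in> L" using L(1) by (simp add: lie_subalgebra_def)
      moreover have "F 0 = 0"
      proof -
        have "F (oscal 0 0) = oscal 0 (F 0)" using F \<open>0 \<in> L\<close> by (simp add: lie_automorphism_def)
        then show ?thesis by (simp add: oscal_def scal_def zero_fun_def)
      qed
      ultimately have "ham f = ham 0"
        using F fL(3) zero unfolding lie_automorphism_def bij_betw_def inj_on_def by metis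
      then have "f = potential (ham 0)" using potential_ham[OF fL(1,2)] by simp
      also have "\<dots> = 0" by (rule potential_ham[OF alg_0 period_0])
      finally show ?thesis .
    qed
    assume g: "g \<in> {f \<in> alg. period f = 0 \<and> ham f \<in> L}"
    then have gL: "g \<in> alg" "period g = 0" "ham g \<in> L" by auto
    note potg = pot[OF gL(3)]
    show "f + g \<in> {f \<in> alg. period f = 0 \<and> ham f \<in> L}"
      using fL gL L_add by (simp add: alg_add period_add ham_add)
    show "br f g \<in> {f \<in> alg. period f = 0 \<and> ham f \<in> L}"
      using fL gL L_bracket by (simp add: alg_br period_br ham_br)
    have "F (ham (f + g)) = ham (potential (F (ham f)) + potential (F (ham g)))"
      using F fL gL potf potg by (simp add: ham_add lie_automorphism_def)
    then show "potential (F (ham (f + g))) = potential (F (ham f)) + potential (F (ham g))"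
      by (simp only:) (rule potential_ham; use potf potg in \<open>simp add: alg_add period_add\<close>)
    have "F (ham (br f g)) = ham (br (potential (F (ham f))) (potential (F (ham g))))"
      using F fL gL potf potg by (simp add: ham_br lie_automorphism_def)
    then show "potential (F (ham (br f g))) = br (potential (F (ham f))) (potential (F (ham g)))"
      by (simp only:) (rule potential_ham; use potf potg in \<open>simp add: alg_br period_br\<close>)
  qed (use powers period_powers in \<open>auto intro: alg_power alg_x alg_y\<close>)
qed

lemma lie_automorphism_inverse:
  assumes L: "lie_subalgebra p L" and F: "lie_automorphism L F"
  shows "lie_automorphism L (inv_into L F)"
proof -
  let ?G = "inv_into L F"
  have bij: "bij_betw F L L" using F by (simp add: lie_automorphism_def)
  have G: "?G D \<in> L" "F (?G D) = D" if "D \<in> L" for D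
    using that bij by (auto simp: bij_betw_def inv_into_into f_inv_into_f)
  have eq: "?G D = E" if "D = F E" "E \<in> L" for D E
    using that bij by (simp add: bij_betw_def)
  have "?G (D + E) = ?G D + ?G E" "?G (bracket D E) = bracket (?G D) (?G E)" "?G (oscal c D) = oscal c (?G D)"
    if "D \<in> L" "E \<in> L" for D E c
    using F L G[OF that(1)] G[OF that(2)]
    by (intro eq; simp add: lie_automorphism_def lie_subalgebra_def)+
  then show ?thesis using bij_betw_inv_into[OF bij] by (auto simp: lie_automorphism_def)
qed

text \<open>
  Let \<open>s\<close> and \<open>s'\<close> be the substitutions that belong to the automorphism and to its inverse. The
  required map of the surface has comorphism \<open>s'\<close>, so that its adjoint action sends the field of \<open>h\<close> to
  \<open>s {h, s' _} = c {s h, _}\<close>, which is the field of the potential assigned to \<open>h\<close>.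
\<close>

theorem automorphism_is_inner:
  assumes L: "lie_subalgebra p L" "L \<subseteq> vec0 p"
    and powers: "\<And>k. ham (sx ^ k) \<in> L" "\<And>k. ham (sy ^ k) \<in> L"
    and F: "lie_automorphism L F"
  shows "\<exists>\<phi>. variety_automorphism p \<phi> \<and> (\<forall>D\<in>L. F D = Ad p \<phi> D)"
proof -
  define G where "G = inv_into L F"
  have G: "lie_automorphism L G" unfolding G_def by (rule lie_automorphism_inverse[OF L(1) F])
  have bij: "bij_betw F L L" using F by (simp add: lie_automorphism_def)
  have FG: "F (G D) = D" "G (F D) = D" "F D \<in> L" "G D \<in> L" if "D \<in> L" for D
    using that bij by (auto simp: G_def bij_betw_def inv_into_into f_inv_into_f)
  define B where "B = {f \<in> alg. period f = 0 \<and> ham f \<in> L}"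
  define f where "f h = potential (F (ham h))" for h
  define g where "g h = potential (G (ham h))" for h
  interpret f: lie_embedding p B f
    using lie_embedding_of_automorphism[OF L powers F] by (simp add: B_def f_def[abs_def])
  interpret g: lie_embedding p B g
    using lie_embedding_of_automorphism[OF L powers G] by (simp add: B_def g_def[abs_def])
  have fg: "f (g h) = h" "g (f h) = h" if "h \<in> B" for h
  proof -
    have h: "h \<in> alg" "period h = 0" "ham h \<in> L" using that by (auto simp: B_def)
    have "ham (g h) = G (ham h)" "ham (f h) = F (ham h)"
      unfolding f_def g_def by (rule potential(3)[OF subsetD[OF L(2)]], rule FG[OF h(3)])+
    then show "f (g h) = h" "g (f h) = h"
      using potential_ham[OF h(1,2)] FG h(3) by (simp_all add: f_def g_def)
  qed
  obtain c X Y Z where s: "substitution p X Y Z" and A: "X \<in> alg" "Y \<in> alg" "Z \<in> alg"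
    and XZ: "con c * br X Z = X" and f_sub: "\<And>h. h \<in> B \<Longrightarrow> \<exists>e. f h = con c * substitution.sub p X Y Z h + con e"
    using f.F_is_substitution by metis
  obtain c' X' Y' Z' where s': "substitution p X' Y' Z'" and A': "X' \<in> alg" "Y' \<in> alg" "Z' \<in> alg"
    and XZ': "con c' * br X' Z' = X'" and g_sub: "\<And>h. h \<in> B \<Longrightarrow> \<exists>e. g h = con c' * substitution.sub p X' Y' Z' h + con e"
    using g.F_is_substitution by metis
  have rs: "regular_substitution p X Y Z"
    by (rule regular_substitution.intro[OF s]) (unfold_locales, use A in auto)
  have rs': "regular_substitution p X' Y' Z'"
    by (rule regular_substitution.intro[OF s']) (unfold_locales, use A' in auto)
  interpret s: regular_substitution p X Y Z by (rule rs)
  interpret s': regular_substitution p X' Y' Z' by (rule rs')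
  have gens: "h \<in> B" if "h \<in> {sx, sx ^ 2, sy, sy ^ 2}" for h
    using that f.B_x[of 1] f.B_x[of 2] f.B_y_power[of 1] f.B_y_power[of 2] by auto
  have "\<exists>e. h = con (c * c') * s.sub (s'.sub h) + con e" if "h \<in> {sx, sx ^ 2, sy, sy ^ 2}" for h
  proof -
    have hB: "h \<in> B" by (rule gens[OF that])
    then have hA: "h \<in> alg" by (simp add: B_def)
    obtain a where a: "g h = con c' * s'.sub h + con a" using g_sub[OF hB] by blast
    obtain b where "f (g h) = con c * s.sub (g h) + con b" using f_sub[OF g.F_B[OF hB]] by blast
    then have "h = con c * (con c' * s.sub (s'.sub h) + con a) + con b"
      using hA fg(1)[OF hB] by (simp add: a s.sub_add s.sub_mult s'.sub_alg' alg_con alg_mult)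
    then have "h = con (c * c') * s.sub (s'.sub h) + con (c * a + b)"
      by (simp add: con_mult con_add algebra_simps)
    then show ?thesis by blast
  qed
  from substitutions_inverse[OF s s' XZ XZ' A' this]
  have inv: "s.sub (s'.sub h) = h" if "h \<in> alg" for h using that by blast
  have "\<exists>e. h = con (c' * c) * s'.sub (s.sub h) + con e" if "h \<in> {sx, sx ^ 2, sy, sy ^ 2}" for h
  proof -
    have hB: "h \<in> B" by (rule gens[OF that])
    then have hA: "h \<in> alg" by (simp add: B_def)
    obtain a where a: "f h = con c * s.sub h + con a" using f_sub[OF hB] by blast
    obtain b where "g (f h) = con c' * s'.sub (f h) + con b" using g_sub[OF f.F_B[OF hB]] by blast
    then have "h = con c' * (con c * s'.sub (s.sub h) + con a) + con b"
      using hA fg(2)[OF hB] by (simp add: a s'.sub_add s'.sub_mult s.sub_alg' alg_con alg_mult)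
    then have "h = con (c' * c) * s'.sub (s.sub h) + con (c' * a + b)"
      by (simp add: con_mult con_add algebra_simps)
    then show ?thesis by blast
  qed
  from substitutions_inverse[OF s' s XZ' XZ A this]
  have inv': "s'.sub (s.sub h) = h" if "h \<in> alg" for h using that by blast
  let ?\<phi> = "s'.point_map"
  have "variety_automorphism p ?\<phi>"
    unfolding variety_automorphism_def
    using s'.point_map_morphism s.point_map_morphism
      point_map_inverse[OF rs rs' inv'] point_map_inverse[OF rs' rs inv] by blast
  moreover have "F D = Ad p ?\<phi> D" if D: "D \<in> L" for D
  proof
    fix q show "F D q = Ad p ?\<phi> D q"
    proof (cases "q \<in> regular p")
      case False
      have "F D \<in> vec p" using FG(3)[OF D] L(1) by (auto simp: lie_subalgebra_def)
      from vec_outside[OF this False] show ?thesis using False by (simp add: Ad_def)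
    next
      case True
      define h where "h = potential D"
      have h: "h \<in> alg" "period h = 0" "ham h = D" using potential[of D] D L(2) by (auto simp: h_def)
      then have hB: "h \<in> B" using D by (simp add: B_def)
      then obtain e where e: "f h = con c * s.sub h + con e" using f_sub by blast
      have FD: "F D = ham (f h)" using potential(3)[of "F D"] FG(3)[OF D] L(2) by (auto simp: f_def h)
      have inj: "inj_on (comorphism p ?\<phi>) (regular p)"
      proof (rule inj_onI)
        fix a b assume ab: "a \<in> regular p" "b \<in> regular p" "comorphism p ?\<phi> a = comorphism p ?\<phi> b"
        then have "s'.sub (ser_of a) = s'.sub (ser_of b)"
          by (metis s'.comorphism_point_map s'.sub_alg' ser_of_alg ser_of_fun_of)
        then have "ser_of a = ser_of b" using inv ser_of_alg ab by metis
        then show "a = b" using ser_of_inj ab by blast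
      qed
      have sA: "f h \<in> alg" using f.F_B[OF hB] by (simp add: B_def)
      have rF: "F D q \<in> regular p" unfolding FD by (rule ham_regular[OF sA True])
      have "comorphism p ?\<phi> (F D q) = D (comorphism p ?\<phi> q)"
      proof -
        let ?e = "ser_of q"
        have eA: "?e \<in> alg" by (rule ser_of_alg[OF True])
        have "br (f h) ?e = con c * br (s.sub h) (s.sub (s'.sub ?e))"
          by (simp add: e br_add_left br_con_times_left inv eA)
        also have "\<dots> = s.sub (br h (s'.sub ?e))" by (rule s.sub_br[OF XZ h(1) s'.sub_alg'[OF eA]])
        finally have "s'.sub (br (f h) ?e) = br h (s'.sub ?e)"
          by (simp add: inv' alg_br h s'.sub_alg' eA)
        moreover have "comorphism p ?\<phi> (F D q) = fun_of (s'.sub (br (f h) ?e))"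
          using s'.comorphism_point_map[OF rF] ser_of_ham[OF sA True] by (simp add: FD)
        moreover have "D (comorphism p ?\<phi> q) = fun_of (br h (s'.sub ?e))"
          unfolding s'.comorphism_point_map[OF True] h(3)[symmetric]
          by (simp add: ham_def oper_of_def fun_of_regular s'.sub_alg' eA)
        ultimately show ?thesis by simp
      qed
      then have "Ad p ?\<phi> D q = inv_into (regular p) (comorphism p ?\<phi>) (comorphism p ?\<phi> (F D q))"
        using True by (simp add: Ad_def)
      also have "\<dots> = F D q" by (rule inv_into_f_f[OF inj rF])
      finally show ?thesis ..
    qed
  qed
  ultimately show ?thesis by blast
qed

end

theorem theorem3:
  fixes p :: "complex poly"
  assumes "rsquarefree p" and "degree p \<ge> 3"
  shows "(\<forall>F. lie_automorphism (lnd_algebra p) F \<longrightarrow>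
            (\<exists>\<phi>. variety_automorphism p \<phi> \<and> (\<forall>D\<in>lnd_algebra p. F D = Ad p \<phi> D))) \<and>
         (\<forall>F. lie_automorphism (vec0 p) F \<longrightarrow>
            (\<exists>\<phi>. variety_automorphism p \<phi> \<and> (\<forall>D\<in>vec0 p. F D = Ad p \<phi> D)))"
proof -
  interpret danielewski p using assms by unfold_locales
  have lnd: "lnd p \<subseteq> lnd_algebra p" unfolding lnd_algebra_def by (rule hull_subset)
  show ?thesis
  proof (intro conjI allI impI)
    fix F assume "lie_automorphism (lnd_algebra p) F"
    then show "\<exists>\<phi>. variety_automorphism p \<phi> \<and> (\<forall>D\<in>lnd_algebra p. F D = Ad p \<phi> D)"
      by (intro automorphism_is_inner lnd_algebra_lie_subalgebra lnd_algebra_vec0 subsetD[OF lnd] ham_power_lnd)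
  next
    fix F assume "lie_automorphism (vec0 p) F"
    then show "\<exists>\<phi>. variety_automorphism p \<phi> \<and> (\<forall>D\<in>vec0 p. F D = Ad p \<phi> D)"
      by (intro automorphism_is_inner vec0_lie_subalgebra order.refl subsetD[OF lnd_vec0] ham_power_lnd)
  qed
qed

end
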